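(* Let $n > 2$ be an integer, and let $\Lambda_K \subset \mathbb{R}^{\phi(n)}$ be the corresponding ($n$-th) cyclotomic lattice for $K = \mathbb{Q}(\zeta_n)$, where $\zeta_n = e^{2\pi i/n}$. Write $n = \prod_{p \mid n} p^{e_p}$ for the prime factorization of $n$, let $\phi$ be Euler's function, and let $\omega(n)$ be the number of (distinct) prime divisors of $n$. Then the following hold. (1) The maximal coherence of $\Lambda_K$ is $$\mathcal{C}(\Lambda_K) = \begin{cases} 0 & \text{if } n \text{ is a power of } 2,\\ \dfrac{1}{p-1} & \text{if } p \text{ is the smallest odd prime dividing } n. \end{cases}$$ (2) For any $\alpha \in S'(\Lambda_K)$, the average coherences of $\alpha$ and of $\Lambda_K$ satisfy $$\mathcal{A}(\alpha) = \mathcal{A}(\Lambda_K) = \begin{cases} \dfrac{2^{\omega(n)}-1}{n-1} & \text{if } n \text{ is odd},\\[2mm] \dfrac{2^{\omega(n)}-2}{n-2} & \text{if } n \text{ is even}. \end{cases}$$ (3) Combining (2) with the formula $$\nu(\Lambda_K) = \left(\frac{\phi(n)}{\prod_{p \mid n} p^{e_p - \frac{1}{p-1}}}\right)^{\frac{\phi(n)}{2}}$$ for the orthogonality defect of $\Lambda_K$, one obtains an explicit formula for the product measure of $\Lambda_K = \Lambda_{\mathbb{Q}(\zeta_n)}$, which depends only on $n$: $$\Pi(\Lambda_{\mathbb{Q}(\zeta_n)}) = \begin{cases} \dfrac{n (n-2)\, \phi(n)^{\frac{\phi(n)}{2} - 1}}{2\, (2^{\omega(n)} - 2) \left(\prod_{p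 \mid n} p^{e_p - \frac{1}{p-1}}\right)^{\frac{\phi(n)}{2}}} & \text{if } 2 \mid n,\\[4mm] \dfrac{n (n-1)\, \phi(n)^{\frac{\phi(n)}{2} - 1}}{(2^{\omega(n)} - 1) \left(\prod_{p \mid n} p^{e_p - \frac{1}{p-1}}\right)^{\frac{\phi(n)}{2}}} & \text{if } 2 \nmid n. \end{cases}$$
   Context: Lattice notions. Let $L \subset \mathbb{R}^d$ be a lattice of full rank $d$, with the Euclidean norm $\|\cdot\|$ and inner product $\langle\cdot,\cdot\rangle$. Its (squared) minimum is $|L| := \min\{\|x\|^2 : x \in L\setminus\{0\}\}$ and its set of minimal vectors is $S(L) := \{x \in L : \|x\|^2 = |L|\}$. The determinant is $\det(L) := |\det B|$ for any $d\times d$ matrix $B$ with $L = B\mathbb{Z}^d$. The set $S'(L)$ is a subset of $S(L)$ obtained by selecting exactly one vector out of each pair $\pm x$, $x\in S(L)$; the quantities below do not depend on this selection. The maximal coherence of $L$ is $$\mathcal{C}(L) := \max\left\{ \frac{|\langle x,y\rangle|}{\|x\|\,\|y\|} : x \neq y \in S'(L)\right\}.$$ For $x \in S'(L)$, the average coherence of $x$ is $$\mathcal{A}(x) := \frac{1}{|S'(L)|-1} \sum_{y \in S'(L)\setminus\{x\}} \frac{|\langle x,y\rangle|}{\|x\|\,\|y\|},$$ where $|S'(L)|$ is the cardinality of $S'(L)$, and the average coherence of $L$ is $\mathcal{A}(L) := \max\{\mathcal{A}(x) : x \in S'(L)\}$. If $S(L)$ contains a basis $b_1,\dots,b_d$ of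 $L$, the orthogonality defect of $L$ is $$\nu(L) := \frac{\prod_{j=1}^d \|b_j\|}{\det(L)} = \frac{|L|^{d/2}}{\det(L)},$$ and the (orthogonality) product measure of $L$ is $$\Pi(L) := \frac{|S'(L)|\,\nu(L)}{d\,\mathcal{A}(L)}.$$ Cyclotomic lattices. For $n>2$, $K=\mathbb{Q}(\zeta_n)$ has degree $d=\phi(n)$ over $\mathbb{Q}$, ring of integers $\mathcal{O}_K = \mathbb{Z}[\zeta_n]$, and $d/2$ pairs of complex conjugate embeddings $\tau_1,\bar\tau_1,\dots,\tau_{d/2},\bar\tau_{d/2} : K \hookrightarrow \mathbb{C}$. The Minkowski embedding is $$\Sigma_K := (\Re \tau_1, \Im \tau_1,\dots,\Re \tau_{d/2},\Im\tau_{d/2}) : K \hookrightarrow \mathbb{R}^d,$$ and the $n$-th cyclotomic lattice is $\Lambda_K := \Sigma_K(\mathcal{O}_K)$, a lattice of full rank in $\mathbb{R}^d$. Elements $\alpha\in\mathcal{O}_K$ are identified with their images $\Sigma_K(\alpha)\in\Lambda_K$, so that $\langle \alpha,\beta\rangle = \frac12 \mathrm{Tr}_{K/\mathbb{Q}}(\alpha\bar\beta)$. Cyclotomic lattices have bases consisting of minimal vectors, so $\nu(\Lambda_K)$ is defined. *)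

theory Defs
  imports
    "HOL-Computational_Algebra.Computational_Algebra"
    "HOL-Number_Theory.Totient"
    "HOL-Library.Extended_Real"
    "HOL-Library.FuncSet"
    "Jordan_Normal_Form.Determinant"
begin

(* R^d is carrier_vec d :: real vec set, so that the dimension can be the term totient n. *)

definition eucl_norm :: "real vec \<Rightarrow> real" where
  "eucl_norm x = sqrt (x \<bullet> x)"

definition lattice_basis :: "nat \<Rightarrow> real vec set \<Rightarrow> real mat \<Rightarrow> bool" where
  "lattice_basis d L B \<longleftrightarrow>
     B \<in> carrier_mat d d \<and> det B \<noteq> 0 \<and>
     L = {B *\<^sub>v map_vec of_int z | z. z \<in> (carrier_vec d :: int vec set)}"

(* The value does not depend on the basis, so the description is proper
   for every lattice of full rank. *)
definition lattice_det :: "nat \<Rightarrow> real vec set \<Rightarrow> real" where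
  "lattice_det d L = (THE D. \<exists>B. lattice_basis d L B \<and> D = \<bar>det B\<bar>)"

definition sq_minimum :: "nat \<Rightarrow> real vec set \<Rightarrow> real" where
  "sq_minimum d L = (LEAST m. \<exists>x \<in> L - {0\<^sub>v d}. m = (eucl_norm x)\<^sup>2)"

definition min_vectors :: "nat \<Rightarrow> real vec set \<Rightarrow> real vec set" where
  "min_vectors d L = {x \<in> L. (eucl_norm x)\<^sup>2 = sq_minimum d L}"

(* T is an admissible choice of S'(L): one vector out of each pair x, -x in S(L). *)
definition half_selection :: "nat \<Rightarrow> real vec set \<Rightarrow> real vec set \<Rightarrow> bool" where
  "half_selection d L T \<longleftrightarrow>
     T \<subseteq> min_vectors d L \<and> (\<forall>x \<in> min_vectors d L. (x \<in> T) \<noteq> (- x \<in> T))"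

definition coherence :: "real vec \<Rightarrow> real vec \<Rightarrow> real" where
  "coherence x y = \<bar>x \<bullet> y\<bar> / (eucl_norm x * eucl_norm y)"

(* In the following, T is the chosen set S'(L). *)

definition max_coherence :: "real vec set \<Rightarrow> real" where
  "max_coherence T = Max {coherence x y | x y. x \<in> T \<and> y \<in> T \<and> x \<noteq> y}"

definition avg_coherence_at :: "real vec set \<Rightarrow> real vec \<Rightarrow> real" where
  "avg_coherence_at T x = 1 / (real (card T) - 1) * (\<Sum>y \<in> T - {x}. coherence x y)"

definition avg_coherence :: "real vec set \<Rightarrow> real" where
  "avg_coherence T = Max (avg_coherence_at T ` T)"

(* The same value arises from every basis of minimal vectors; meaningful only if one exists. *)
definition orth_defect :: "nat \<Rightarrow> real vec set \<Rightarrow> real" where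
  "orth_defect d L =
     (THE v. \<exists>B. lattice_basis d L B \<and> (\<forall>j<d. col B j \<in> min_vectors d L) \<and>
                 v = (\<Prod>j<d. eucl_norm (col B j)) / lattice_det d L)"

(* Extended reals: the average coherence may vanish (orthogonal minimal vectors), and the
   measure is then infinite, since x / 0 = \<infinity> for x > 0 in ereal. *)
definition product_measure :: "nat \<Rightarrow> real vec set \<Rightarrow> real vec set \<Rightarrow> ereal" where
  "product_measure d L T =
     ereal (real (card T) * orth_defect d L) / ereal (real d * avg_coherence T)"

inductive_set rat_adjoin :: "complex \<Rightarrow> complex set" for z :: complex where
  of_rat: "of_rat q \<in> rat_adjoin z"
| gen: "z \<in> rat_adjoin z"
| add: "x \<in> rat_adjoin z \<Longrightarrow> y \<in> rat_adjoin z \<Longrightarrow> x + y \<in> rat_adjoin z"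
| mult: "x \<in> rat_adjoin z \<Longrightarrow> y \<in> rat_adjoin z \<Longrightarrow> x * y \<in> rat_adjoin z"
| inverse: "x \<in> rat_adjoin z \<Longrightarrow> inverse x \<in> rat_adjoin z"

definition cyclotomic_field :: "nat \<Rightarrow> complex set" where
  "cyclotomic_field n = rat_adjoin (exp (2 * of_real pi * \<i> / of_nat n))"

definition ring_of_integers :: "complex set \<Rightarrow> complex set" where
  "ring_of_integers K = {x \<in> K. algebraic_int x}"

(* Field embeddings of K into the complex numbers; extensionality makes equality of
   functions mean equality on K. *)
definition complex_embeddings :: "complex set \<Rightarrow> (complex \<Rightarrow> complex) set" where
  "complex_embeddings K = {\<sigma> \<in> extensional K. \<sigma> 1 = 1 \<and>
     (\<forall>x\<in>K. \<forall>y\<in>K. \<sigma> (x + y) = \<sigma> x + \<sigma> y \<and> \<sigma> (x * y) = \<sigma> x * \<sigma> y)}"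

(* tau_0, cnj tau_0, ..., tau_(r-1), cnj tau_(r-1) list every embedding exactly once. *)
definition conj_pairs_enum :: "complex set \<Rightarrow> nat \<Rightarrow> (nat \<Rightarrow> complex \<Rightarrow> complex) \<Rightarrow> bool" where
  "conj_pairs_enum K r \<tau> \<longleftrightarrow>
     bij_betw (\<lambda>(j, conjugated). if conjugated then restrict (cnj \<circ> \<tau> j) K else \<tau> j)
       ({..<r} \<times> (UNIV :: bool set)) (complex_embeddings K)"

definition minkowski_embedding ::
    "nat \<Rightarrow> (nat \<Rightarrow> complex \<Rightarrow> complex) \<Rightarrow> complex \<Rightarrow> real vec" where
  "minkowski_embedding r \<tau> x =
     vec (2 * r) (\<lambda>i. if even i then Re (\<tau> (i div 2) x) else Im (\<tau> (i div 2) x))"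

definition cyclotomic_lattice :: "nat \<Rightarrow> (nat \<Rightarrow> complex \<Rightarrow> complex) \<Rightarrow> real vec set" where
  "cyclotomic_lattice n \<tau> =
     minkowski_embedding (totient n div 2) \<tau> ` ring_of_integers (cyclotomic_field n)"

definition omega :: "nat \<Rightarrow> nat" where
  "omega n = card (prime_factors n)"

definition ramified_prod :: "nat \<Rightarrow> real" where
  "ramified_prod n =
     (\<Prod>p \<in> prime_factors n. real p powr (real (multiplicity p n) - 1 / (real p - 1)))"

end

theory Submission
  imports Defs "Jordan_Normal_Form.Char_Poly"
begin

text \<open>
  Everything is computed with polynomials evaluated at primitive \<open>n\<close>-th roots of unity. The fibres of
  \<open>x \<mapsto> x\<^sup>p\<close> yield, by induction on the prime factors of \<open>n\<close>, the sums \<open>\<Sum> x\<^sup>k\<close> over primitive roots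
  (hence the inner products of roots of unity) and the discriminant. The ring of integers is
  \<open>\<int>[\<zeta>]\<close>: the expansion \<open>n x = \<Sum>\<^sub>j Tr(x \<zeta>\<^sup>j) \<zeta>\<^sup>-\<^sup>j\<close> shows \<open>n \<O> \<subseteq> \<int>[\<zeta>]\<close>, and a Frobenius argument modulo
  each prime dividing \<open>n\<close> removes the factor \<open>n\<close>. By AM-GM and integrality of the norm, a nonzero
  integer has squared length at least \<open>\<phi>(n)/2\<close>, with equality only if all its conjugates have absolute
  value 1, in which case Kronecker's theorem makes it a root of unity. So for even \<open>n\<close> the minimal
  vectors are the \<open>n\<close>-th roots of unity; the case of odd \<open>n\<close> follows since \<open>n\<close> and \<open>2 n\<close> define the same
  field. The average coherence then counts the squarefree divisors of \<open>n\<close>, and the determinant is a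
  Vandermonde determinant.
\<close>

subsection \<open>Primitive roots of unity\<close>

text \<open>No Galois group is introduced. A field element is a rational polynomial \<open>p\<close>
  evaluated at \<open>z\<close>, and its conjugates are the values of the same \<open>p\<close> at
  the other primitive roots; that this is well defined is the irreducibility of the cyclotomic
  polynomial, \<open>rpoly_prim_roots_conjugate\<close>. Traces and norms become sums and products
  over \<open>prim_roots n\<close>. Even \<open>n\<close> is the convenient case: then
  \<open>-1\<close> is an \<open>n\<close>-th root of unity and the minimal vectors are exactly the
  solutions of \<open>x ^ n = 1\<close>, whereas for odd \<open>n\<close> the field also contains
  their negatives. The number \<open>2 ^ omega n\<close> arises as follows: two roots with quotient
  of order \<open>m\<close> have coherence \<open>1 / totient m\<close> or 0, according to whether
  \<open>m\<close> is squarefree, and there are \<open>totient m\<close> quotients of order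
  \<open>m\<close>, so each squarefree divisor contributes 1. That the ring of integers is generated
  by \<open>z\<close> matters for the determinant, because the powers of \<open>z\<close> then form
  a lattice basis. The number \<open>ramified_prod n\<close> is the \<open>totient n\<close>-th root
  of the absolute discriminant.\<close>

text \<open>The set \<open>prim_roots 0\<close> consists of all numbers of infinite order, including 0.\<close>
definition prim_roots :: "nat \<Rightarrow> complex set" where
  "prim_roots n = {z. \<forall>k::nat. z ^ k = 1 \<longleftrightarrow> n dvd k}"

lemma prim_roots_power_eq_1_iff: "z \<in> prim_roots n \<Longrightarrow> z ^ k = 1 \<longleftrightarrow> n dvd k"
  unfolding prim_roots_def by blast

lemma prim_rootsI: "(\<And>k. z ^ k = 1 \<longleftrightarrow> n dvd k) \<Longrightarrow> z \<in> prim_roots n"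
  unfolding prim_roots_def by blast

lemma prim_roots_power_self [simp]: "z \<in> prim_roots n \<Longrightarrow> z ^ n = 1"
  by (simp add: prim_roots_power_eq_1_iff)

lemma prim_roots_nonzero: "z \<in> prim_roots n \<Longrightarrow> n > 0 \<Longrightarrow> z \<noteq> 0"
  by (metis power_eq_0_iff prim_roots_power_self zero_neq_one zero_power)

lemma norm_prim_roots: "z \<in> prim_roots n \<Longrightarrow> n > 0 \<Longrightarrow> norm z = 1"
  by (metis norm_one norm_power norm_ge_zero power_eq_1_iff prim_roots_power_self less_numeral_extra(3))

lemma cnj_prim_roots: "z \<in> prim_roots n \<Longrightarrow> n > 0 \<Longrightarrow> cnj z = inverse z"
  using norm_prim_roots[of z n] by (metis complex_norm_square inverse_unique mult.commute of_real_1 power_one)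

lemma prim_roots_power_eq_iff:
  assumes z: "z \<in> prim_roots n" "n > 0"
  shows "z ^ i = z ^ j \<longleftrightarrow> [i = j] (mod n)"
proof -
  have z0: "z \<noteq> 0" using prim_roots_nonzero[OF z] .
  have *: "z ^ i = z ^ j \<longleftrightarrow> [i = j] (mod n)" if "i \<le> j" for i j
  proof -
    have "z ^ j = z ^ i * z ^ (j - i)" using that by (simp flip: power_add)
    then have "z ^ i = z ^ j \<longleftrightarrow> z ^ (j - i) = 1" using z0 by auto
    also have "\<dots> \<longleftrightarrow> n dvd (j - i)" using prim_roots_power_eq_1_iff[OF z(1)] .
    also have "\<dots> \<longleftrightarrow> [i = j] (mod n)"
      using that by (metis cong_altdef_nat cong_sym_eq)
    finally show ?thesis .
  qed
  show ?thesis using *[of i j] *[of j i] by (metis cong_sym_eq nat_le_linear)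
qed

lemma prim_roots_cis:
  assumes "n > 0"
  shows "cis (2 * pi / real n) \<in> prim_roots n"
proof -
  have pw: "cis (2 * pi / real n) ^ k = cis (2 * pi * real k / real n)" for k
    by (simp add: DeMoivre mult_ac)
  have n1: "cis (2 * pi / real n) ^ n = 1" using assms by (simp add: pw)
  have "n dvd k" if "cis (2 * pi / real n) ^ k = 1" for k
  proof -
    have "cis (2 * pi / real n) ^ (k mod n) = 1"
      using that n1 by (metis mult_1 mult_div_mod_eq power_add power_mult power_one)
    then have "cis (2 * pi * real (k mod n) / real n) = cis (2 * pi * real 0 / real n)"
      by (simp add: pw)
    then have "k mod n = 0"
      using bij_betw_imp_inj_on[OF bij_betw_roots_unity[OF assms]] assms
      by (meson inj_onD lessThan_iff mod_less_divisor)
    then show ?thesis by auto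
  qed
  moreover have "cis (2 * pi / real n) ^ k = 1" if "n dvd k" for k
    using that n1 by (auto simp: power_mult)
  ultimately show ?thesis unfolding prim_roots_def by blast
qed

lemma prim_roots_1 [simp]: "prim_roots (Suc 0) = {1}"
proof (intro equalityI subsetI)
  fix z assume "z \<in> prim_roots (Suc 0)"
  then show "z \<in> {1}" using prim_roots_power_self by fastforce
qed (auto intro: prim_rootsI)

lemma prim_roots_power:
  assumes z: "z \<in> prim_roots n" and "coprime k n"
  shows "z ^ k \<in> prim_roots n"
  using assms
  by (intro prim_rootsI)
     (simp add: prim_roots_power_eq_1_iff coprime_commute coprime_dvd_mult_right_iff flip: power_mult)

lemma prim_roots_power_mult:
  assumes z: "z \<in> prim_roots (g * m)" and "g > 0"
  shows "z ^ g \<in> prim_roots m"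
  using assms by (intro prim_rootsI) (simp add: prim_roots_power_eq_1_iff flip: power_mult)

lemma prim_roots_mult_coprime:
  assumes x: "x \<in> prim_roots a" and y: "y \<in> prim_roots b" and ab: "coprime a b"
  shows "x * y \<in> prim_roots (a * b)"
proof -
  have "a * b dvd k" if k: "(x * y) ^ k = 1" for k
  proof -
    have "(x ^ k) * (y ^ k) = 1" using k by (simp add: power_mult_distrib)
    then have "(x ^ k) ^ b * (y ^ k) ^ b = 1" "(x ^ k) ^ a * (y ^ k) ^ a = 1"
      by (simp_all flip: power_mult_distrib)
    moreover have "(y ^ k) ^ b = 1" "(x ^ k) ^ a = 1"
      using x y by (simp_all add: prim_roots_power_eq_1_iff flip: power_mult)
    ultimately have "x ^ (k * b) = 1" "y ^ (k * a) = 1" by (simp_all add: power_mult)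
    then have "a dvd k * b" "b dvd k * a" using x y by (simp_all add: prim_roots_power_eq_1_iff)
    then have "a dvd k" "b dvd k" using ab
      by (simp_all add: coprime_dvd_mult_left_iff coprime_commute)
    then show ?thesis using ab by (simp add: divides_mult)
  qed
  moreover have "(x * y) ^ k = 1" if "a * b dvd k" for k
  proof -
    have "x ^ k = 1" "y ^ k = 1"
      using that dvd_mult_left[of a b k] dvd_mult_right[of a b k]
      by (simp_all add: prim_roots_power_eq_1_iff[OF x] prim_roots_power_eq_1_iff[OF y])
    then show ?thesis by (simp add: power_mult_distrib)
  qed
  ultimately show ?thesis by (intro prim_rootsI) blast
qed

lemma bij_betw_power_prim_roots:
  assumes z: "z \<in> prim_roots n" and n: "n > 0"
  shows "bij_betw (\<lambda>k. z ^ k) {..<n} {x. x ^ n = 1}"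
proof -
  have inj: "inj_on (\<lambda>k. z ^ k) {..<n}"
    using prim_roots_power_eq_iff[OF assms] by (auto simp: inj_on_def cong_less_modulus_unique_nat)
  have "(\<lambda>k. z ^ k) ` {..<n} = {x. x ^ n = 1}"
  proof (rule card_subset_eq)
    show "finite {x::complex. x ^ n = 1}" using n by auto
    show "(\<lambda>k. z ^ k) ` {..<n} \<subseteq> {x. x ^ n = 1}" using z
      by (auto simp: prim_roots_power_eq_1_iff simp flip: power_mult)
    show "card ((\<lambda>k. z ^ k) ` {..<n}) = card {x::complex. x ^ n = 1}"
      using card_image[OF inj] card_roots_unity_eq[OF n] by simp
  qed
  with inj show ?thesis by (simp add: bij_betw_def)
qed

lemma prim_rootsE:
  assumes z: "z \<in> prim_roots n" and n: "n > 0" and x: "x ^ n = 1"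
  obtains k where "k < n" "x = z ^ k"
  using bij_betw_imp_surj_on[OF bij_betw_power_prim_roots[OF z n]] x by blast

lemma prim_roots_coprimeE:
  assumes z: "z \<in> prim_roots n" and n: "n > 0" and x: "x \<in> prim_roots n"
  obtains k where "k < n" "x = z ^ k" "coprime k n"
proof -
  obtain k where k: "k < n" "x = z ^ k"
    using prim_rootsE[OF z n] prim_roots_power_self[OF x] by metis
  let ?g = "gcd k n"
  have "z ^ (k * (n div ?g)) = 1"
    using prim_roots_power_eq_1_iff[OF z] by (metis div_mult_swap dvd_triv_right gcd_dvd1 gcd_dvd2 dvd_mult_div_cancel dvd_triv_left mult.assoc mult.commute)
  then have "x ^ (n div ?g) = 1" using k by (simp add: power_mult)
  then have "n dvd n div ?g" using prim_roots_power_eq_1_iff[OF x] by simp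
  then have "coprime k n"
  proof -
    have "?g * (n div ?g) = n" by simp
    moreover have "n div ?g = n" using \<open>n dvd n div ?g\<close> n
      by (metis dvd_div_eq_0_iff div_dvd_iff_mult dvd_antisym dvd_triv_left gcd_dvd2 calculation dvd_triv_right)
    ultimately show ?thesis using n by (simp add: coprime_iff_gcd_eq_1)
  qed
  with k that show thesis by blast
qed

lemma bij_betw_totatives_prim_roots:
  assumes z: "z \<in> prim_roots n" and n: "n > 0"
  shows "bij_betw (\<lambda>k. z ^ k) (totatives n) (prim_roots n)"
proof (rule bij_betw_imageI)
  show "inj_on (\<lambda>k. z ^ k) (totatives n)"
  proof (rule inj_onI)
    fix i j assume ij: "i \<in> totatives n" "j \<in> totatives n" "z ^ i = z ^ j"
    then have c: "[i = j] (mod n)" using prim_roots_power_eq_iff[OF assms] by simp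
    show "i = j"
    proof (cases "n = 1")
      case False
      then have "i < n" "j < n" using ij n by (auto intro: totatives_less)
      then show ?thesis using c by (simp add: cong_less_modulus_unique_nat)
    qed (use ij in auto)
  qed
  show "(\<lambda>k. z ^ k) ` totatives n = prim_roots n"
  proof (intro equalityI subsetI)
    fix x assume "x \<in> (\<lambda>k. z ^ k) ` totatives n"
    then show "x \<in> prim_roots n" using prim_roots_power[OF z] by (auto simp: totatives_def)
  next
    fix x assume x: "x \<in> prim_roots n"
    then obtain k where k: "k < n" "x = z ^ k" "coprime k n" using prim_roots_coprimeE[OF z n] by blast
    show "x \<in> (\<lambda>k. z ^ k) ` totatives n"
    \<comment> \<open>\<open>totatives n\<close> lies in \<open>{1..n}\<close>; the exponent 0 is
      coprime to \<open>n\<close> only for \<open>n = 1\<close>, where the exponent 1 gives the same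
      root.\<close>
    proof (cases "k = 0")
      case True
      with k have "n = 1" by simp
      with k z show ?thesis by (auto simp: True)
    next
      case False
      with k show ?thesis by (auto simp: in_totatives_iff)
    qed
  qed
qed

lemma prim_roots_nonempty: "n > 0 \<Longrightarrow> prim_roots n \<noteq> {}"
  using prim_roots_cis by blast

lemma card_prim_roots: "n > 0 \<Longrightarrow> card (prim_roots n) = totient n"
  using bij_betw_same_card[OF bij_betw_totatives_prim_roots[OF prim_roots_cis]]
  by (simp add: totient_def)

lemma finite_prim_roots [simp]: "n > 0 \<Longrightarrow> finite (prim_roots n)"
  using bij_betw_finite[OF bij_betw_totatives_prim_roots[OF prim_roots_cis]] by simp

lemma disjoint_prim_roots: "m \<noteq> n \<Longrightarrow> prim_roots m \<inter> prim_roots n = {}"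
  using prim_roots_power_eq_1_iff by (metis disjoint_iff dvd_antisym dvd_refl)

lemma root_unity_prim_roots:
  fixes x :: complex
  assumes "x ^ n = 1" "n > 0"
  obtains m where "m dvd n" "x \<in> prim_roots m" "m > 0"
proof -
  define m where "m = (LEAST m. m > 0 \<and> x ^ m = 1)"
  have m: "m > 0" "x ^ m = 1" using LeastI[of "\<lambda>m. m > 0 \<and> x ^ m = 1" n] assms by (auto simp: m_def)
  have min: "k \<ge> m" if "k > 0" "x ^ k = 1" for k
    unfolding m_def using that by (intro Least_le) auto
  have "m dvd k" if "x ^ k = 1" for k
  proof -
    have "x ^ (k mod m) = 1"
      using that m(2) by (metis mult_1 mult_div_mod_eq power_add power_mult power_one)
    then have "k mod m = 0" using min[of "k mod m"] m(1) by (meson mod_less_divisor not_gr_zero not_less)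
    then show ?thesis by auto
  qed
  moreover have "x ^ k = 1" if "m dvd k" for k using that m by (auto simp: power_mult)
  ultimately have "x \<in> prim_roots m" by (intro prim_rootsI) blast
  then show thesis using that m(1) prim_roots_power_eq_1_iff assms(1) by blast
qed

lemma roots_unity_eq_Union_prim_roots:
  assumes "n > 0"
  shows "{x. x ^ n = 1} = (\<Union>m\<in>{m. m dvd n}. prim_roots m)"
  using assms by (auto elim!: root_unity_prim_roots simp: prim_roots_power_eq_1_iff)

subsection \<open>Pulling back along a prime power map\<close>

text \<open>If \<open>x ^ k = 1\<close>, then \<open>(x ^ p) ^ k = 1\<close>, so \<open>m\<close>
  and with it \<open>p\<close> divide \<open>k\<close>; writing \<open>k = p * k'\<close> leaves
  only the order of \<open>x ^ p\<close>.\<close>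

lemma power_vimage_prim_roots_dvd:
  assumes p: "prime p" and "p dvd m"
  shows "{x. x ^ p \<in> prim_roots m} = prim_roots (p * m)"
proof (intro equalityI subsetI CollectI)
  fix x assume x: "x \<in> prim_roots (p * m)"
  then show "x ^ p \<in> prim_roots m" using prim_roots_power_mult p prime_gt_0_nat by blast
next
  fix x assume "x \<in> {x. x ^ p \<in> prim_roots m}"
  then have x: "x ^ (p * k) = 1 \<longleftrightarrow> m dvd k" for k by (simp add: prim_roots_power_eq_1_iff power_mult)
  have "x ^ k = 1 \<longleftrightarrow> p * m dvd k" for k
  proof
    assume k: "x ^ k = 1"
    then have "m dvd k" using x[of k] by (simp add: mult.commute power_mult)
    then obtain k' where k': "k = p * k'" using assms(2) by (meson dvdE dvd_trans)
    then show "p * m dvd k" using k x[of k'] by simp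
  next
    assume "p * m dvd k"
    then show "x ^ k = 1" using x by (metis dvdE dvd_triv_left mult.assoc)
  qed
  then show "x \<in> prim_roots (p * m)" by (rule prim_rootsI)
qed

text \<open>Here \<open>x ^ m\<close> is a \<open>p\<close>-th root of unity: if it is 1, then
  \<open>x\<close> has order \<open>m\<close>, otherwise order \<open>p * m\<close>. This extra copy
  of \<open>prim_roots m\<close>, which the \<open>p\<close>-th power permutes, is why the later
  recursions distinguish whether \<open>p dvd m\<close>.\<close>

lemma power_vimage_prim_roots_not_dvd:
  assumes p: "prime p" and "\<not> p dvd m" and m: "m > 0"
  shows "{x. x ^ p \<in> prim_roots m} = prim_roots (p * m) \<union> prim_roots m"
proof (intro equalityI subsetI)
  fix x assume "x \<in> prim_roots (p * m) \<union> prim_roots m"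
  moreover have "coprime p m" using assms by (simp add: prime_imp_coprime)
  ultimately show "x \<in> {x. x ^ p \<in> prim_roots m}"
    using prim_roots_power_mult p prime_gt_0_nat prim_roots_power by blast
next
  fix x assume "x \<in> {x. x ^ p \<in> prim_roots m}"
  then have x: "x ^ (p * k) = 1 \<longleftrightarrow> m dvd k" for k by (simp add: prim_roots_power_eq_1_iff power_mult)
  have 1: "m dvd k" if "x ^ k = 1" for k
    using x[of k] that by (simp add: mult.commute power_mult)
  show "x \<in> prim_roots (p * m) \<union> prim_roots m"
  proof (cases "x ^ m = 1")
    case True
    then have "x ^ k = 1" if "m dvd k" for k using that by (auto simp: power_mult)
    with 1 have "x \<in> prim_roots m" by (intro prim_rootsI) blast
    then show ?thesis by blast
  next
    case False
    have "p * m dvd k" if k: "x ^ k = 1" for k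
    proof -
      obtain j where j: "k = m * j" using 1[OF k] by blast
      have "(x ^ m) ^ j = 1" "(x ^ m) ^ p = 1"
        using k j x[of m] by (simp_all add: power_mult mult.commute flip: power_mult)
      then have "p dvd j"
        using root_unity_prim_roots[of "x ^ m" p] p False prime_gt_0_nat[OF p]
        by (metis One_nat_def empty_iff insert_iff prim_roots_1 prim_roots_power_eq_1_iff prime_nat_iff)
      then show ?thesis using j by (simp add: mult.commute)
    qed
    moreover have "x ^ k = 1" if "p * m dvd k" for k
      using that x by (metis dvdE dvd_triv_left mult.assoc)
    ultimately have "x \<in> prim_roots (p * m)" by (intro prim_rootsI) blast
    then show ?thesis by blast
  qed
qed

lemma
  fixes W :: "complex set"
  assumes "finite W" "p > 0"
  shows sum_power_vimage: "sum f {x. x ^ p \<in> W} = (\<Sum>y\<in>W. sum f {x. x ^ p = y})"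
    and prod_power_vimage: "prod f {x. x ^ p \<in> W} = (\<Prod>y\<in>W. prod f {x. x ^ p = y})"
    and finite_power_vimage: "finite {x. x ^ p \<in> W}"
proof -
  have eq: "{x. x ^ p \<in> W} = (\<Union>y\<in>W. {x. x ^ p = y})" by auto
  show fin: "finite {x. x ^ p \<in> W}"
    unfolding eq using assms by (auto intro!: finite_nth_roots)
  have s: "{x \<in> {x. x ^ p \<in> W}. x ^ p = y} = {x. x ^ p = y}" if "y \<in> W" for y
    using that by auto
  show "sum f {x. x ^ p \<in> W} = (\<Sum>y\<in>W. sum f {x. x ^ p = y})"
    by (subst sum.group[OF fin assms(1), of "\<lambda>x. x ^ p" f, symmetric])
       (use s in \<open>auto intro!: sum.cong\<close>)
  show "prod f {x. x ^ p \<in> W} = (\<Prod>y\<in>W. prod f {x. x ^ p = y})"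
    by (subst prod.group[OF fin assms(1), of "\<lambda>x. x ^ p" f, symmetric])
       (use s in \<open>auto intro!: prod.cong\<close>)
qed

lemma prod_diff_nth_roots_poly:
  fixes y :: complex
  assumes "y \<noteq> 0" "n > 0"
  shows "(\<Prod>x\<in>{x. x ^ n = y}. [:- x, 1:]) = monom 1 n - [:y:]"
proof (rule poly_eqI_degree_lead_coeff[where n = n and A = "{x. x ^ n = y}"])
  let ?P = "\<Prod>x\<in>{x. x ^ n = y}. [:- x, 1:]"
  have fin: "finite {x. x ^ n = y}" using assms by auto
  have deg: "degree ?P = n"
    using card_nth_roots[OF assms] by (subst degree_prod_eq_sum_degree) auto
  have "lead_coeff ?P = 1" by (simp add: lead_coeff_prod)
  then show "coeff ?P n = coeff (monom 1 n - [:y:]) n" using deg assms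
    by (simp add: coeff_eq_0)
  show "n \<le> card {x. x ^ n = y}" using card_nth_roots[OF assms] by simp
  show "degree ?P \<le> n" using deg by simp
  show "degree (monom 1 n - [:y:]) \<le> n" using degree_diff_le[of "monom 1 n" n "[:y:]"]
    by (simp add: degree_monom_le)
  fix z assume z: "z \<in> {x. x ^ n = y}"
  then show "poly ?P z = poly (monom 1 n - [:y:]) z"
    using fin by (auto simp: poly_prod poly_monom)
qed

lemma prod_diff_nth_roots:
  fixes y :: complex
  assumes "y \<noteq> 0" "n > 0"
  shows "(\<Prod>x\<in>{x. x ^ n = y}. c - x) = c ^ n - y"
  using arg_cong[OF prod_diff_nth_roots_poly[OF assms], of "\<lambda>p. poly p c"]
  by (simp add: poly_prod poly_monom)

text \<open>Differentiate the factorisation of \<open>X ^ n - x ^ n\<close> and evaluate at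
  \<open>x\<close>: only the term without the factor \<open>X - x\<close> survives.\<close>

lemma prod_diff_other_nth_roots:
  fixes x :: complex
  assumes "x \<noteq> 0" "n > 0"
  shows "(\<Prod>w\<in>{w. w ^ n = x ^ n} - {x}. x - w) = of_nat n * x ^ (n - 1)"
proof -
  let ?A = "{w. w ^ n = x ^ n}"
  have fin: "finite ?A" using assms by auto
  have "[:- x, 1:] * (\<Prod>w\<in>?A - {x}. [:- w, 1:]) = monom 1 n - [:x ^ n:]"
    using prod_diff_nth_roots_poly[of "x ^ n" n] prod.remove[OF fin, of x "\<lambda>w. [:- w, 1:]"] assms
    by simp
  then have "poly (pderiv ([:- x, 1:] * (\<Prod>w\<in>?A - {x}. [:- w, 1:]))) x =
      poly (pderiv (monom 1 n - [:x ^ n:])) x" by metis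
  then show ?thesis
    by (simp only: pderiv_mult pderiv_diff pderiv_monom poly_monom poly_prod pderiv_pCons poly_add poly_mult)
       (simp add: poly_prod poly_monom)
qed

subsection \<open>Sums over primitive roots of unity\<close>

lemma bij_betw_power_coprime_prim_roots:
  assumes "coprime k m" "m > 0"
  shows "bij_betw (\<lambda>x. x ^ k) (prim_roots m) (prim_roots m)"
proof -
  obtain q where q: "[k * q = 1] (mod m)"
    using cong_solve_coprime_nat[OF assms(1)] by auto
  have "(x ^ k) ^ q = x" if "x \<in> prim_roots m" for x
  proof -
    have "x ^ (k * q) = x ^ 1" using prim_roots_power_eq_iff[OF that assms(2)] q by blast
    then show ?thesis by (simp add: power_mult)
  qed
  then have "inj_on (\<lambda>x. x ^ k) (prim_roots m)" by (intro inj_on_inverseI[where g = "\<lambda>x. x ^ q"]) simp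
  moreover have "(\<lambda>x. x ^ k) ` prim_roots m \<subseteq> prim_roots m"
    using prim_roots_power assms(1) by blast
  ultimately show ?thesis
    using assms(2) by (simp add: bij_betw_def endo_inj_surj)
qed

text \<open>Each \<open>w\<close> has \<open>p\<close> preimages under the \<open>p\<close>-th
  power. If \<open>p\<close> does not divide \<open>m\<close>, one of them lies in
  \<open>prim_roots m\<close> itself, and removing these turns \<open>p\<close> into
  \<open>p - 1\<close>. For \<open>f = 1\<close> this yields the recursion of the totient.\<close>

lemma sum_power_fibre_prime:
  fixes f :: "complex \<Rightarrow> complex"
  assumes p: "prime p" and m: "m > 0"
  shows "(\<Sum>x\<in>prim_roots (p * m). f (x ^ p)) =
    of_nat (if p dvd m then p else p - 1) * (\<Sum>w\<in>prim_roots m. f w)"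
proof -
  have p0: "p > 0" using p prime_gt_0_nat by blast
  have "(\<Sum>x | x ^ p \<in> prim_roots m. f (x ^ p)) =
      (\<Sum>w\<in>prim_roots m. \<Sum>x | x ^ p = w. f (x ^ p))"
    using sum_power_vimage[OF finite_prim_roots[OF m] p0, of "\<lambda>x. f (x ^ p)"] .
  also have "\<dots> = (\<Sum>w\<in>prim_roots m. of_nat p * f w)"
    using prim_roots_nonzero[OF _ m] by (intro sum.cong) (simp_all add: card_nth_roots p0)
  finally have *: "(\<Sum>x | x ^ p \<in> prim_roots m. f (x ^ p)) = of_nat p * (\<Sum>w\<in>prim_roots m. f w)"
    by (simp add: sum_distrib_left)
  show ?thesis
  proof (cases "p dvd m")
    case True
    then show ?thesis using * power_vimage_prim_roots_dvd[OF p True] by simp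
  next
    case False
    then have cop: "coprime p m" using p by (simp add: prime_imp_coprime)
    have "(\<Sum>x | x ^ p \<in> prim_roots m. f (x ^ p)) =
      (\<Sum>x\<in>prim_roots (p * m). f (x ^ p)) + (\<Sum>x\<in>prim_roots m. f (x ^ p))"
      unfolding power_vimage_prim_roots_not_dvd[OF p False m]
      by (rule sum.union_disjoint) (use m p0 disjoint_prim_roots[of "p * m" m] prime_gt_1_nat[OF p] in auto)
    also have "(\<Sum>x\<in>prim_roots m. f (x ^ p)) = (\<Sum>x\<in>prim_roots m. f x)"
      using sum.reindex_bij_betw[OF bij_betw_power_coprime_prim_roots[OF cop m], of f] .
    finally have "(\<Sum>x\<in>prim_roots (p * m). f (x ^ p)) =
        of_nat p * (\<Sum>w\<in>prim_roots m. f w) - (\<Sum>x\<in>prim_roots m. f x)"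
      using * by (simp add: algebra_simps)
    then show ?thesis using False p0 by (simp add: of_nat_diff algebra_simps Suc_leI)
  qed
qed

lemma totient_prime_mult:
  assumes p: "prime p" and m: "m > 0"
  shows "totient (p * m) = (if p dvd m then p else p - 1) * totient m"
proof -
  have pm: "p * m > 0" using p m prime_gt_0_nat by simp
  have "of_nat (totient (p * m)) = (of_nat ((if p dvd m then p else p - 1) * totient m) :: complex)"
    using sum_power_fibre_prime[OF assms, of "\<lambda>_. 1"] m pm
    by (simp add: card_prim_roots)
  then show ?thesis by (simp only: of_nat_eq_iff)
qed

text \<open>The fibres of the \<open>g\<close>-th power map all have
  \<open>totient (g * m) / totient m\<close> elements; the denominator is cleared.\<close>

lemma sum_power_fibre:
  fixes f :: "complex \<Rightarrow> complex"
  assumes "g > 0" "m > 0"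
  shows "of_nat (totient m) * (\<Sum>x\<in>prim_roots (g * m). f (x ^ g)) =
    of_nat (totient (g * m)) * (\<Sum>w\<in>prim_roots m. f w)"
  using assms(1)
proof (induction g arbitrary: f rule: prime_divisors_induct)
  case (factor p g)
  then have g: "g > 0" "g * m > 0" using assms by auto
  have "(\<Sum>x\<in>prim_roots (p * (g * m)). f ((x ^ p) ^ g)) * of_nat (totient (g * m)) =
     of_nat (totient (p * (g * m))) * (\<Sum>w\<in>prim_roots (g * m). f (w ^ g))"
    using sum_power_fibre_prime[OF factor(1) g(2), of "\<lambda>x. f (x ^ g)"]
    by (simp add: totient_prime_mult[OF factor(1) g(2)])
  then have "of_nat (totient (g * m)) * (of_nat (totient m) * (\<Sum>x\<in>prim_roots (p * (g * m)). f ((x ^ p) ^ g))) =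
     of_nat (totient (g * m)) * (of_nat (totient (p * (g * m))) * (\<Sum>w\<in>prim_roots m. f w))"
    using factor.IH[OF g(1), of f] by (simp add: algebra_simps)
  then have "of_nat (totient m) * (\<Sum>x\<in>prim_roots (p * (g * m)). f ((x ^ p) ^ g)) =
     of_nat (totient (p * (g * m))) * (\<Sum>w\<in>prim_roots m. f w)"
    using g by simp
  then show ?case by (simp add: power_mult mult.assoc)
qed auto

text \<open>The sum is the Moebius function of \<open>n\<close>; only its absolute value matters for coherence.\<close>
lemma sum_prim_roots:
  assumes "n > 0"
  shows "\<exists>s. \<Sum>(prim_roots n) = of_int s \<and> \<bar>s\<bar> = (if squarefree n then 1 else 0)"
  using assms
proof (induction n rule: prime_divisors_induct)
  case (unit x)
  then show ?case by (intro exI[of _ 1]) auto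
next
  case (factor p m)
  then have m: "m > 0" by simp
  have p: "prime p" "p > 1" using factor prime_gt_1_nat by auto
  \<comment> \<open>Each fibre consists of the \<open>p\<close>-th roots of one number, which sum to
    0 since \<open>p > 1\<close>. So the sum for \<open>p * m\<close> either is 0 or cancels the sum
    for \<open>m\<close>.\<close>
  have 0: "(\<Sum>x | x ^ p \<in> prim_roots m. x) = 0"
    using sum_power_vimage[OF finite_prim_roots[OF m], of p "\<lambda>x. x"] p(2) sum_nth_roots[OF p(2)]
    by simp
  show ?case
  proof (cases "p dvd m")
    case True
    then have "p ^ 2 dvd p * m" by (simp add: power2_eq_square)
    then have "\<not> squarefree (p * m)" using p not_squarefreeI[of p "p * m"] by auto
    then show ?thesis using 0 unfolding power_vimage_prim_roots_dvd[OF p(1) True]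
      by (intro exI[of _ 0]) simp
  next
    case False
    have "0 = \<Sum>(prim_roots (p * m)) + \<Sum>(prim_roots m)"
      using 0 unfolding power_vimage_prim_roots_not_dvd[OF p(1) False m]
      by (subst (asm) sum.union_disjoint) (use m p disjoint_prim_roots[of "p * m" m] in auto)
    moreover obtain s where s: "\<Sum>(prim_roots m) = of_int s" "\<bar>s\<bar> = (if squarefree m then 1 else 0)"
      using factor.IH[OF m] by blast
    moreover have "squarefree (p * m) \<longleftrightarrow> squarefree m"
      using False p squarefree_mult_coprime[of p m] squarefree_multD(2)[of p m]
      by (auto simp: prime_imp_coprime squarefree_prime)
    ultimately have "\<Sum>(prim_roots (p * m)) = of_int (- s)" "\<bar>- s\<bar> = (if squarefree (p * m) then 1 else 0)"
      by (simp_all add: eq_neg_iff_add_eq_0)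
    then show ?thesis by blast
  qed
qed auto

text \<open>A Ramanujan sum. With \<open>g = gcd k n\<close>, the \<open>g\<close>-th power
  collapses it to order \<open>m = n div g\<close>, the order of \<open>z ^ k\<close>; the remaining
  exponent \<open>u\<close> is coprime to \<open>m\<close> and permutes the roots.\<close>

lemma sum_power_prim_roots:
  assumes n: "n > 0" and z: "z \<in> prim_roots n" "z ^ k \<in> prim_roots m"
  shows "\<exists>s. (\<Sum>x\<in>prim_roots n. x ^ k) = of_int s \<and>
    real_of_int \<bar>s\<bar> = real (totient n) * (if squarefree m then 1 / real (totient m) else 0)"
proof -
  define g where "g = gcd k n"
  define m' where "m' = n div g"
  define u where "u = k div g"
  have g0: "g > 0" using n by (simp add: g_def)
  have kn: "k = g * u" "n = g * m'" by (simp_all add: g_def u_def m'_def)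
  have cop: "coprime u m'" unfolding u_def m'_def g_def using n by (intro div_gcd_coprime) auto
  have m'0: "m' > 0" using n kn by (cases m') auto
  have "z ^ g \<in> prim_roots m'" using prim_roots_power_mult z kn g0 by simp
  then have "z ^ k \<in> prim_roots m'" using prim_roots_power[OF _ cop] by (simp add: kn power_mult)
  then have m: "m = m'" using z disjoint_prim_roots by blast
  obtain s where s: "\<Sum>(prim_roots m) = of_int s" "\<bar>s\<bar> = (if squarefree m then 1 else 0)"
    using sum_prim_roots[OF m'0] m by blast
  have dv: "totient m dvd totient n" using kn m n by (intro totient_dvd) auto
  then obtain t where t: "totient n = totient m * t" by blast
  have tm: "totient m > 0" using m m'0 by simp
  have "of_nat (totient m) * (\<Sum>x\<in>prim_roots n. x ^ k) = of_nat (totient n) * (\<Sum>w\<in>prim_roots m. w ^ u)"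
    using sum_power_fibre[OF g0 m'0, of "\<lambda>x. x ^ u"] by (simp add: kn m power_mult)
  also have "(\<Sum>w\<in>prim_roots m. w ^ u) = \<Sum>(prim_roots m)"
    using sum.reindex_bij_betw[OF bij_betw_power_coprime_prim_roots[OF cop m'0], of "\<lambda>x. x"] by (simp add: m)
  finally have "(\<Sum>x\<in>prim_roots n. x ^ k) = of_int (int t * s)"
    using tm by (simp add: t s mult.assoc)
  moreover have "real_of_int \<bar>int t * s\<bar> = real (totient n) * (if squarefree m then 1 / real (totient m) else 0)"
    using tm by (simp add: t s abs_mult)
  ultimately show ?thesis by blast
qed

lemma card_squarefree_divisors:
  fixes n :: nat
  assumes "n > 0"
  shows "card {m. m dvd n \<and> squarefree m} = 2 ^ card (prime_factors n)"
proof -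
  have pf: "prime_factors (\<Prod>A) = A" if "A \<subseteq> prime_factors n" for A
  proof -
    have "finite A" using that finite_subset by blast
    moreover have "prime p" if "p \<in> A" for p using that \<open>A \<subseteq> _\<close> by auto
    moreover from this have "0 \<notin> A" by force
    ultimately have "prime_factors (\<Prod>A) = \<Union> ((prime_factors \<circ> (\<lambda>x. x)) ` A)"
      by (intro prime_factors_prod) auto
    also have "\<dots> = A" using \<open>\<And>p. p \<in> A \<Longrightarrow> prime p\<close> by (auto simp: prime_prime_factors)
    finally show ?thesis .
  qed
  have "bij_betw (\<lambda>A. \<Prod>A) (Pow (prime_factors n)) {m. m dvd n \<and> squarefree m}"
  proof (rule bij_betw_byWitness[where f' = prime_factors])
    show "\<forall>A\<in>Pow (prime_factors n). prime_factors (\<Prod>A) = A" using pf by blast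
    show "\<forall>m\<in>{m. m dvd n \<and> squarefree m}. \<Prod>(prime_factors m) = m"
    proof clarify
      fix m assume m: "m dvd n" "squarefree m"
      then have m0: "m \<noteq> 0" using assms by auto
      have "(\<Prod>p\<in>prime_factors m. p ^ multiplicity p m) = m"
        using m0 by (simp add: prod_prime_factors)
      then show "\<Prod>(prime_factors m) = m"
        using m(2) squarefree_factorial_semiring'[OF m0] by simp
    qed
    show "prod (\<lambda>x. x) ` Pow (prime_factors n) \<subseteq> {m. m dvd n \<and> squarefree m}"
    proof clarify
      fix A assume A: "A \<subseteq> prime_factors n"
      have "\<Prod>A dvd (\<Prod>p\<in>prime_factors n. p)" by (rule prod_dvd_prod_subset) (use A in auto)
      also have "\<dots> dvd (\<Prod>p\<in>prime_factors n. p ^ multiplicity p n)"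
        by (rule prod_dvd_prod) (auto simp: prime_factors_multiplicity intro!: dvd_power)
      also have "\<dots> = n" using assms by (simp add: prod_prime_factors)
      finally have "\<Prod>A dvd n" .
      moreover have "squarefree (\<Prod>A)"
        by (rule squarefree_prod_coprime) (use A in \<open>auto intro: squarefree_prime primes_coprime\<close>)
      ultimately show "\<Prod>A dvd n \<and> squarefree (\<Prod>A)" by blast
    qed
    show "prime_factors ` {m. m dvd n \<and> squarefree m} \<subseteq> Pow (prime_factors n)"
      using assms by (auto simp: in_prime_factors_iff)
  qed
  from bij_betw_same_card[OF this] show ?thesis by (simp add: card_Pow)
qed

text \<open>The value at 1 of the cyclotomic polynomial of prime power order. The fibre over
  \<open>w\<close> multiplies to \<open>1 - w\<close>, so the value does not depend on
  \<open>e\<close>; for \<open>e = 0\<close> it is the derivative of \<open>X ^ p - 1\<close> at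
  1.\<close>

lemma prod_one_minus_prim_roots_prime_power:
  assumes p: "prime p"
  shows "(\<Prod>x\<in>prim_roots (p ^ Suc e). 1 - x) = of_nat p"
proof -
  have p0: "p > 0" using p prime_gt_0_nat by blast
  show ?thesis
  proof (induction e)
    case 0
    have "prim_roots p \<union> {1} = {x. x ^ p = 1}"
      using power_vimage_prim_roots_not_dvd[OF p, of 1] prime_gt_1_nat[OF p] by auto
    moreover have "1 \<notin> prim_roots p"
      using prim_roots_power_eq_1_iff[of 1 p 1] prime_gt_1_nat[OF p] by auto
    ultimately have eq: "prim_roots p = {w. w ^ p = 1 ^ p} - {1}" unfolding power_one by blast
    have "(\<Prod>x\<in>prim_roots p. 1 - x) = of_nat p"
      unfolding eq by (subst prod_diff_other_nth_roots) (use p0 in auto)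
    then show ?case by simp
  next
    case (Suc e)
    have pe: "p ^ Suc e > 0" using p0 by simp
    have "(\<Prod>x\<in>prim_roots (p ^ Suc (Suc e)). 1 - x) = (\<Prod>x | x ^ p \<in> prim_roots (p ^ Suc e). 1 - x)"
      using power_vimage_prim_roots_dvd[OF p, of "p ^ Suc e"] by simp
    also have "\<dots> = (\<Prod>w\<in>prim_roots (p ^ Suc e). \<Prod>x | x ^ p = w. 1 - x)"
      by (rule prod_power_vimage[OF finite_prim_roots[OF pe] p0])
    also have "\<dots> = (\<Prod>w\<in>prim_roots (p ^ Suc e). 1 - w)"
      using prim_roots_nonzero[OF _ pe] by (intro prod.cong) (simp_all add: prod_diff_nth_roots p0)
    finally show ?case using Suc by simp
  qed
qed

subsection \<open>The discriminant\<close>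

text \<open>For \<open>W = prim_roots n\<close> this is the absolute value of the discriminant of the \<open>n\<close>-th
  cyclotomic polynomial.\<close>
definition diff_prod :: "complex set \<Rightarrow> real" where
  "diff_prod W = (\<Prod>x\<in>W. \<Prod>y\<in>W - {x}. norm (x - y))"

lemma diff_prod_pos: "finite W \<Longrightarrow> diff_prod W > 0"
  by (auto simp: diff_prod_def intro!: prod_pos)

text \<open>Differences within the fibre of \<open>x\<close> multiply to the derivative
  \<open>p * x ^ (p - 1)\<close>, of norm \<open>p\<close>; those to the fibre over another
  \<open>w\<close> multiply to \<open>x ^ p - w\<close>.\<close>

lemma prod_norm_diff_power_vimage:
  fixes x :: complex
  assumes W: "finite W" and p: "p > 0" and x: "norm x = 1" "x ^ p \<in> W"
  shows "(\<Prod>y\<in>{y. y ^ p \<in> W} - {x}. norm (x - y)) = real p * (\<Prod>w\<in>W - {x ^ p}. norm (x ^ p - w))"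
    (is "?L = _")
proof -

  have x0: "x \<noteq> 0" using x by auto
  have eq: "{y. y ^ p \<in> W} - {x} = {y. y ^ p \<in> W - {x ^ p}} \<union> ({y. y ^ p = x ^ p} - {x})"
    using x by auto
  have W': "finite (W - {x ^ p})" using W by simp
  have "?L = (\<Prod>y | y ^ p \<in> W - {x ^ p}. norm (x - y)) * (\<Prod>y\<in>{y. y ^ p = x ^ p} - {x}. norm (x - y))"
    unfolding eq by (rule prod.union_disjoint)
      (use finite_power_vimage[OF W' p] finite_nth_roots[OF p] in auto)
  also have "(\<Prod>y\<in>{y. y ^ p = x ^ p} - {x}. norm (x - y)) = norm (of_nat p * x ^ (p - 1))"
    using prod_diff_other_nth_roots[OF x0 p] by (metis prod_norm)
  also have "\<dots> = real p" using x by (simp add: norm_mult norm_power)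
  also have "(\<Prod>y | y ^ p \<in> W - {x ^ p}. norm (x - y)) = (\<Prod>w\<in>W - {x ^ p}. \<Prod>y | y ^ p = w. norm (x - y))"
    by (rule prod_power_vimage[OF W' p])
  also have "\<dots> = (\<Prod>w\<in>W - {x ^ p}. norm (x ^ p - w))"
  proof (rule prod.cong[OF refl])
    fix w assume "w \<in> W - {x ^ p}"
    show "(\<Prod>y | y ^ p = w. norm (x - y)) = norm (x ^ p - w)"
    \<comment> \<open>\<open>W\<close> may contain 0, which has a single \<open>p\<close>-th root;
      both sides are then 1 because \<open>norm x = 1\<close>.\<close>
    proof (cases "w = 0")
      case True
      then have "{y. y ^ p = w} = {0}" using p by (auto simp: zero_power)
      then show ?thesis using x(1) True by (simp add: norm_power)
    next
      case False
      then show ?thesis using prod_diff_nth_roots[OF False p, of x] by (simp add: prod_norm)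
    qed
  qed
  finally show ?thesis by simp
qed

lemma diff_prod_power_vimage:
  assumes W: "finite W" "\<And>w. w \<in> W \<Longrightarrow> norm w = 1" and p: "p > 0"
  shows "diff_prod {x. x ^ p \<in> W} = real p ^ (p * card W) * diff_prod W ^ p"
proof -
  let ?G = "\<lambda>v. real p * (\<Prod>w\<in>W - {v}. norm (v - w))"
  have n1: "norm x = 1" if "x ^ p \<in> W" for x
    using W(2)[OF that] p power_eq_1_iff[of "norm x" p] by (simp add: norm_power)
  have "diff_prod {x. x ^ p \<in> W} = (\<Prod>x | x ^ p \<in> W. ?G (x ^ p))"
    unfolding diff_prod_def
    by (rule prod.cong[OF refl], rule prod_norm_diff_power_vimage[OF W(1) p]) (use n1 in auto)
  also have "\<dots> = (\<Prod>w\<in>W. \<Prod>x | x ^ p = w. ?G (x ^ p))"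
    by (rule prod_power_vimage[OF W(1) p])
  also have "\<dots> = (\<Prod>w\<in>W. ?G w ^ p)"
  proof (rule prod.cong[OF refl])
    fix w assume "w \<in> W"
    then have "w \<noteq> 0" using W(2)[of w] by auto
    then show "(\<Prod>x | x ^ p = w. ?G (x ^ p)) = ?G w ^ p"
      by (simp add: card_nth_roots p)
  qed
  also have "\<dots> = (\<Prod>w\<in>W. ?G w) ^ p" by (simp only: prod_power_distrib)
  also have "(\<Prod>w\<in>W. ?G w) = real p ^ card W * diff_prod W"
    by (simp add: prod.distrib diff_prod_def)
  finally show ?thesis by (simp add: power_mult_distrib power_mult mult.commute[of p])
qed

lemma diff_prod_prim_roots_dvd:
  assumes p: "prime p" "p dvd m" and m: "m > 0"
  shows "diff_prod (prim_roots (p * m)) = real p ^ (p * totient m) * diff_prod (prim_roots m) ^ p"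
  using diff_prod_power_vimage[of "prim_roots m" p] power_vimage_prim_roots_dvd[OF p]
    prime_gt_0_nat[OF p(1)] m by (simp add: card_prim_roots norm_prim_roots)

text \<open>The factor \<open>real p ^ (2 * totient m)\<close> is the square of \<open>R\<close>,
  the absolute resultant of the cyclotomic polynomials of orders \<open>p * m\<close> and
  \<open>m\<close>: the preimage of \<open>prim_roots m\<close> is the union of both root sets, and
  its \<open>diff_prod\<close> contains every cross difference twice.\<close>

lemma diff_prod_prim_roots_not_dvd:
  assumes p: "prime p" "\<not> p dvd m" and m: "m > 0"
  shows "diff_prod (prim_roots (p * m)) * real p ^ (2 * totient m) =
    real p ^ (p * totient m) * diff_prod (prim_roots m) ^ (p - 1)"
proof -
  define A where "A = prim_roots (p * m)"
  define B where "B = prim_roots m"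
  define R where "R = (\<Prod>x\<in>A. \<Prod>y\<in>B. norm (x - y))"
  have p0: "p > 0" "p > 1" using prime_gt_1_nat[OF p(1)] by auto
  have fin: "finite A" "finite B" using m p0 by (auto simp: A_def B_def)
  have dis: "A \<inter> B = {}" unfolding A_def B_def using m p0 by (intro disjoint_prim_roots) auto
  have Q: "{x. x ^ p \<in> B} = A \<union> B" unfolding A_def B_def by (rule power_vimage_prim_roots_not_dvd[OF p m])
  have nB: "norm w = 1" if "w \<in> B" for w using that norm_prim_roots[OF _ m] by (simp add: B_def)
  have cop: "coprime p m" using p by (simp add: prime_imp_coprime)
  have bij: "bij_betw (\<lambda>x. x ^ p) B B" unfolding B_def by (rule bij_betw_power_coprime_prim_roots[OF cop m])
  have R': "(\<Prod>x\<in>B. \<Prod>y\<in>A. norm (x - y)) = R"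
    unfolding R_def by (subst prod.swap) (simp add: norm_minus_commute)
  have split: "(\<Prod>y\<in>A \<union> B - {x}. norm (x - y)) = (\<Prod>y\<in>A - {x}. norm (x - y)) * (\<Prod>y\<in>B - {x}. norm (x - y))" for x
    unfolding Un_Diff by (rule prod.union_disjoint) (use fin dis in auto)
  have dA: "B - {x} = B" if "x \<in> A" for x using that dis by blast
  have dB: "A - {x} = A" if "x \<in> B" for x using that dis by blast
  have "diff_prod (A \<union> B) = (\<Prod>x\<in>A. \<Prod>y\<in>A \<union> B - {x}. norm (x - y)) * (\<Prod>x\<in>B. \<Prod>y\<in>A \<union> B - {x}. norm (x - y))"
    unfolding diff_prod_def by (rule prod.union_disjoint) (use fin dis in auto)
  also have "(\<Prod>x\<in>A. \<Prod>y\<in>A \<union> B - {x}. norm (x - y)) = (\<Prod>x\<in>A. (\<Prod>y\<in>A - {x}. norm (x - y)) * (\<Prod>y\<in>B. norm (x - y)))"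
    unfolding split using dA by simp
  also have "\<dots> = diff_prod A * R" by (simp add: prod.distrib R_def diff_prod_def)
  also have B1: "(\<Prod>x\<in>B. \<Prod>y\<in>A \<union> B - {x}. norm (x - y)) = (\<Prod>x\<in>B. (\<Prod>y\<in>A. norm (x - y)) * (\<Prod>y\<in>B - {x}. norm (x - y)))"
    unfolding split using dB by simp
  also have B2: "\<dots> = R * diff_prod B" by (simp add: prod.distrib diff_prod_def R')
  finally have D: "diff_prod (A \<union> B) = diff_prod A * R * (R * diff_prod B)" .
  \<comment> \<open>The differences from \<open>B\<close> to the whole preimage, computed by fibres,
    determine \<open>R\<close>: as the \<open>p\<close>-th power permutes \<open>B\<close>,
    \<open>diff_prod B\<close> reappears and cancels, leaving \<open>p ^ card B\<close>.\<close>
  have "R * diff_prod B = (\<Prod>x\<in>B. \<Prod>y\<in>A \<union> B - {x}. norm (x - y))" using B1 B2 by simp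
  also have "\<dots> = (\<Prod>x\<in>B. real p * (\<Prod>w\<in>B - {x ^ p}. norm (x ^ p - w)))"
    unfolding Q[symmetric] using bij
    by (intro prod.cong refl prod_norm_diff_power_vimage fin p0 nB) (auto simp: bij_betw_def)
  also have "\<dots> = real p ^ card B * (\<Prod>x\<in>B. \<Prod>w\<in>B - {x ^ p}. norm (x ^ p - w))"
    by (simp add: prod.distrib)
  also have "(\<Prod>x\<in>B. \<Prod>w\<in>B - {x ^ p}. norm (x ^ p - w)) = diff_prod B"
    unfolding diff_prod_def using prod.reindex_bij_betw[OF bij, of "\<lambda>x. \<Prod>w\<in>B - {x}. norm (x - w)"] .
  finally have R: "R = real p ^ card B" using diff_prod_pos[OF fin(2)] by simp
  have "diff_prod A * real p ^ (2 * card B) * diff_prod B = real p ^ (p * card B) * diff_prod B ^ p"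
    using D diff_prod_power_vimage[of B p, OF fin(2) nB p0(1)] unfolding Q R
    by (simp add: mult_ac mult_2_right flip: power_add)
  also have "diff_prod B ^ p = diff_prod B ^ (p - 1) * diff_prod B"
    using p0 by (simp flip: power_Suc2)
  finally show ?thesis using diff_prod_pos[OF fin(2)] m by (simp add: A_def B_def card_prim_roots)
qed

lemma ramified_prod_pos: "ramified_prod n > 0"
  unfolding ramified_prod_def by (intro prod_pos) (auto simp: prime_gt_0_nat in_prime_factors_iff)

lemma ramified_prod_mult_dvd:
  assumes p: "prime p" "p dvd m" and m: "m > 0"
  shows "ramified_prod (p * m) = real p * ramified_prod m"
proof -
  let ?f = "\<lambda>n p. real p powr (real (multiplicity p n) - 1 / (real p - 1))"
  have p0: "p > 0" using p prime_gt_0_nat by blast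
  have pf: "prime_factors (p * m) = prime_factors m" "p \<in> prime_factors m"
    using p m p0 by (auto simp: prime_factors_product prime_prime_factors in_prime_factors_iff)
  have "multiplicity p (p * m) = Suc (multiplicity p m)"
    using p0 m prime_gt_1_nat[OF p(1)] by (simp add: multiplicity_times_same)
  then have "?f (p * m) p = real p powr (1 + (real (multiplicity p m) - 1 / (real p - 1)))"
    by (simp add: add_diff_eq)
  also have "\<dots> = real p * ?f m p" using p0 by (simp only: powr_add) simp
  finally have "?f (p * m) p = real p * ?f m p" .
  moreover have "?f (p * m) q = ?f m q" if "q \<in> prime_factors m - {p}" for q
    using that p m by (auto simp: prime_elem_multiplicity_mult_distrib in_prime_factors_iff
        prime_multiplicity_other)
  ultimately show ?thesis unfolding ramified_prod_def pf(1)
    by (simp add: prod.remove[OF _ pf(2)])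
qed

lemma ramified_prod_mult_not_dvd:
  assumes p: "prime p" "\<not> p dvd m" and m: "m > 0"
  shows "ramified_prod (p * m) = real p powr (1 - 1 / (real p - 1)) * ramified_prod m"
proof -
  let ?f = "\<lambda>n p. real p powr (real (multiplicity p n) - 1 / (real p - 1))"
  have p0: "p > 0" using p prime_gt_0_nat by blast
  have pf: "prime_factors (p * m) = insert p (prime_factors m)" "p \<notin> prime_factors m"
    using p m p0 by (auto simp: prime_factors_product prime_prime_factors in_prime_factors_iff)
  have "multiplicity p (p * m) = Suc 0"
    using p0 m p prime_gt_1_nat[OF p(1)] by (simp add: multiplicity_times_same not_dvd_imp_multiplicity_0)
  then have "?f (p * m) p = real p powr (1 - 1 / (real p - 1))"
    by simp
  moreover have "?f (p * m) q = ?f m q" if "q \<in> prime_factors m" for q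
  proof -
    have "prime q" "q \<noteq> p" using that pf(2) by auto
    then have "multiplicity q p = 0" using p(1) prime_multiplicity_other by blast
    then show ?thesis using \<open>prime q\<close> m p0 by (simp add: prime_elem_multiplicity_mult_distrib)
  qed
  ultimately show ?thesis unfolding ramified_prod_def pf(1)
    by (simp add: pf(2))
qed

text \<open>The classical discriminant formula, \<open>n ^ totient n\<close> divided by the product
  of all \<open>p powr (totient n / (p - 1))\<close>, with the \<open>totient n\<close>-th root
  taken prime by prime.\<close>

lemma diff_prod_prim_roots:
  assumes "n > 0"
  shows "diff_prod (prim_roots n) = ramified_prod n ^ totient n"
  using assms
proof (induction n rule: prime_divisors_induct)
  case (unit x)
  then show ?case by (simp add: diff_prod_def ramified_prod_def)
next
  case (factor p m)
  then have m: "m > 0" by simp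
  have p: "prime p" "p > 1" using factor prime_gt_1_nat by auto
  show ?case
  proof (cases "p dvd m")
    case True
    then show ?thesis
      using diff_prod_prim_roots_dvd[OF p(1) True m] ramified_prod_mult_dvd[OF p(1) True m]
        totient_prime_mult[OF p(1) m] factor.IH[OF m]
      by (simp add: power_mult_distrib power_mult mult.commute[of p])
  next
    case False
    let ?t = "totient m"
    have tot: "totient (p * m) = (p - 1) * ?t" using totient_prime_mult[OF p(1) m] False by simp
    \<comment> \<open>The new prime contributes the exponent \<open>(p - 2) * ?t\<close> and the
      squared resultant \<open>2 * ?t\<close>, together the \<open>p * ?t\<close> of the
      recursion.\<close>
    have e: "(1 - 1 / (real p - 1)) * real ((p - 1) * ?t) + real (2 * ?t) = real (p * ?t)"
      using p(2) by (simp add: of_nat_diff field_simps)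
    have "(real p powr (1 - 1 / (real p - 1))) ^ ((p - 1) * ?t) * real p ^ (2 * ?t) =
        real p powr ((1 - 1 / (real p - 1)) * real ((p - 1) * ?t)) * real p powr real (2 * ?t)"
      using p(2) by (simp only: powr_realpow[symmetric] powr_powr powr_gt_zero of_nat_0_less_iff)
    also have "\<dots> = real p powr real (p * ?t)" unfolding e[symmetric] by (simp only: powr_add)
    also have "\<dots> = real p ^ (p * ?t)" using p(2) by (intro powr_realpow) simp
    finally have P: "(real p powr (1 - 1 / (real p - 1))) ^ ((p - 1) * ?t) * real p ^ (2 * ?t) = real p ^ (p * ?t)" .
    have "diff_prod (prim_roots (p * m)) * real p ^ (2 * ?t) = ramified_prod (p * m) ^ totient (p * m) * real p ^ (2 * ?t)"
      unfolding diff_prod_prim_roots_not_dvd[OF p(1) False m] factor.IH[OF m] tot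
        ramified_prod_mult_not_dvd[OF p(1) False m] P[symmetric]
      by (simp add: power_mult_distrib mult_ac flip: power_mult)
    then show ?thesis using p(2) by simp
  qed
qed auto

subsection \<open>Algebraic integers form a ring\<close>

text \<open>The determinant trick: \<open>x\<close> is an eigenvalue of the integer matrix
  \<open>c\<close> with eigenvector \<open>w\<close>, hence a root of its monic characteristic
  polynomial.\<close>

lemma algebraic_int_eigenvalue:
  fixes x :: complex
  assumes I: "finite I"
    and eq: "\<And>i. i \<in> I \<Longrightarrow> x * w i = (\<Sum>j\<in>I. of_int (c i j) * w j)"
    and nz: "\<exists>i\<in>I. w i \<noteq> 0"
  shows "algebraic_int x"
proof -
  define k where "k = card I"
  obtain h where h: "bij_betw h {0..<k} I"
    using ex_bij_betw_nat_finite[OF I] by (auto simp: k_def)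
  define A :: "int mat" where "A = mat k k (\<lambda>(a, b). c (h a) (h b))"
  define B :: "complex mat" where "B = map_mat of_int A"
  define v where "v = vec k (\<lambda>a. w (h a))"
  have A: "A \<in> carrier_mat k k" by (simp add: A_def)
  then have B: "B \<in> carrier_mat k k" by (simp add: B_def)
  have "B *\<^sub>v v = x \<cdot>\<^sub>v v"
  proof (rule eq_vecI)
    show "dim_vec (B *\<^sub>v v) = dim_vec (x \<cdot>\<^sub>v v)" using B by (simp add: v_def)
    fix a assume "a < dim_vec (x \<cdot>\<^sub>v v)"
    then have a: "a < k" by (simp add: v_def)
    then have ha: "h a \<in> I" using h by (auto simp: bij_betw_def)
    have "(B *\<^sub>v v) $ a = (\<Sum>b = 0..<k. of_int (c (h a) (h b)) * w (h b))"
      using a by (simp add: B_def A_def v_def scalar_prod_def)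
    also have "\<dots> = (\<Sum>j\<in>I. of_int (c (h a) j) * w j)"
      using sum.reindex_bij_betw[OF h, of "\<lambda>j. of_int (c (h a) j) * w j"] .
    also have "\<dots> = (x \<cdot>\<^sub>v v) $ a" using eq[OF ha] a by (simp add: v_def)
    finally show "(B *\<^sub>v v) $ a = (x \<cdot>\<^sub>v v) $ a" .
  qed
  moreover have "v \<noteq> 0\<^sub>v k"
  proof
    assume v: "v = 0\<^sub>v k"
    obtain i where i: "i \<in> I" "w i \<noteq> 0" using nz by blast
    then obtain a where "a < k" "i = h a" using h by (auto simp: bij_betw_def)
    then have "v $ a \<noteq> 0" using i by (simp add: v_def)
    then show False using v \<open>a < k\<close> by simp
  qed
  ultimately have "eigenvector B v x" using B by (simp add: eigenvector_def v_def)
  then have "poly (char_poly B) x = 0"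
    using eigenvalue_root_char_poly[OF B, of x] by (auto simp: eigenvalue_def)
  moreover have "char_poly B = map_poly of_int (char_poly A)"
    unfolding B_def by (rule of_int_hom.char_poly_hom[OF A])
  moreover have "lead_coeff (char_poly A) = 1" using degree_monic_char_poly[OF A] by simp
  ultimately show ?thesis by (auto simp: algebraic_int_altdef_ipoly)
qed

lemma monic_root_power_reduce:
  fixes x :: complex
  assumes p: "poly (map_poly of_int p) x = 0" "lead_coeff p = 1"
  shows "degree p > 0" and "\<exists>c. x ^ k = (\<Sum>i<degree p. of_int (c i) * x ^ i)"
proof -
  have d0: "degree p \<noteq> 0"
  proof
    assume "degree p = 0"
    then obtain c where "p = [:c:]" using degree_0_id by metis
    then show False using p by simp
  qed
  then obtain a where a: "degree p = Suc a" by (cases "degree p") auto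
  have "poly (map_poly of_int p) x = (\<Sum>i\<le>Suc a. of_int (coeff p i) * x ^ i)"
    by (simp add: poly_altdef a)
  also have "\<dots> = (\<Sum>i<Suc a. of_int (coeff p i) * x ^ i) + x ^ Suc a"
    using p(2) a by (simp add: lessThan_Suc_atMost)
  finally have xa: "x ^ Suc a = (\<Sum>i<Suc a. of_int (- coeff p i) * x ^ i)"
    using p(1) by (simp only: of_int_minus mult_minus_left sum_negf eq_neg_iff_add_eq_0 add.commute)
  show "degree p > 0" using d0 by simp
  show "\<exists>c. x ^ k = (\<Sum>i<degree p. of_int (c i) * x ^ i)" for k
    unfolding a
  proof (induction k)
    case 0
    have "x ^ 0 = (\<Sum>i<Suc a. of_int (if i = 0 then 1 else 0) * x ^ i)"
      by (subst sum.lessThan_Suc_shift) simp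
    then show ?case by (intro exI[of _ "\<lambda>i. if i = 0 then 1 else 0"])
  next
    case (Suc k)
    then obtain c where c: "x ^ k = (\<Sum>i<Suc a. of_int (c i) * x ^ i)" by blast
    have "x ^ Suc k = (\<Sum>i<Suc a. of_int (c i) * x ^ Suc i)"
      unfolding power_Suc c sum_distrib_left by (simp only: mult_ac)
    also have "\<dots> = (\<Sum>i<a. of_int (c i) * x ^ Suc i) + of_int (c a) * x ^ Suc a"
      by (simp only: sum.lessThan_Suc)
    also have "(\<Sum>i<a. of_int (c i) * x ^ Suc i) = (\<Sum>i<Suc a. of_int (if i = 0 then 0 else c (i - 1)) * x ^ i)"
      by (subst sum.lessThan_Suc_shift) simp
    also have "of_int (c a) * x ^ Suc a = (\<Sum>i<Suc a. of_int (c a * - coeff p i) * x ^ i)"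
      unfolding xa by (simp only: sum_distrib_left of_int_mult mult.assoc)
    finally have "x ^ Suc k = (\<Sum>i<Suc a. of_int ((if i = 0 then 0 else c (i - 1)) + c a * - coeff p i) * x ^ i)"
      by (simp only: sum.distrib[symmetric] of_int_add distrib_right)
    then show ?case by (intro exI[of _ "\<lambda>i. (if i = 0 then 0 else c (i - 1)) + c a * - coeff p i"])
  qed
qed

lemma algebraic_int_power_reduce:
  fixes x :: complex
  assumes "algebraic_int x"
  obtains a where "a > 0" "\<And>k. \<exists>c. x ^ k = (\<Sum>i<a. of_int (c i) * x ^ i)"
proof -
  obtain p where p: "poly (map_poly of_int p) x = 0" "lead_coeff p = 1"
    using assms by (auto simp: algebraic_int_altdef_ipoly)
  show thesis using that monic_root_power_reduce[OF p] by blast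
qed

text \<open>The monomials \<open>x ^ i * y ^ j\<close> with \<open>i < a\<close>,
  \<open>j < b\<close> generate an abelian group stable under multiplication by \<open>x\<close> and
  \<open>y\<close>, so \<open>x + y\<close> and \<open>x * y\<close> act on it by integer
  matrices.\<close>

lemma algebraic_int_add_mult:
  fixes x y :: complex
  assumes "algebraic_int x" "algebraic_int y"
  shows "algebraic_int (x + y) \<and> algebraic_int (x * y)"
proof -
  obtain a where a: "a > 0" "\<And>k. \<exists>c. x ^ k = (\<Sum>i<a. of_int (c i) * x ^ i)"
    using algebraic_int_power_reduce[OF assms(1)] by blast
  obtain b where b: "b > 0" "\<And>k. \<exists>c. y ^ k = (\<Sum>i<b. of_int (c i) * y ^ i)"
    using algebraic_int_power_reduce[OF assms(2)] by blast
  define I where "I = {..<a} \<times> {..<b}"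
  define w where "w = (\<lambda>(i, j). x ^ i * y ^ j)"
  have fin: "finite I" by (simp add: I_def)
  have nz: "\<exists>i\<in>I. w i \<noteq> 0" using a b by (intro bexI[of _ "(0, 0)"]) (auto simp: I_def w_def)
  have ex: "\<exists>c. x ^ k * y ^ l = (\<Sum>s\<in>I. of_int (c s) * w s)" for k l
  proof -
    obtain c d where "x ^ k = (\<Sum>i<a. of_int (c i) * x ^ i)" "y ^ l = (\<Sum>j<b. of_int (d j) * y ^ j)"
      using a b by blast
    then have "x ^ k * y ^ l = (\<Sum>i<a. \<Sum>j<b. of_int (c i * d j) * (x ^ i * y ^ j))"
      by (simp add: sum_product mult_ac)
    also have "\<dots> = (\<Sum>s\<in>I. of_int (case s of (i, j) \<Rightarrow> c i * d j) * w s)"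
      unfolding I_def w_def sum.cartesian_product by (rule sum.cong) auto
    finally show ?thesis by (intro exI[of _ "\<lambda>s. case s of (i, j) \<Rightarrow> c i * d j"])
  qed
  obtain C where C: "x ^ k * y ^ l = (\<Sum>s\<in>I. of_int (C k l s) * w s)" for k l
    using ex by metis
  have "algebraic_int (x + y)"
  proof (rule algebraic_int_eigenvalue[OF fin _ nz])
    fix s assume "s \<in> I"
    obtain i j where s: "s = (i, j)" by (cases s)
    have "(x + y) * w s = x ^ Suc i * y ^ j + x ^ i * y ^ Suc j"
      by (simp add: w_def s algebra_simps)
    also have "\<dots> = (\<Sum>t\<in>I. of_int (C (Suc i) j t + C i (Suc j) t) * w t)"
      unfolding C by (simp add: sum.distrib algebra_simps)
    finally show "(x + y) * w s = (\<Sum>t\<in>I. of_int ((\<lambda>(i, j) t. C (Suc i) j t + C i (Suc j) t) s t) * w t)"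
      by (simp add: s)
  qed
  moreover have "algebraic_int (x * y)"
  proof (rule algebraic_int_eigenvalue[OF fin _ nz])
    fix s assume "s \<in> I"
    obtain i j where s: "s = (i, j)" by (cases s)
    have "(x * y) * w s = x ^ Suc i * y ^ Suc j"
      by (simp add: w_def s algebra_simps)
    then show "(x * y) * w s = (\<Sum>t\<in>I. of_int ((\<lambda>(i, j). C (Suc i) (Suc j)) s t) * w t)"
      unfolding C by (simp add: s)
  qed
  ultimately show ?thesis by blast
qed

lemma algebraic_int_add: "algebraic_int x \<Longrightarrow> algebraic_int y \<Longrightarrow> algebraic_int (x + y)"
  and algebraic_int_mult: "algebraic_int x \<Longrightarrow> algebraic_int y \<Longrightarrow> algebraic_int (x * y)"
  for x y :: complex
  using algebraic_int_add_mult by blast+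

lemma algebraic_int_diff: "algebraic_int x \<Longrightarrow> algebraic_int y \<Longrightarrow> algebraic_int (x - y)"
  for x y :: complex
  using algebraic_int_add[of x "- y"] by simp

lemma algebraic_int_of_int: "algebraic_int (of_int k :: complex)"
  by (intro int_imp_algebraic_int) auto

lemma algebraic_int_of_nat: "algebraic_int (of_nat k :: complex)"
  using algebraic_int_of_int[of "int k"] by simp

lemma algebraic_int_1: "algebraic_int (1 :: complex)"
  using algebraic_int_of_int[of 1] by simp

lemma algebraic_int_power: "algebraic_int x \<Longrightarrow> algebraic_int (x ^ k)" for x :: complex
  by (induction k) (auto intro: algebraic_int_mult algebraic_int_1)

lemma algebraic_int_sum: "(\<And>i. i \<in> A \<Longrightarrow> algebraic_int (f i)) \<Longrightarrow> algebraic_int (sum f A)"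
  for f :: "_ \<Rightarrow> complex"
  by (induction A rule: infinite_finite_induct) (auto intro: algebraic_int_add)

lemma algebraic_int_prod: "(\<And>i. i \<in> A \<Longrightarrow> algebraic_int (f i)) \<Longrightarrow> algebraic_int (prod f A)"
  for f :: "_ \<Rightarrow> complex"
  by (induction A rule: infinite_finite_induct) (auto intro: algebraic_int_mult algebraic_int_1)

lemma algebraic_int_root_unity:
  assumes "x ^ n = (1 :: complex)" "n > 0"
  shows "algebraic_int x"
proof (rule algebraic_int.intros[of "monom 1 n - 1"])
  have "degree (monom 1 n - 1 :: complex poly) = n"
    using degree_add_eq_left[of "- 1" "monom 1 n :: complex poly"] assms(2) by (simp add: degree_monom_eq)
  then show "lead_coeff (monom 1 n - 1 :: complex poly) = 1" using assms(2) by simp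
  show "\<forall>i. coeff (monom 1 n - 1 :: complex poly) i \<in> \<int>" by (auto simp: coeff_1)
  show "poly (monom 1 n - 1) x = 0" using assms by (simp add: poly_monom)
qed

lemma algebraic_int_coeff_prod_linear:
  assumes "\<And>a. a \<in> set as \<Longrightarrow> algebraic_int (a :: complex)"
  shows "algebraic_int (coeff (\<Prod>a\<leftarrow>as. [:- a, 1:]) i)"
  using assms
proof (induction as arbitrary: i)
  case Nil
  then show ?case by (simp add: coeff_1 algebraic_int_1)
next
  case (Cons a as)
  let ?P = "\<Prod>a\<leftarrow>as. [:- a, 1:]"
  have IH: "algebraic_int (coeff ?P i)" for i using Cons by simp
  have "coeff ([:- a, 1:] * ?P) i = (if i = 0 then 0 else coeff ?P (i - 1)) + - a * coeff ?P i"
    by (cases i) auto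
  moreover have "algebraic_int \<dots>"
    using IH Cons.prems[of a] by (intro algebraic_int_add algebraic_int_mult) auto
  ultimately show ?case by simp
qed

subsection \<open>Rational polynomials at roots of unity\<close>

text \<open>Polynomials are carried along instead of field elements, so that conjugation is a change
  of evaluation point.\<close>

definition rpoly :: "rat poly \<Rightarrow> complex \<Rightarrow> complex" where
  "rpoly p x = poly (map_poly of_rat p) x"

definition zpoly :: "int poly \<Rightarrow> complex \<Rightarrow> complex" where
  "zpoly p x = poly (map_poly of_int p) x"

interpretation of_rat_poly_hom: map_poly_idom_hom "of_rat :: rat \<Rightarrow> complex" ..

lemma rpoly_simps [simp]:
  "rpoly 0 x = 0" "rpoly 1 x = 1" "rpoly (p + q) x = rpoly p x + rpoly q x"
  "rpoly (p - q) x = rpoly p x - rpoly q x" "rpoly (- p) x = - rpoly p x"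
  "rpoly (p * q) x = rpoly p x * rpoly q x" "rpoly (p ^ k) x = rpoly p x ^ k"
  "rpoly (pCons a p) x = of_rat a + x * rpoly p x"
  "rpoly (monom a k) x = of_rat a * x ^ k"
  "rpoly (Polynomial.smult a p) x = of_rat a * rpoly p x"
  "rpoly (pcompose p q) x = rpoly p (rpoly q x)"
  "rpoly (prod f A) x = (\<Prod>i\<in>A. rpoly (f i) x)"
  by (simp_all add: rpoly_def of_rat_poly_hom.hom_add of_rat_poly_hom.hom_minus
      of_rat_poly_hom.hom_uminus of_rat_poly_hom.hom_mult of_rat_poly_hom.hom_power
      of_rat_hom.map_poly_pCons_hom of_rat_hom.map_poly_hom_smult poly_monom
      of_rat_hom.map_poly_pcompose poly_pcompose of_rat_poly_hom.hom_prod poly_prod)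

lemma rpoly_sum: "rpoly (sum f A) x = (\<Sum>i\<in>A. rpoly (f i) x)"
  by (induction A rule: infinite_finite_induct) auto

lemma zpoly_simps [simp]:
  "zpoly 0 x = 0" "zpoly 1 x = 1" "zpoly (p + q) x = zpoly p x + zpoly q x"
  "zpoly (p - q) x = zpoly p x - zpoly q x" "zpoly (- p) x = - zpoly p x"
  "zpoly (p * q) x = zpoly p x * zpoly q x" "zpoly (p ^ k) x = zpoly p x ^ k"
  "zpoly (pCons a p) x = of_int a + x * zpoly p x"
  "zpoly (monom a k) x = of_int a * x ^ k"
  "zpoly (Polynomial.smult a p) x = of_int a * zpoly p x"
  "zpoly (pcompose p q) x = zpoly p (zpoly q x)"
  by (simp_all add: zpoly_def of_int_poly_hom.hom_add of_int_poly_hom.hom_minus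
      of_int_poly_hom.hom_uminus of_int_poly_hom.hom_mult of_int_poly_hom.hom_power
      of_int_hom.map_poly_pCons_hom of_int_hom.map_poly_hom_smult poly_monom
      of_int_hom.map_poly_pcompose poly_pcompose)

lemma rpoly_of_int_poly: "rpoly (map_poly of_int p) x = zpoly p x"
  by (induction p) (auto simp: of_int_hom.map_poly_pCons_hom)

lemma algebraic_int_zpoly: "algebraic_int x \<Longrightarrow> algebraic_int (zpoly p x)"
  by (induction p) (auto intro!: algebraic_int_add algebraic_int_mult algebraic_int_of_int)

lemma algebraic_int_iff_zpoly: "algebraic_int x \<longleftrightarrow> (\<exists>p. zpoly p x = 0 \<and> lead_coeff p = 1)"
  by (simp add: algebraic_int_altdef_ipoly zpoly_def)

section \<open>Frobenius congruences modulo a prime\<close>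

lemma prime_power_add:
  fixes a b :: "'a :: comm_ring_1"
  assumes l: "prime l"
  shows "\<exists>r. (a + b) ^ l = a ^ l + b ^ l + of_nat l * r"
proof -
  have l0: "l > 0" using l prime_gt_0_nat by blast
  have dv: "\<exists>c. l choose k = l * c" if "k \<in> {1..<l}" for k
    using that dvd_choose_prime[of k l] l by (auto simp: dvd_def)
  then obtain c where c: "\<And>k. k \<in> {1..<l} \<Longrightarrow> l choose k = l * c k" by metis
  have "(a + b) ^ l = (\<Sum>k\<le>l. of_nat (l choose k) * a ^ k * b ^ (l - k))" by (rule binomial_ring)
  also have "{..l} = {0, l} \<union> {1..<l}" using l0 by auto
  also have "(\<Sum>k\<in>\<dots>. of_nat (l choose k) * a ^ k * b ^ (l - k)) =
      (\<Sum>k\<in>{0, l}. of_nat (l choose k) * a ^ k * b ^ (l - k)) +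
      (\<Sum>k\<in>{1..<l}. of_nat (l choose k) * a ^ k * b ^ (l - k))"
    by (rule sum.union_disjoint) auto
  also have "(\<Sum>k\<in>{0, l}. of_nat (l choose k) * a ^ k * b ^ (l - k)) = a ^ l + b ^ l"
    using l0 by simp
  also have "(\<Sum>k\<in>{1..<l}. of_nat (l choose k) * a ^ k * b ^ (l - k)) =
      (\<Sum>k\<in>{1..<l}. of_nat l * (of_nat (c k) * a ^ k * b ^ (l - k)))"
    by (rule sum.cong[OF refl]) (simp add: c mult.assoc)
  also have "\<dots> = of_nat l * (\<Sum>k\<in>{1..<l}. of_nat (c k) * a ^ k * b ^ (l - k))"
    by (simp add: sum_distrib_left)
  finally show ?thesis by blast
qed

lemma fermat_int:
  fixes a :: int
  assumes l: "prime l"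
  shows "\<exists>s. a ^ l = a + int l * s"
proof (induction a rule: int_induct[where k = 0])
  case base
  then show ?case using prime_gt_0_nat[OF l] by (intro exI[of _ 0]) simp
next
  case (step1 i)
  obtain r where "(i + 1) ^ l = i ^ l + 1 ^ l + int l * r" using prime_power_add[OF l] by blast
  moreover obtain s where "i ^ l = i + int l * s" using step1 by blast
  ultimately show ?case by (intro exI[of _ "s + r"]) (simp add: algebra_simps)
next
  case (step2 i)
  obtain r where "((i - 1) + 1) ^ l = (i - 1) ^ l + 1 ^ l + int l * r"
    using prime_power_add[OF l] by blast
  moreover obtain s where "i ^ l = i + int l * s" using step2 by blast
  ultimately show ?case by (intro exI[of _ "s - r"]) (simp add: algebra_simps)
qed

lemma frobenius_poly:
  fixes g :: "int poly"
  assumes l: "prime l"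
  shows "\<exists>r. g ^ l = pcompose g (monom 1 l) + Polynomial.smult (int l) r"
proof (induction g)
  case 0
  then show ?case using prime_gt_0_nat[OF l] by (intro exI[of _ 0]) simp
next
  case (pCons a g)
  then obtain r where r: "g ^ l = pcompose g (monom 1 l) + Polynomial.smult (int l) r" by blast
  obtain r2 where r2: "([:a:] + [:0, 1:] * g) ^ l = [:a:] ^ l + ([:0, 1:] * g) ^ l + of_nat l * r2"
    using prime_power_add[OF l] by blast
  obtain s where s: "a ^ l = a + int l * s" using fermat_int[OF l] by blast
  have "pCons a g ^ l = ([:a:] + [:0, 1:] * g) ^ l" by simp
  also have "\<dots> = [:a ^ l:] + monom 1 l * g ^ l + Polynomial.smult (int l) r2"
    unfolding r2 by (simp add: power_mult_distrib poly_const_pow x_as_monom x_pow_n[unfolded One_nat_def] of_nat_poly)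
  also have "\<dots> = pcompose (pCons a g) (monom 1 l) + Polynomial.smult (int l) ([:s:] + monom 1 l * r + r2)"
    unfolding r s by (simp add: pcompose_pCons algebra_simps smult_add_right)
  finally show ?case by blast
qed

subsection \<open>Irreducibility of cyclotomic polynomials\<close>

lemma algebraic_int_prim_root: "z \<in> prim_roots n \<Longrightarrow> n > 0 \<Longrightarrow> algebraic_int z"
  by (rule algebraic_int_root_unity[of z n]) auto

lemma algebraic_int_of_rat_iff: "algebraic_int (of_rat q :: complex) \<longleftrightarrow> q \<in> \<int>"
proof
  assume "algebraic_int (of_rat q :: complex)"
  then have "(of_rat q :: complex) \<in> \<int>" by (rule rational_algebraic_int_is_int) auto
  then obtain k where "(of_rat q :: complex) = of_int k" by (auto elim: Ints_cases)
  then have "(of_rat q :: complex) = of_rat (of_int k)" by simp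
  then show "q \<in> \<int>" by (simp only: of_rat_eq_iff) simp
qed (auto elim!: Ints_cases simp: algebraic_int_of_int)

lemma algebraic_int_div_nat_iff:
  assumes "l > 0"
  shows "algebraic_int (of_nat k / of_nat l :: complex) \<longleftrightarrow> l dvd k"
proof
  assume a: "algebraic_int (of_nat k / of_nat l :: complex)"
  have eq: "(of_nat k / of_nat l :: complex) = of_rat (of_nat k / of_nat l)" by (simp add: of_rat_divide)
  obtain m where "(of_nat k / of_nat l :: rat) = of_int m"
    using a unfolding eq algebraic_int_of_rat_iff by (auto elim: Ints_cases)
  then have "(of_int (int k) :: rat) = of_int (m * int l)" using assms by (simp add: field_simps)
  then have "int k = m * int l" by (simp only: of_int_eq_iff)
  then show "l dvd k" by (metis dvd_triv_right int_dvd_int_iff)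
next
  assume "l dvd k"
  then obtain c where "k = l * c" ..
  then have "(of_nat k / of_nat l :: complex) = of_nat c" using assms by simp
  then show "algebraic_int (of_nat k / of_nat l :: complex)" using algebraic_int_of_nat by simp
qed

text \<open>\<open>y - a\<close> is one of the factors whose product is
  \<open>n * y ^ (n - 1)\<close>, and \<open>y\<close> is a unit.\<close>

lemma algebraic_int_div_diff_roots_unity:
  assumes y: "y ^ n = 1" and a: "a ^ n = 1" and "y \<noteq> a" and n: "n > 0"
  shows "algebraic_int (of_nat n / (y - a) :: complex)"
proof -
  let ?A = "{w. w ^ n = y ^ n} - {y}"
  have y0: "y \<noteq> 0" using y n by (auto simp: zero_power)
  have fin: "finite ?A" using n by auto
  have "a \<in> ?A" using assms by auto
  then have "(y - a) * (\<Prod>w\<in>?A - {a}. y - w) = of_nat n * y ^ (n - 1)"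
    using prod_diff_other_nth_roots[OF y0 n] prod.remove[OF fin, of a "\<lambda>w. y - w"] by simp
  moreover have "y ^ (n - 1) * y = 1" using y n by (simp flip: power_Suc2)
  ultimately have "(y - a) * ((\<Prod>w\<in>?A - {a}. y - w) * y) = of_nat n"
    by (metis mult.assoc mult.right_neutral)
  then have "of_nat n / (y - a) = (\<Prod>w\<in>?A - {a}. y - w) * y" using \<open>y \<noteq> a\<close>
    by (simp add: field_simps)
  moreover have "algebraic_int y" using algebraic_int_root_unity[OF y n] .
  moreover have "algebraic_int w" if "w \<in> ?A - {a}" for w
    using algebraic_int_root_unity[of w n] that n y by auto
  ultimately show ?thesis
    by (auto intro!: algebraic_int_mult algebraic_int_prod algebraic_int_diff)
qed

lemma zpoly_linear_factors:
  assumes "lead_coeff g = 1"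
  shows "\<exists>as. (\<forall>x. zpoly g x = (\<Prod>a\<leftarrow>as. x - a)) \<and> (\<forall>a\<in>set as. zpoly g a = 0)"
proof -
  let ?G = "map_poly of_int g :: complex poly"
  have lc: "lead_coeff ?G = 1" using assms by simp
  obtain as where as: "Polynomial.smult (lead_coeff ?G) (\<Prod>a\<leftarrow>as. [:- a, 1:]) = ?G"
    using fundamental_theorem_algebra_factorized[of ?G] by blast
  then have as: "?G = (\<Prod>a\<leftarrow>as. [:- a, 1:])" unfolding lc by simp
  have e: "zpoly g x = (\<Prod>a\<leftarrow>as. x - a)" for x
    unfolding zpoly_def as by (induction as) (auto simp: algebra_simps)
  have "zpoly g a = 0" if "a \<in> set as" for a
    unfolding e using that by (induction as) auto
  with e show ?thesis by blast
qed

text \<open>If \<open>g(x\<^sup>l)\<close> were nonzero, it would divide a power of \<open>n\<close>, being a product of differences of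
  \<open>n\<close>-th roots of unity; but it is divisible by \<open>l\<close>, being congruent to \<open>g(x)\<^sup>l = 0\<close>.\<close>
lemma zpoly_root_power_prime:
  assumes g: "lead_coeff g = 1" "\<And>a. zpoly g a = 0 \<Longrightarrow> a ^ n = 1"
    and l: "prime l" "\<not> l dvd n" and n: "n > 0" and x: "zpoly g x = 0"
  shows "zpoly g (x ^ l) = 0"
proof (rule ccontr)
  assume nz: "zpoly g (x ^ l) \<noteq> 0"
  have xn: "x ^ n = 1" using g x by blast
  have yn: "(x ^ l) ^ n = 1" using xn by (metis mult.commute power_mult power_one)
  have l0: "l > 0" using l prime_gt_0_nat by blast
  obtain as where as: "\<forall>x. zpoly g x = (\<Prod>a\<leftarrow>as. x - a)" "\<forall>a\<in>set as. zpoly g a = 0"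
    using zpoly_linear_factors[OF g(1)] by blast
  have root: "a ^ n = 1 \<and> x ^ l \<noteq> a" if "a \<in> set as" for a
  proof -
    have "zpoly g a = 0" using as(2) that by blast
    then show ?thesis using g(2)[of a] nz by (metis (full_types))
  qed
  \<comment> \<open>Stated for lists \<open>bs\<close> of roots to allow induction;
    \<open>x ^ l\<close> differs from every root, so each factor divides \<open>n\<close> in the
    algebraic integers.\<close>
  have "algebraic_int (of_nat n ^ length bs / (\<Prod>a\<leftarrow>bs. x ^ l - a))" if "set bs \<subseteq> set as" for bs
    using that
  proof (induction bs)
    case (Cons b bs)
    have "algebraic_int ((of_nat n / (x ^ l - b)) * (of_nat n ^ length bs / (\<Prod>a\<leftarrow>bs. x ^ l - a)))"
      using Cons root[of b] yn n by (intro algebraic_int_mult algebraic_int_div_diff_roots_unity) auto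
    then show ?case by (simp add: mult_ac)
  qed (simp add: algebraic_int_1)
  from this[of as] have A: "algebraic_int (of_nat n ^ length as / zpoly g (x ^ l))"
    using as(1) by simp
  obtain r where r: "g ^ l = pcompose g (monom 1 l) + Polynomial.smult (int l) r"
    using frobenius_poly[OF l(1)] by blast
  have "zpoly (g ^ l) x = zpoly g (x ^ l) + of_nat l * zpoly r x" unfolding r by simp
  then have e: "zpoly g (x ^ l) = of_nat l * zpoly (- r) x"
    using x l0 by (simp add: eq_neg_iff_add_eq_0 zero_power)
  have "of_nat n ^ length as / of_nat l = (of_nat n ^ length as / zpoly g (x ^ l)) * zpoly (- r) x"
    using nz l0 unfolding e by (simp add: field_simps)
  moreover have "algebraic_int \<dots>"
    by (intro algebraic_int_mult A algebraic_int_zpoly algebraic_int_root_unity[OF xn n])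
  ultimately have "algebraic_int (of_nat (n ^ length as) / of_nat l :: complex)" by simp
  then have "l dvd n ^ length as" using algebraic_int_div_nat_iff[OF l0] by blast
  then show False using l prime_dvd_power by blast
qed

lemma rat_min_poly:
  assumes "p0 \<noteq> 0" "rpoly p0 z = 0"
  obtains f where "lead_coeff f = 1" "rpoly f z = 0" "\<And>p. rpoly p z = 0 \<Longrightarrow> f dvd p"
proof -
  obtain f0 where f0: "f0 \<noteq> 0" "rpoly f0 z = 0"
    and min: "\<And>p. p \<noteq> 0 \<Longrightarrow> rpoly p z = 0 \<Longrightarrow> degree f0 \<le> degree p"
    using ex_has_least_nat[of "\<lambda>p. p \<noteq> 0 \<and> rpoly p z = 0" p0 degree] assms by blast
  define f where "f = Polynomial.smult (inverse (lead_coeff f0)) f0"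
  have f: "lead_coeff f = 1" "rpoly f z = 0" "degree f = degree f0" "f \<noteq> 0"
    using f0 by (simp_all add: f_def)
  have "f dvd p" if p: "rpoly p z = 0" for p
  proof (rule ccontr)
    assume "\<not> f dvd p"
    then have nz: "p mod f \<noteq> 0" by (simp add: dvd_eq_mod_eq_0)
    have "rpoly p z = rpoly f z * rpoly (p div f) z + rpoly (p mod f) z"
      by (metis mult_div_mod_eq rpoly_simps(3,6))
    then have "rpoly (p mod f) z = 0" using f(2) p by simp
    then have "degree f0 \<le> degree (p mod f)" using min nz by blast
    then show False using degree_mod_less[of f p] f nz by simp
  qed
  with f show thesis using that by blast
qed

text \<open>Integrality comes without Gauss's lemma: the rational minimal polynomial divides
  \<open>X ^ n - 1\<close>, so its roots are roots of unity, and its coefficients are rational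
  algebraic integers.\<close>

lemma cyclotomic_min_poly:
  assumes z: "z \<in> prim_roots n" and n: "n > 0"
  obtains g :: "int poly" where "lead_coeff g = 1" "zpoly g z = 0"
    "\<And>p. rpoly p z = 0 \<Longrightarrow> map_poly of_int g dvd p" "\<And>a. zpoly g a = 0 \<Longrightarrow> a ^ n = 1"
proof -
  let ?X = "monom 1 n - 1 :: rat poly"
  have X0: "?X \<noteq> 0"
  proof
    assume "?X = 0"
    then have "coeff ?X n = 0" by simp
    then show False using n by (simp add: coeff_1)
  qed
  have "rpoly ?X z = 0" using z by simp
  then obtain f where f: "lead_coeff f = 1" "rpoly f z = 0" "\<And>p. rpoly p z = 0 \<Longrightarrow> f dvd p"
    using rat_min_poly[OF X0] by metis
  then have fX: "f dvd ?X" using \<open>rpoly ?X z = 0\<close> by blast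
  have root: "a ^ n = 1" if "rpoly f a = 0" for a
  proof -
    obtain h where "?X = f * h" using fX by blast
    then have "rpoly ?X a = 0" using that by simp
    then show ?thesis by simp
  qed
  let ?F = "map_poly of_rat f :: complex poly"
  have lc: "lead_coeff ?F = 1" using f by simp
  obtain as where as: "Polynomial.smult (lead_coeff ?F) (\<Prod>a\<leftarrow>as. [:- a, 1:]) = ?F"
    using fundamental_theorem_algebra_factorized[of ?F] by blast
  then have as: "?F = (\<Prod>a\<leftarrow>as. [:- a, 1:])" unfolding lc by simp
  have "algebraic_int a" if "a \<in> set as" for a
  proof -
    have "poly ?F a = 0" unfolding as using that by (induction as) auto
    then have "a ^ n = 1" using root by (simp add: rpoly_def)
    then show ?thesis using algebraic_int_root_unity n by blast
  qed
  then have "algebraic_int (coeff ?F i)" for i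
    unfolding as using algebraic_int_coeff_prod_linear by blast
  then have c: "coeff f i \<in> \<int>" for i by (simp add: algebraic_int_of_rat_iff)
  define g where "g = map_poly floor f"
  have g: "map_poly of_int g = f"
    by (rule poly_eqI) (use c in \<open>simp add: g_def coeff_map_poly\<close>)
  have "rat_of_int (lead_coeff g) = 1" using f(1) by (simp flip: g)
  then have "lead_coeff g = 1" by simp
  moreover have "zpoly g = rpoly f" using rpoly_of_int_poly[of g] unfolding g by (intro ext) simp
  ultimately show thesis using that[of g] f root g by metis
qed

text \<open>Irreducibility of the cyclotomic polynomial. Every \<open>w\<close> is
  \<open>z ^ k\<close> with \<open>k\<close> coprime to \<open>n\<close>, and is reached from
  \<open>z\<close> through one prime factor of \<open>k\<close> at a time, none of which divides
  \<open>n\<close>.\<close>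

theorem rpoly_prim_roots_conjugate:
  assumes z: "z \<in> prim_roots n" and w: "w \<in> prim_roots n" and n: "n > 0" and p: "rpoly p z = 0"
  shows "rpoly p w = 0"
proof -
  obtain g where g: "lead_coeff g = 1" "zpoly g z = 0"
    "\<And>p. rpoly p z = 0 \<Longrightarrow> map_poly of_int g dvd p" "\<And>a. zpoly g a = 0 \<Longrightarrow> a ^ n = 1"
    using cyclotomic_min_poly[OF z n] by metis
  have "coprime k n \<Longrightarrow> k > 0 \<Longrightarrow> zpoly g (z ^ k) = 0" for k
  proof (induction k rule: prime_divisors_induct)
    case (factor p k)
    have "zpoly g ((z ^ k) ^ p) = 0"
    proof (rule zpoly_root_power_prime[OF g(1) g(4)])
      show "zpoly g (z ^ k) = 0" using factor by auto
      have "coprime p n" using factor.prems(1) by simp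
      then show "\<not> p dvd n" using factor.hyps coprime_common_divisor[of p n p] by auto
    qed (use factor n in auto)
    then show ?case by (simp add: mult.commute power_mult)
  qed (use g in auto)
  moreover obtain k where "k \<in> totatives n" "w = z ^ k"
    using bij_betw_totatives_prim_roots[OF z n] w by (auto simp: bij_betw_def)
  ultimately have "zpoly g w = 0" by (auto simp: in_totatives_iff)
  moreover obtain h where "p = map_poly of_int g * h" using g(3)[OF p] by blast
  ultimately show ?thesis by (simp add: rpoly_of_int_poly)
qed

text \<open>The roots of the minimal polynomial \<open>g\<close> are exactly the primitive roots.
  For a root \<open>a\<close> of order \<open>m\<close>, the minimal polynomial \<open>g'\<close> of
  \<open>a\<close> divides \<open>g\<close>; the cofactor \<open>h\<close> cannot vanish at
  \<open>z\<close> for reasons of degree, so \<open>g'\<close> does, and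
  \<open>n dvd m\<close>.\<close>

lemma degree_cyclotomic_min_poly:
  assumes z: "z \<in> prim_roots n" and n: "n > 0"
  shows "\<exists>g. lead_coeff g = 1 \<and> degree g = totient n \<and> zpoly g z = 0"
proof -
  obtain g where g: "lead_coeff g = 1" "zpoly g z = 0"
    "\<And>p. rpoly p z = 0 \<Longrightarrow> map_poly of_int g dvd p" "\<And>a. zpoly g a = 0 \<Longrightarrow> a ^ n = 1"
    using cyclotomic_min_poly[OF z n] by metis
  let ?f = "map_poly of_int g :: rat poly"
  let ?G = "map_poly of_int g :: complex poly"
  have g0: "g \<noteq> 0" using g by auto
  have roots: "{a. zpoly g a = 0} = prim_roots n"
  proof (intro equalityI subsetI)
    fix a assume "a \<in> prim_roots n"
    then show "a \<in> {a. zpoly g a = 0}"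
      using rpoly_prim_roots_conjugate[OF z _ n, of a ?f] g by (simp add: rpoly_of_int_poly)
  next
    fix a assume "a \<in> {a. zpoly g a = 0}"
    then have a: "zpoly g a = 0" by simp
    obtain m where m: "m dvd n" "a \<in> prim_roots m" "m > 0"
      using root_unity_prim_roots[OF g(4)[OF a] n] by blast
    obtain g' where g': "lead_coeff g' = 1" "zpoly g' a = 0"
      "\<And>p. rpoly p a = 0 \<Longrightarrow> map_poly of_int g' dvd p" "\<And>b. zpoly g' b = 0 \<Longrightarrow> b ^ m = 1"
      using cyclotomic_min_poly[OF m(2,3)] by metis
    obtain h where h: "?f = map_poly of_int g' * h"
      using g'(3)[of ?f] a by (auto simp: rpoly_of_int_poly)
    have "rpoly ?f z = 0" using g by (simp add: rpoly_of_int_poly)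
    then have "zpoly g' z = 0 \<or> rpoly h z = 0" unfolding h by (simp add: rpoly_of_int_poly)
    then have "zpoly g' z = 0"
    proof
      assume "rpoly h z = 0"
      then have "?f dvd h" using g(3) by blast
      moreover have "h \<noteq> 0" using h g0 by auto
      ultimately have "degree ?f \<le> degree h" by (rule dvd_imp_degree_le)
      moreover have "degree ?f = degree g' + degree h"
        unfolding h using \<open>h \<noteq> 0\<close> g'(1) by (subst degree_mult_eq) auto
      ultimately have "degree g' = 0" by simp
      then obtain c where "g' = [:c:]" using degree_0_id by metis
      then have False using g' by simp
      then show ?thesis ..
    qed
    then have "n dvd m" using g'(4) prim_roots_power_eq_1_iff[OF z] by blast
    then show "a \<in> prim_roots n" using m dvd_antisym by blast
  qed
  have card: "card (prim_roots n) = totient n" using card_prim_roots[OF n] .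
  have G: "{a. poly ?G a = 0} = prim_roots n" using roots by (simp add: zpoly_def)
  have G0: "?G \<noteq> 0" using g0 by simp
  have "totient n \<le> degree g" using card_poly_roots_bound[OF G0] unfolding G card by simp
  \<comment> \<open>This excludes multiple roots: the \<open>n\<close> distinct roots of
    \<open>X ^ n - 1 = g * h\<close> are covered by the \<open>totient n\<close> roots of
    \<open>g\<close> and at most \<open>degree h\<close> roots of \<open>h\<close>.\<close>
  moreover have "degree g \<le> totient n"
  proof -
    obtain h where h: "monom 1 n - 1 = ?f * h"
      using g(3)[of "monom 1 n - 1"] z by auto
    let ?H = "map_poly of_rat h :: complex poly"
    have ev: "x ^ n - 1 = zpoly g x * rpoly h x" for x
      using arg_cong[OF h, of "\<lambda>p. rpoly p x"] by (simp add: rpoly_of_int_poly)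
    have "degree (monom 1 n - 1 :: rat poly) = n"
      using degree_add_eq_left[of "- 1" "monom 1 n :: rat poly"] n by (simp add: degree_monom_eq)
    moreover have h0: "h \<noteq> 0" using h n calculation by auto
    ultimately have deg: "n = degree g + degree h"
      using arg_cong[OF h, of degree] g0 by (simp add: degree_mult_eq)
    have H0: "?H \<noteq> 0" using h0 by simp
    have "{x::complex. x ^ n = 1} \<subseteq> prim_roots n \<union> {x. poly ?H x = 0}"
    proof
      fix x :: complex assume "x \<in> {x. x ^ n = 1}"
      then have "zpoly g x = 0 \<or> rpoly h x = 0" using ev[of x] by simp
      then show "x \<in> prim_roots n \<union> {x. poly ?H x = 0}" using roots by (auto simp: rpoly_def)
    qed
    then have "card {x::complex. x ^ n = 1} \<le> card (prim_roots n \<union> {x. poly ?H x = 0})"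
      by (rule card_mono[rotated]) (use n poly_roots_finite[OF H0] in auto)
    also have "\<dots> \<le> totient n + card {x. poly ?H x = 0}" using card_Un_le card by metis
    also have "card {x. poly ?H x = 0} \<le> degree h" using card_poly_roots_bound[OF H0] by simp
    finally show ?thesis using deg card_roots_unity_eq[OF n] by simp
  qed
  ultimately show ?thesis using g by auto
qed

subsection \<open>Traces and norms\<close>

lemma sum_power_prim_roots_int:
  assumes n: "n > 0"
  shows "(\<Sum>x\<in>prim_roots n. x ^ k) \<in> \<int>"
proof -
  obtain z where z: "z \<in> prim_roots n" using prim_roots_nonempty[OF n] by blast
  have "(z ^ k) ^ n = 1" using z by (metis mult.commute power_mult power_one prim_roots_power_self)
  then obtain m where "z ^ k \<in> prim_roots m" using root_unity_prim_roots n by metis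
  then show ?thesis using sum_power_prim_roots[OF n z] by (metis Ints_of_int)
qed

lemma trace_rat:
  assumes n: "n > 0"
  shows "(\<Sum>x\<in>prim_roots n. rpoly p x) \<in> \<rat>"
proof -
  have "(\<Sum>x\<in>prim_roots n. rpoly p x) =
      (\<Sum>i\<le>degree p. of_rat (coeff p i) * (\<Sum>x\<in>prim_roots n. x ^ i))"
    unfolding rpoly_def poly_altdef sum_distrib_left by (subst sum.swap) simp
  also have "\<dots> \<in> \<rat>"
    using subsetD[OF Ints_subset_Rats sum_power_prim_roots_int[OF n]]
    by (intro Rats_sum) (rule Rats_mult, simp, blast)
  finally show ?thesis .
qed

lemma rpoly_invariant_rat:
  assumes n: "n > 0" and inv: "\<And>x. x \<in> prim_roots n \<Longrightarrow> rpoly p x = c"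
  shows "c \<in> \<rat>"
proof -
  have "(\<Sum>x\<in>prim_roots n. rpoly p x) = of_nat (totient n) * c"
    using inv by (simp add: card_prim_roots[OF n])
  then have "c = (\<Sum>x\<in>prim_roots n. rpoly p x) / of_nat (totient n)" using n by simp
  then show ?thesis using trace_rat[OF n, of p] by simp
qed

text \<open>Composing \<open>p\<close> with \<open>X ^ k\<close> for each totative \<open>k\<close>
  writes the norm as one polynomial with the same value at every primitive root; such a value is
  rational, being a trace divided by \<open>totient n\<close>.\<close>

lemma norm_rpoly_eq:
  assumes n: "n > 0"
  shows "\<exists>q. \<forall>x\<in>prim_roots n. rpoly q x = (\<Prod>w\<in>prim_roots n. rpoly p w)"
proof (intro exI ballI)
  fix x assume x: "x \<in> prim_roots n"
  show "rpoly (\<Prod>k\<in>totatives n. pcompose p (monom 1 k)) x = (\<Prod>w\<in>prim_roots n. rpoly p w)"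
    using prod.reindex_bij_betw[OF bij_betw_totatives_prim_roots[OF x n], of "rpoly p"] by simp
qed

lemma norm_rat:
  assumes n: "n > 0"
  shows "(\<Prod>w\<in>prim_roots n. rpoly p w) \<in> \<rat>"
  using norm_rpoly_eq[OF n] rpoly_invariant_rat[OF n] by metis

lemma rpoly_conjugate_eq:
  assumes z: "z \<in> prim_roots n" and w: "w \<in> prim_roots n" and n: "n > 0" and eq: "rpoly p z = rpoly q z"
  shows "rpoly p w = rpoly q w"
  using rpoly_prim_roots_conjugate[OF z w n, of "p - q"] eq by simp

lemma algebraic_int_conjugate:
  assumes z: "z \<in> prim_roots n" and w: "w \<in> prim_roots n" and n: "n > 0"
    and a: "algebraic_int (rpoly p z)"
  shows "algebraic_int (rpoly p w)"
proof -
  obtain f where f: "zpoly f (rpoly p z) = 0" "lead_coeff f = 1"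
    using a by (auto simp: algebraic_int_iff_zpoly)
  then have "rpoly (pcompose (map_poly of_int f) p) z = 0" by (simp add: rpoly_of_int_poly)
  then have "rpoly (pcompose (map_poly of_int f) p) w = 0"
    by (rule rpoly_prim_roots_conjugate[OF z w n])
  then have "zpoly f (rpoly p w) = 0" by (simp add: rpoly_of_int_poly)
  then show ?thesis using f by (auto simp: algebraic_int_iff_zpoly)
qed

lemma trace_int:
  assumes z: "z \<in> prim_roots n" and n: "n > 0" and a: "algebraic_int (rpoly p z)"
  shows "(\<Sum>x\<in>prim_roots n. rpoly p x) \<in> \<int>"
  using trace_rat[OF n] algebraic_int_conjugate[OF z _ n a]
  by (intro rational_algebraic_int_is_int algebraic_int_sum) auto

lemma norm_int:
  assumes z: "z \<in> prim_roots n" and n: "n > 0" and a: "algebraic_int (rpoly p z)"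
  shows "(\<Prod>x\<in>prim_roots n. rpoly p x) \<in> \<int>"
  using norm_rat[OF n] algebraic_int_conjugate[OF z _ n a]
  by (intro rational_algebraic_int_is_int algebraic_int_prod) auto

lemma rpoly_nonzero_conjugate:
  assumes z: "z \<in> prim_roots n" and w: "w \<in> prim_roots n" and n: "n > 0" and "rpoly p z \<noteq> 0"
  shows "rpoly p w \<noteq> 0"
  using rpoly_prim_roots_conjugate[OF w z n] assms by blast

subsection \<open>The ring of integers\<close>

definition int_adj :: "complex \<Rightarrow> complex set" where
  "int_adj z = range (\<lambda>p. zpoly p z)"

lemma int_adj_zpoly [simp]: "zpoly p z \<in> int_adj z"
  by (simp add: int_adj_def)

lemma int_adj_add: "x \<in> int_adj z \<Longrightarrow> y \<in> int_adj z \<Longrightarrow> x + y \<in> int_adj z"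
  and int_adj_diff: "x \<in> int_adj z \<Longrightarrow> y \<in> int_adj z \<Longrightarrow> x - y \<in> int_adj z"
  and int_adj_mult: "x \<in> int_adj z \<Longrightarrow> y \<in> int_adj z \<Longrightarrow> x * y \<in> int_adj z"
  unfolding int_adj_def by (auto simp flip: zpoly_simps)

lemma int_adj_of_int: "of_int k \<in> int_adj z"
  using int_adj_zpoly[of "[:k:]" z] by simp

lemma int_adj_1: "1 \<in> int_adj z"
  using int_adj_of_int[of 1 z] by simp

lemma int_adj_Ints: "x \<in> \<int> \<Longrightarrow> x \<in> int_adj z"
  using int_adj_of_int by (auto elim: Ints_cases)

lemma int_adj_self: "z \<in> int_adj z"
  using int_adj_zpoly[of "[:0, 1:]" z] by simp

lemma int_adj_power: "x \<in> int_adj z \<Longrightarrow> x ^ k \<in> int_adj z"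
  by (induction k) (auto intro: int_adj_mult int_adj_1)

lemma int_adj_sum: "(\<And>i. i \<in> A \<Longrightarrow> f i \<in> int_adj z) \<Longrightarrow> sum f A \<in> int_adj z"
  using int_adj_of_int[of 0 z]
  by (induction A rule: infinite_finite_induct) (auto intro: int_adj_add)

lemma int_adj_prod: "(\<And>i. i \<in> A \<Longrightarrow> f i \<in> int_adj z) \<Longrightarrow> prod f A \<in> int_adj z"
  by (induction A rule: infinite_finite_induct) (auto intro: int_adj_mult int_adj_1)

lemma int_adj_subset: "y \<in> int_adj z \<Longrightarrow> int_adj y \<subseteq> int_adj z"
  by (auto simp: int_adj_def simp flip: zpoly_simps(11))

lemma int_adj_algebraic_int: "x \<in> int_adj z \<Longrightarrow> algebraic_int z \<Longrightarrow> algebraic_int x"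
  by (auto simp: int_adj_def algebraic_int_zpoly)

lemma zpoly_diff_dvd:
  assumes "a \<in> int_adj z" "b \<in> int_adj z"
  shows "\<exists>r\<in>int_adj z. zpoly g a - zpoly g b = (a - b) * r"
proof (induction g)
  case 0
  then show ?case using int_adj_of_int[of 0 z] by (intro bexI[of _ 0]) auto
next
  case (pCons c g)
  then obtain r where r: "r \<in> int_adj z" "zpoly g a - zpoly g b = (a - b) * r" by blast
  have "zpoly (pCons c g) a - zpoly (pCons c g) b = (a - b) * zpoly g a + b * (zpoly g a - zpoly g b)"
    by (simp add: algebra_simps)
  also have "\<dots> = (a - b) * (zpoly g a + b * r)" unfolding r(2) by (simp add: algebra_simps)
  finally show ?case
    using assms r(1) int_adj_subset[OF assms(1)] int_adj_zpoly[of g a]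
    by (intro bexI[of _ "zpoly g a + b * r"] int_adj_add int_adj_mult) auto
qed

lemma zpoly_frobenius_power:
  assumes l: "prime l"
  shows "\<exists>r\<in>int_adj x. zpoly g x ^ (l ^ k) = zpoly g (x ^ (l ^ k)) + of_nat l * r"
proof (induction k)
  case 0
  then show ?case using int_adj_of_int[of 0 x] by (intro bexI[of _ 0]) auto
next
  case (Suc k)
  let ?X = "zpoly g x ^ (l ^ k)" and ?A = "zpoly g (x ^ (l ^ k))"
  obtain c where c: "c \<in> int_adj x" "?X = ?A + of_nat l * c" using Suc by blast
  have xk: "x ^ (l ^ k) \<in> int_adj x" by (intro int_adj_power int_adj_self)
  have A: "?A \<in> int_adj x" using int_adj_subset[OF xk] int_adj_zpoly by blast
  let ?S = "\<Sum>i<l. ?A ^ (l - Suc i) * ?X ^ i"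
  have S: "?S \<in> int_adj x" using A by (intro int_adj_sum int_adj_mult int_adj_power) auto
  obtain r where "g ^ l = pcompose g (monom 1 l) + Polynomial.smult (int l) r"
    using frobenius_poly[OF l] by blast
  then have "zpoly (g ^ l) (x ^ (l ^ k)) = zpoly (pcompose g (monom 1 l) + Polynomial.smult (int l) r) (x ^ (l ^ k))"
    by metis
  then have r: "?A ^ l = zpoly g ((x ^ (l ^ k)) ^ l) + of_nat l * zpoly r (x ^ (l ^ k))" by simp
  have R: "zpoly r (x ^ (l ^ k)) \<in> int_adj x" using int_adj_subset[OF xk] int_adj_zpoly by blast
  have "?X ^ l - ?A ^ l = (?X - ?A) * ?S" by (rule power_diff_sumr2)
  also have "\<dots> = of_nat l * (c * ?S)" using c by simp
  finally have "?X ^ l = zpoly g ((x ^ (l ^ k)) ^ l) + of_nat l * (c * ?S + zpoly r (x ^ (l ^ k)))"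
    unfolding r by (simp add: algebra_simps)
  then have "zpoly g x ^ (l ^ Suc k) = zpoly g (x ^ (l ^ Suc k)) + of_nat l * (c * ?S + zpoly r (x ^ (l ^ k)))"
    by (simp add: power_mult[symmetric] mult.commute)
  moreover have "c * ?S + zpoly r (x ^ (l ^ k)) \<in> int_adj x"
    by (rule int_adj_add[OF int_adj_mult[OF c(1) S] R])
  ultimately show ?case by blast
qed

text \<open>Orthogonality: after exchanging the sums, the geometric sum of
  \<open>(w / z) ^ j\<close> vanishes unless \<open>w = z\<close>. Using all \<open>n\<close> powers
  of \<open>z\<close> instead of a basis makes \<open>n\<close> the only denominator.\<close>

lemma trace_expansion:
  assumes z: "z \<in> prim_roots n" and n: "n > 0"
  shows "of_nat n * rpoly p z = (\<Sum>j<n. (\<Sum>w\<in>prim_roots n. rpoly p w * w ^ j) * inverse z ^ j)"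
proof -
  have z0: "z \<noteq> 0" using prim_roots_nonzero[OF z n] .
  have "(\<Sum>j<n. (\<Sum>w\<in>prim_roots n. rpoly p w * w ^ j) * inverse z ^ j) =
      (\<Sum>w\<in>prim_roots n. rpoly p w * (\<Sum>j<n. (w * inverse z) ^ j))"
    unfolding sum_distrib_left sum_distrib_right
    by (subst sum.swap) (simp add: power_mult_distrib mult_ac)
  also have "\<dots> = (\<Sum>w\<in>prim_roots n. if w = z then rpoly p z * of_nat n else 0)"
  proof (rule sum.cong[OF refl])
    fix w assume w: "w \<in> prim_roots n"
    show "rpoly p w * (\<Sum>j<n. (w * inverse z) ^ j) = (if w = z then rpoly p z * of_nat n else 0)"
    proof (cases "w = z")
      case True
      then show ?thesis using z0 by simp
    next
      case False
      then have "w * inverse z \<noteq> 1" using z0 by (simp add: field_simps)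
      moreover have "(w * inverse z) ^ n = 1" using z w by (simp add: power_mult_distrib power_inverse)
      ultimately have "(\<Sum>j<n. (w * inverse z) ^ j) = 0" by (simp add: geometric_sum)
      then show ?thesis using False by simp
    qed
  qed
  also have "\<dots> = rpoly p z * of_nat n" using z n by (simp add: sum.delta)
  finally show ?thesis by simp
qed

lemma trace_coeff_int:
  assumes z: "z \<in> prim_roots n" and n: "n > 0" and a: "algebraic_int (rpoly p z)"
  shows "(\<Sum>w\<in>prim_roots n. rpoly p w * w ^ j) \<in> \<int>"
proof -
  have "algebraic_int (rpoly (p * monom 1 j) z)"
    using a algebraic_int_prim_root[OF z n] by (auto intro!: algebraic_int_mult algebraic_int_power)
  then show ?thesis using trace_int[OF z n, of "p * monom 1 j"] by simp
qed

lemma inverse_prim_root: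
  assumes "z \<in> prim_roots n" and n: "n > 0"
  shows "inverse z = z ^ (n - 1)"
proof -
  have "z ^ (n - 1) * z = 1" using assms by (simp flip: power_Suc2)
  then show ?thesis using inverse_unique[of z "z ^ (n - 1)"] by (simp add: mult.commute)
qed

lemma order_mult_int_adj:
  assumes z: "z \<in> prim_roots n" and n: "n > 0" and a: "algebraic_int (rpoly p z)"
  shows "of_nat n * rpoly p z \<in> int_adj z"
  unfolding trace_expansion[OF z n] inverse_prim_root[OF z n]
  by (rule int_adj_sum, rule int_adj_mult[OF int_adj_Ints[OF trace_coeff_int[OF z n a]]])
     (intro int_adj_power int_adj_self)

text \<open>Cyclotomic units: with \<open>u = w ^ k\<close> the quotient is a geometric sum, and
  exchanging \<open>u\<close> and \<open>w\<close> treats its inverse.\<close>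

lemma one_minus_quotient_int_adj:
  assumes w: "w \<in> prim_roots q" and u: "u \<in> prim_roots q" and q: "q > 1"
  shows "(1 - u) / (1 - w) \<in> int_adj w"
proof -
  have q0: "q > 0" using q by simp
  obtain k where k: "u = w ^ k" using prim_roots_coprimeE[OF w q0 u] by blast
  have w1: "w \<noteq> 1" using prim_roots_power_eq_1_iff[OF w, of 1] q by auto
  have "(1 - u) / (1 - w) = (\<Sum>i<k. w ^ i)"
    unfolding k using w1 by (simp add: one_diff_power_eq)
  then show ?thesis by (simp add: int_adj_sum int_adj_power int_adj_self)
qed

lemma ex_power_cong_1:
  fixes l m :: nat
  assumes c: "coprime l m" and m: "m > 0"
  shows "\<exists>k>0. [l ^ k = 1] (mod m)"
proof -
  have "\<not> inj (\<lambda>j. l ^ j mod m)"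
  proof
    assume "inj (\<lambda>j. l ^ j mod m)"
    moreover have "range (\<lambda>j. l ^ j mod m) \<subseteq> {..<m}" using m by auto
    ultimately show False using finite_subset finite_imageD by (metis finite_lessThan infinite_UNIV_nat)
  qed
  then obtain i j where ij: "i < j" "l ^ i mod m = l ^ j mod m"
    unfolding inj_def by (metis linorder_neqE_nat)
  have "l ^ j = l ^ i * l ^ (j - i)" using ij by (simp flip: power_add)
  then have "[l ^ i * l ^ (j - i) = l ^ i * 1] (mod m)" using ij by (simp add: cong_def)
  moreover have "coprime (l ^ i) m" using c by simp
  ultimately have "[l ^ (j - i) = 1] (mod m)" by (simp only: cong_mult_lcancel_nat)
  then show ?thesis using ij by (intro exI[of _ "j - i"]) auto
qed

text \<open>With \<open>q\<close> the exact power of \<open>l\<close> in \<open>n = q m\<close> and \<open>\<pi> = 1 - u\<close> for a primitive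
  \<open>q\<close>-th root of unity \<open>u\<close>, the number \<open>l\<close> is a unit multiple of a power of \<open>\<pi>\<close>. Modulo \<open>\<pi>\<close> every
  element of the ring comes from a primitive \<open>m\<close>-th root of unity \<open>v\<close>, where a power of Frobenius
  acts trivially.\<close>
lemma int_adj_saturated:
  assumes l: "prime l" and nq: "n = l ^ Suc e * m" and lm: "\<not> l dvd m" and m: "m > 0"
    and z: "z \<in> prim_roots n" and y: "y \<in> int_adj z" and a: "algebraic_int (y / of_nat l)"
  shows "y / of_nat l \<in> int_adj z"
proof -
  define q where "q = l ^ Suc e"
  define u where "u = z ^ m"
  define v where "v = z ^ q"
  define \<pi> where "\<pi> = 1 - u"
  define h where "h = card (prim_roots q)"
  have l1: "l > 1" "l > 0" using prime_gt_1_nat[OF l] by auto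
  have q1: "q > 1" "q > 0" using l1 unfolding q_def by (metis one_less_power zero_less_Suc) (use l1 in simp)
  have n: "n > 0" "n = m * q" "n = q * m" using q1 m by (auto simp: nq q_def)
  have cop: "coprime q m" unfolding q_def using l lm by (simp add: prime_imp_coprime)
  have zq: "z \<in> prim_roots (m * q)" "z \<in> prim_roots (q * m)" using z n(2) by (simp_all add: mult.commute)
  have u: "u \<in> prim_roots q" unfolding u_def using prim_roots_power_mult[OF zq(1) m] .
  have v: "v \<in> prim_roots m" unfolding v_def using prim_roots_power_mult[OF zq(2) q1(2)] .
  have uR: "u \<in> int_adj z" unfolding u_def by (intro int_adj_power int_adj_self)
  have vR: "v \<in> int_adj z" unfolding v_def by (intro int_adj_power int_adj_self)
  have algz: "algebraic_int z" using algebraic_int_prim_root[OF z n(1)] .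
  have u1: "u \<noteq> 1" using prim_roots_power_eq_1_iff[OF u, of 1] q1 by auto
  then have \<pi>0: "\<pi> \<noteq> 0" by (simp add: \<pi>_def)
  have \<pi>R: "\<pi> \<in> int_adj z" unfolding \<pi>_def by (intro int_adj_diff int_adj_1 uR)

  have prd: "(\<Prod>w\<in>prim_roots q. 1 - w) = of_nat l"
    unfolding q_def by (rule prod_one_minus_prim_roots_prime_power[OF l])
  have wR: "int_adj w \<subseteq> int_adj z" if w: "w \<in> prim_roots q" for w
  proof -
    obtain k where "w = u ^ k" using prim_roots_coprimeE[OF u q1(2) w] by blast
    then show ?thesis using uR by (intro int_adj_subset) (auto intro: int_adj_power)
  qed
  \<comment> \<open>\<open>\<epsilon>\<close> and \<open>\<delta>\<close> are mutually inverse units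
    with \<open>\<pi> ^ h = \<epsilon> * l\<close> and
    \<open>l = \<delta> * \<pi> ^ h\<close>.\<close>
  define \<epsilon> where "\<epsilon> = (\<Prod>w\<in>prim_roots q. (1 - u) / (1 - w))"
  define \<delta> where "\<delta> = (\<Prod>w\<in>prim_roots q. (1 - w) / (1 - u))"
  have \<epsilon>R: "\<epsilon> \<in> int_adj z" unfolding \<epsilon>_def
    using one_minus_quotient_int_adj[OF _ u q1(1)] wR by (intro int_adj_prod) blast
  have \<delta>R: "\<delta> \<in> int_adj z" unfolding \<delta>_def
    using one_minus_quotient_int_adj[OF u _ q1(1)] wR[OF u] by (intro int_adj_prod) blast
  have \<epsilon>: "\<epsilon> = \<pi> ^ h / of_nat l" unfolding \<epsilon>_def by (simp add: prod_dividef prd h_def \<pi>_def)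
  have \<delta>: "\<delta> = of_nat l / \<pi> ^ h" unfolding \<delta>_def by (simp add: prod_dividef prd h_def \<pi>_def)
  have h0: "h > 0" unfolding h_def using q1 prim_roots_nonempty by (simp add: card_gt_0_iff)
  obtain h' where h': "h = Suc h'" using h0 by (cases h) auto

  \<comment> \<open>The Chinese remainder theorem splits \<open>z\<close> into a part of order prime
    to \<open>l\<close> and one of \<open>l\<close>-power order. Since \<open>u\<close> is 1 modulo
    \<open>\<pi>\<close>, \<open>z\<close> is congruent to \<open>v ^ t\<close>.\<close>
  obtain s t where st: "z = v ^ t * u ^ s"
  proof -
    obtain s where s: "[m * s = 1] (mod q)" using cong_solve_coprime_nat cop by (metis coprime_commute One_nat_def)
    obtain t where t: "[q * t = 1] (mod m)" using cong_solve_coprime_nat cop by (metis One_nat_def)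
    have "[m * s + q * t = 1 + 0] (mod q)" using s by (intro cong_add) (auto simp: cong_0_iff)
    moreover have "[m * s + q * t = 0 + 1] (mod m)" using t by (intro cong_add) (auto simp: cong_0_iff)
    ultimately have "[m * s + q * t = 1] (mod n)" unfolding n(3)
      using cop by (intro coprime_cong_mult_nat) auto
    then have "z ^ (m * s + q * t) = z ^ 1" using prim_roots_power_eq_iff[OF z n(1)] by blast
    then have "z = v ^ t * u ^ s" by (simp add: u_def v_def power_add power_mult mult.commute)
    then show thesis using that by blast
  qed
  have usR: "(u ^ s - 1) / \<pi> \<in> int_adj z"
  proof -
    have "(u ^ s - 1) / \<pi> = - (\<Sum>i<s. u ^ i)" unfolding \<pi>_def using u1
      by (simp add: geometric_sum field_simps)
    also have "\<dots> = 0 - (\<Sum>i<s. u ^ i)" by simp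
    also have "\<dots> \<in> int_adj z" using int_adj_of_int[of 0 z]
      by (intro int_adj_diff int_adj_sum int_adj_power uR) auto
    finally show ?thesis .
  qed
  \<comment> \<open>Divisibility by \<open>\<pi>\<close> is transferred to \<open>b\<close>, the
    value of the same polynomial at \<open>v ^ t\<close>: it differs from \<open>x\<close> by a
    multiple of \<open>\<pi>\<close> and lies in the smaller ring generated by \<open>v\<close>,
    whose order \<open>m\<close> is prime to \<open>l\<close>.\<close>
  have \<pi>_sat: "x / \<pi> \<in> int_adj z" if x: "x \<in> int_adj z" "algebraic_int (x / \<pi>)" for x
  proof -
    obtain g where g: "x = zpoly g z" using x by (auto simp: int_adj_def)
    define b where "b = zpoly g (v ^ t)"
    have vtR: "v ^ t \<in> int_adj z" by (intro int_adj_power vR)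
    have bv: "b \<in> int_adj v" unfolding b_def
      using int_adj_subset[OF int_adj_power[OF int_adj_self]] int_adj_zpoly by blast
    obtain g' where g': "b = zpoly g' v" using bv by (auto simp: int_adj_def)
    obtain r where r: "r \<in> int_adj z" "x - b = (z - v ^ t) * r"
      using zpoly_diff_dvd[OF int_adj_self vtR] unfolding g b_def by blast
    have "z - v ^ t = v ^ t * (u ^ s - 1)" by (subst st) (simp add: algebra_simps)
    then have xb: "(x - b) / \<pi> = v ^ t * ((u ^ s - 1) / \<pi>) * r" using r(2) by simp
    then have xbR: "(x - b) / \<pi> \<in> int_adj z"
      using int_adj_mult[OF int_adj_mult[OF vtR usR] r(1)] by metis
    have "b / \<pi> = x / \<pi> - (x - b) / \<pi>" by (simp add: diff_divide_distrib)
    then have ab: "algebraic_int (b / \<pi>)"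
      using x(2) int_adj_algebraic_int[OF xbR algz] by (simp add: algebraic_int_diff)
    obtain k0 where k0: "k0 > 0" "[l ^ k0 = 1] (mod m)"
      using ex_power_cong_1[of l m] l lm m by (auto simp: prime_imp_coprime)
    \<comment> \<open>The exponent does two things: as a multiple of \<open>k0\<close> it gives
      \<open>v ^ (l ^ k) = v\<close>, and \<open>l ^ k \<ge> h\<close> makes
      \<open>b ^ (l ^ k)\<close> divisible by \<open>\<pi> ^ h\<close>, hence by \<open>l\<close>.
      Frobenius then makes \<open>b\<close> itself divisible by \<open>l\<close>.\<close>
    define k where "k = k0 * h"
    have "h \<le> k" unfolding k_def using k0 by (cases k0) auto
    also have "k < 2 ^ k" by (rule less_exp)
    also have "2 ^ k \<le> l ^ k" using l1 by (intro power_mono) auto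
    finally have hk: "h \<le> l ^ k" by simp
    have "[(l ^ k0) ^ h = 1 ^ h] (mod m)" using k0(2) by (rule cong_pow)
    then have "[l ^ k = 1] (mod m)" by (simp add: k_def power_mult)
    then have vk: "v ^ (l ^ k) = v" using prim_roots_power_eq_iff[OF v m, of "l ^ k" 1] by simp
    have "b ^ (l ^ k) / of_nat l = (b / \<pi>) ^ (l ^ k) * (\<pi> ^ (l ^ k - h) * \<epsilon>)"
    proof -
      have "\<pi> ^ (l ^ k) = \<pi> ^ (l ^ k - h) * \<pi> ^ h" using hk by (simp flip: power_add)
      then show ?thesis unfolding \<epsilon> using \<pi>0 by (simp add: power_divide)
    qed
    also have "algebraic_int \<dots>" using ab int_adj_algebraic_int[OF _ algz] \<pi>R \<epsilon>R
      by (intro algebraic_int_mult algebraic_int_power) auto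
    finally have "algebraic_int (b ^ (l ^ k) / of_nat l)" .
    moreover obtain c where c: "c \<in> int_adj v" "b ^ (l ^ k) = b + of_nat l * c"
      using zpoly_frobenius_power[OF l, of v g' k] unfolding g' vk by blast
    then have "b / of_nat l = b ^ (l ^ k) / of_nat l - c" using l1 by (simp add: field_simps)
    moreover have "algebraic_int c" using int_adj_algebraic_int[OF c(1) algebraic_int_prim_root[OF v m]] .
    ultimately have abl: "algebraic_int (b / of_nat l)" by (simp add: algebraic_int_diff)
    have "b / of_nat l = rpoly (Polynomial.smult (1 / of_nat l) (map_poly of_int g')) v"
      by (simp add: g' rpoly_of_int_poly of_rat_divide)
    then have mb: "of_nat m * (b / of_nat l) \<in> int_adj v"
      using order_mult_int_adj[OF v m] abl by metis
    \<comment> \<open>Both \<open>m * (b / l)\<close> and \<open>l * (b / l)\<close> lie in the ring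
      generated by \<open>v\<close>, and \<open>m\<close> and \<open>l\<close> are coprime.\<close>
    have "b / of_nat l \<in> int_adj v"
    proof -
      have "coprime (int m) (int l)" using l lm by (simp add: prime_imp_coprime coprime_commute)
      then obtain i j where ij: "i * int m + j * int l = 1"
        using bezout_int[of "int m" "int l"] by auto
      have "b / of_nat l = of_int (i * int m + j * int l) * (b / of_nat l)" unfolding ij by simp
      also have "\<dots> = of_int i * (of_nat m * (b / of_nat l)) + of_int j * b"
        using l1 by (simp add: algebra_simps)
      also have "\<dots> \<in> int_adj v"
        by (rule int_adj_add[OF int_adj_mult[OF int_adj_of_int mb] int_adj_mult[OF int_adj_of_int bv]])
      finally show ?thesis .
    qed
    then have blR: "b / of_nat l \<in> int_adj z" using int_adj_subset[OF vR] by blast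
    have "b / \<pi> = (b / of_nat l) * (\<delta> * \<pi> ^ h')" unfolding \<delta> h' using l1 \<pi>0 by simp
    then have "x / \<pi> = (b / of_nat l) * (\<delta> * \<pi> ^ h') + (x - b) / \<pi>" by (simp add: diff_divide_distrib)
    then show ?thesis
      using int_adj_add[OF int_adj_mult[OF blR int_adj_mult[OF \<delta>R int_adj_power[OF \<pi>R]]] xbR] by metis
  qed
  \<comment> \<open>One factor \<open>\<pi>\<close> is split off at a time; the quotients stay
    integral because \<open>y / l\<close> is integral and \<open>\<pi> ^ Suc i\<close> divides
    \<open>l\<close>.\<close>
  have "y / \<pi> ^ i \<in> int_adj z" if "i \<le> h" for i
    using that
  proof (induction i)
    case (Suc i)
    have "y / \<pi> ^ i / \<pi> = (y / of_nat l) * (\<delta> * \<pi> ^ (h - Suc i))"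
    proof -
      have "\<pi> ^ h = \<pi> ^ Suc i * \<pi> ^ (h - Suc i)" using Suc.prems by (simp only: flip: power_add) simp
      then show ?thesis unfolding \<delta> using l1 \<pi>0 by simp
    qed
    also have "algebraic_int \<dots>" using a int_adj_algebraic_int[OF _ algz] \<pi>R \<delta>R
      by (intro algebraic_int_mult algebraic_int_power) auto
    finally have "y / \<pi> ^ i / \<pi> \<in> int_adj z" using Suc by (intro \<pi>_sat) auto
    then show ?case by (simp add: field_simps)
  qed (use y in simp)
  from this[of h] have "y / \<pi> ^ h * \<epsilon> \<in> int_adj z" using \<epsilon>R by (intro int_adj_mult) auto
  moreover have "y / \<pi> ^ h * \<epsilon> = y / of_nat l" unfolding \<epsilon> using \<pi>0 by simp
  ultimately show ?thesis by simp
qed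

theorem algebraic_int_rpoly_in_int_adj:
  assumes z: "z \<in> prim_roots n" and n: "n > 0" and a: "algebraic_int (rpoly p z)"
  shows "rpoly p z \<in> int_adj z"
proof -
  have sat: "k dvd n \<Longrightarrow> algebraic_int x \<Longrightarrow> of_nat k * x \<in> int_adj z \<Longrightarrow> x \<in> int_adj z" for k x
  proof (induction k rule: prime_divisors_induct)
    case (factor l k)
    have l: "prime l" "l dvd n" "k dvd n" using factor by (auto dest: dvd_mult_left dvd_mult_right)
    obtain m where m: "n = l ^ multiplicity l n * m" "\<not> l dvd m"
      using multiplicity_decompose'[of n l] n l(1) by (metis gr_implies_not0 not_prime_unit)
    obtain e where e: "multiplicity l n = Suc e"
      using prime_multiplicity_gt_zero_iff[of l n] l n by (cases "multiplicity l n") auto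
    have "of_nat (l * k) * x / of_nat l \<in> int_adj z"
    proof (rule int_adj_saturated[OF l(1) _ m(2) _ z])
      show "n = l ^ Suc e * m" using m(1) e by simp
      show "m > 0" using m n by (cases m) auto
      show "of_nat (l * k) * x \<in> int_adj z" using factor by simp
      have "of_nat (l * k) * x / of_nat l = of_nat k * x" using prime_gt_0_nat[OF l(1)] by simp
      then show "algebraic_int (of_nat (l * k) * x / of_nat l)"
        using factor algebraic_int_of_nat by (simp add: algebraic_int_mult)
    qed
    moreover have "of_nat (l * k) * x / of_nat l = of_nat k * x" using prime_gt_0_nat[OF l(1)] by simp
    ultimately have "of_nat k * x \<in> int_adj z" by (simp only:)
    then show ?case by (rule factor.IH[OF l(3) factor.prems(2)])
  qed (use n in auto)
  show ?thesis by (rule sat[OF dvd_refl a order_mult_int_adj[OF z n a]])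
qed

lemma int_adj_rpoly: "x \<in> int_adj z \<Longrightarrow> \<exists>p. x = rpoly p z"
  by (auto simp: int_adj_def simp flip: rpoly_of_int_poly)

subsection \<open>Roots of unity in a cyclotomic field\<close>

text \<open>Otherwise the field contains a primitive root of unity \<open>w\<close> of order \<open>l n\<close> for a prime \<open>l\<close>, and \<open>w\<close> is
  a polynomial in \<open>w\<^sup>l\<close>. Then every conjugate \<open>w\<^sup>1\<^sup>+\<^sup>n\<^sup>t\<close> of \<open>w\<close> equals \<open>w\<close>, which fails for \<open>t = 1\<close> or
  \<open>t = 2\<close>.\<close>
lemma prim_root_order_dvd_even:
  assumes z: "z \<in> prim_roots n" and n: "n > 0" "even n"
    and x: "rpoly p z \<in> prim_roots N" and N: "N > 0"
  shows "N dvd n"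
proof (rule ccontr)
  assume "\<not> N dvd n"
  then obtain l where l: "prime l" "multiplicity l n < multiplicity l N"
    using multiplicity_le_imp_dvd[of N n] N by (metis not_le less_numeral_extra(3))
  define e where "e = multiplicity l n"
  have l1: "l > 1" "l > 0" using prime_gt_1_nat[OF l(1)] by auto
  obtain m where m: "n = l ^ e * m" "\<not> l dvd m"
    using multiplicity_decompose'[of n l] n l(1) unfolding e_def by (metis gr_implies_not0 not_prime_unit)
  have "l ^ Suc e dvd N" using l(2) unfolding e_def by (intro multiplicity_dvd') simp
  then obtain N' where N': "N = N' * l ^ Suc e" by (metis dvdE mult.commute)
  then have N'0: "N' > 0" using N by (cases N') auto
  have y: "rpoly p z ^ N' \<in> prim_roots (l ^ Suc e)"
    using prim_roots_power_mult[of "rpoly p z" N' "l ^ Suc e"] x N' N'0 by simp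
  have v: "z ^ (l ^ e) \<in> prim_roots m"
    using prim_roots_power_mult[of z "l ^ e" m] z m l1 by simp
  \<comment> \<open>The product of the two parts has order \<open>l ^ Suc e * m = l * n\<close>,
    while \<open>w\<close> remains a polynomial \<open>q\<close> in \<open>z\<close>.\<close>
  define q where "q = p ^ N' * monom 1 (l ^ e)"
  define w where "w = rpoly q z"
  have "coprime (l ^ Suc e) m" using l m by (simp add: prime_imp_coprime)
  then have "w \<in> prim_roots (l ^ Suc e * m)"
    unfolding w_def q_def using prim_roots_mult_coprime[OF y v] by simp
  then have w: "w \<in> prim_roots (l * n)" by (simp add: m mult.assoc)
  have ln: "l * n > 0" using l1 n by simp
  have "w ^ l \<in> prim_roots n" using prim_roots_power_mult[OF w l1(2)] .
  then obtain b where b: "z = (w ^ l) ^ b" using prim_roots_coprimeE[OF _ n(1) z] by blast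
  have z': "w ^ (l * b) = z" using b by (simp add: power_mult)
  have rel: "rpoly (pcompose q (monom 1 (l * b)) - monom 1 1) w = 0"
    using z' by (simp add: w_def[symmetric])
  have w0: "w \<noteq> 0" using prim_roots_nonzero[OF w] l1 n by simp
  \<comment> \<open>The conjugation \<open>w \<mapsto> w ^ (1 + n * t)\<close> fixes
    \<open>w ^ l\<close>, because \<open>w ^ (l * n) = 1\<close>; hence it fixes \<open>z\<close>
    and \<open>w = rpoly q z\<close>.\<close>
  have key: "l dvd t" if cop: "coprime (1 + n * t) (l * n)" for t
  proof -
    have "w ^ (1 + n * t) \<in> prim_roots (l * n)" using prim_roots_power[OF w cop] .
    then have "rpoly (pcompose q (monom 1 (l * b)) - monom 1 1) (w ^ (1 + n * t)) = 0"
      using rpoly_prim_roots_conjugate[OF w _ ln rel] by blast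
    then have "rpoly q ((w ^ (1 + n * t)) ^ (l * b)) = w ^ (1 + n * t)" by simp
    moreover have "(w ^ (1 + n * t)) ^ (l * b) = w ^ (l * b) * (w ^ (l * n)) ^ (t * b)"
      by (simp add: algebra_simps flip: power_mult power_add)
    moreover have "w ^ (l * b) * (w ^ (l * n)) ^ (t * b) = z"
      unfolding prim_roots_power_self[OF w] z' by simp
    ultimately have "rpoly q z = w ^ (1 + n * t)" by metis
    then have "w = w * w ^ (n * t)" by (simp add: w_def)
    then have "w ^ (n * t) = 1" using w0 by simp
    then have "l * n dvd t * n" using prim_roots_power_eq_1_iff[OF w, of "n * t"] by (simp add: mult.commute)
    then show ?thesis using n by simp
  qed
  have cop: "coprime (1 + n * t) (l * n) \<longleftrightarrow> \<not> l dvd 1 + n * t" for t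
  proof -
    have "coprime (1 + n * t) n"
    proof (rule coprimeI)
      fix d assume "d dvd 1 + n * t" "d dvd n"
      then show "is_unit d" using dvd_add_left_iff[of d "n * t" 1] by simp
    qed
    then show ?thesis using l(1) by (auto simp: prime_imp_coprime coprime_commute[of _ l]
        dest: coprime_common_divisor[of l _ l])
  qed
  show False
  proof (cases "l dvd n")
    case True
    then have "\<not> l dvd 1 + n * 1" using l1 dvd_add_left_iff[OF True, of 1] by simp
    then show False using key[of 1] cop[of 1] l1 by auto
  next
    \<comment> \<open>Evenness of \<open>n\<close> forces \<open>l\<close> to be odd, so neither 1
      nor 2 is a multiple of \<open>l\<close>. For odd \<open>n\<close> the prime 2 is a true
      exception, since \<open>-1\<close> lies in the field.\<close>
    case False
    then have l2: "l \<noteq> 2" using n by auto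
    have "\<not> l dvd 1 + n * 1 \<or> \<not> l dvd 1 + n * 2"
    proof (rule ccontr)
      assume "\<not> ?thesis"
      then have "l dvd (1 + n * 2) - (1 + n * 1)" by (metis dvd_diff_nat)
      then show False using False by simp
    qed
    then have "l dvd 1 \<or> l dvd 2" using key[of 1] key[of 2] cop by blast
    then show False using l1 l2 by (auto dest: dvd_imp_le)
  qed
qed

text \<open>The arithmetic-geometric mean inequality by summing \<open>ln t \<le> t - 1\<close>;
  equality there holds only at \<open>t = 1\<close>, which settles the equality case.\<close>

lemma sum_ge_card_of_prod_ge_1:
  fixes f :: "'a \<Rightarrow> real"
  assumes "finite S" "\<And>i. i \<in> S \<Longrightarrow> f i > 0" "prod f S \<ge> 1"
  shows "sum f S \<ge> real (card S)"
    and "sum f S = real (card S) \<Longrightarrow> i \<in> S \<Longrightarrow> f i = 1"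
proof -
  have "0 \<le> ln (prod f S)" using assms by simp
  also have "\<dots> = (\<Sum>i\<in>S. ln (f i))" using assms by (intro ln_prod) (auto simp: less_imp_neq[symmetric])
  finally have 0: "0 \<le> (\<Sum>i\<in>S. ln (f i))" .
  have le: "ln (f i) \<le> f i - 1" if "i \<in> S" for i using assms(2)[OF that] by (rule ln_le_minus_one)
  have "(\<Sum>i\<in>S. ln (f i)) \<le> (\<Sum>i\<in>S. f i - 1)" using le by (rule sum_mono)
  with 0 show "sum f S \<ge> real (card S)" by (simp add: sum_subtractf)
  assume eq: "sum f S = real (card S)" and i: "i \<in> S"
  have "(\<Sum>i\<in>S. (f i - 1) - ln (f i)) = - (\<Sum>i\<in>S. ln (f i))" using eq by (simp add: sum_subtractf)
  then have "(\<Sum>i\<in>S. (f i - 1) - ln (f i)) \<le> 0" using 0 by simp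
  moreover have "(\<Sum>i\<in>S. (f i - 1) - ln (f i)) \<ge> 0" using le by (intro sum_nonneg) simp
  ultimately have "(\<Sum>i\<in>S. (f i - 1) - ln (f i)) = 0" by simp
  then have "(f i - 1) - ln (f i) = 0"
    using sum_nonneg_eq_0_iff[OF assms(1), of "\<lambda>i. (f i - 1) - ln (f i)"] le i by auto
  then show "f i = 1" using assms(2)[OF i] by (intro ln_eq_minus_one) auto
qed

lemma rpoly_nonzero_norm_ge_1:
  assumes z: "z \<in> prim_roots n" and n: "n > 0" and a: "algebraic_int (rpoly p z)" and nz: "rpoly p z \<noteq> 0"
  shows "(\<Prod>w\<in>prim_roots n. (norm (rpoly p w))\<^sup>2) \<ge> 1"
proof -
  obtain k where k: "(\<Prod>w\<in>prim_roots n. rpoly p w) = of_int k"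
    using norm_int[OF z n a] by (auto elim: Ints_cases)
  have "(\<Prod>w\<in>prim_roots n. rpoly p w) \<noteq> 0"
    using rpoly_nonzero_conjugate[OF z _ n nz] n by simp
  then have "k \<noteq> 0" using k by auto
  then have "k\<^sup>2 \<ge> 1" by (metis int_one_le_iff_zero_less zero_less_power2)
  have "(\<Prod>w\<in>prim_roots n. (norm (rpoly p w))\<^sup>2) = (norm (\<Prod>w\<in>prim_roots n. rpoly p w))\<^sup>2"
    by (simp add: prod_power_distrib flip: prod_norm)
  also have "\<dots> = real_of_int (k\<^sup>2)" unfolding k by (simp add: power2_abs)
  finally show ?thesis using \<open>k\<^sup>2 \<ge> 1\<close> by (simp only: of_int_1_le_iff)
qed

text \<open>Kronecker's argument: the powers of \<open>x\<close> lie in a finite set, because the coefficients in the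
  trace expansion are integers of bounded size.\<close>
lemma root_unity_of_conjugates_norm_1:
  assumes z: "z \<in> prim_roots n" and n: "n > 0" and a: "algebraic_int (rpoly p z)"
    and norm1: "\<And>w. w \<in> prim_roots n \<Longrightarrow> norm (rpoly p w) = 1"
  shows "\<exists>k>0. rpoly p z ^ k = 1"
proof -
  let ?d = "int (totient n)"
  \<comment> \<open>The bound is the number of conjugates: every coefficient is a sum of
    \<open>totient n\<close> numbers of modulus 1, whichever power of the element is
    expanded.\<close>
  define C where "C = ({..<n} \<rightarrow>\<^sub>E {- ?d..?d})"
  define F where "F c = (\<Sum>j<n. of_int (c j) * inverse z ^ j) / of_nat n" for c :: "nat \<Rightarrow> int"
  have fin: "finite (F ` C)" unfolding C_def by (intro finite_imageI finite_PiE) auto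
  have "rpoly p z ^ k \<in> F ` C" for k
  proof -
    let ?q = "p ^ k"
    let ?t = "\<lambda>j. \<Sum>w\<in>prim_roots n. rpoly ?q w * w ^ j"
    have a': "algebraic_int (rpoly ?q z)" using a by (simp add: algebraic_int_power)
    have "\<exists>c. ?t j = of_int c" for j
      using trace_coeff_int[OF z n a'] by (metis Ints_cases)
    then obtain c where c: "\<And>j. ?t j = of_int (c j)" by metis
    have "c j \<in> {- ?d..?d}" for j
    proof -
      have "norm (?t j) \<le> (\<Sum>w\<in>prim_roots n. norm (rpoly ?q w * w ^ j))" by (rule norm_sum)
      also have "\<dots> = (\<Sum>w\<in>prim_roots n. 1)"
        using norm1 norm_prim_roots[OF _ n] by (intro sum.cong) (simp_all add: norm_mult norm_power)
      also have "\<dots> = real (totient n)" using card_prim_roots[OF n] by simp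
      finally have "\<bar>real_of_int (c j)\<bar> \<le> real (totient n)" unfolding c by simp
      then show ?thesis by (simp add: abs_le_iff)
    qed
    then have "restrict c {..<n} \<in> C" by (auto simp: C_def)
    moreover have "of_nat n * rpoly ?q z = (\<Sum>j<n. of_int (c j) * inverse z ^ j)"
      unfolding trace_expansion[OF z n] c ..
    then have "rpoly ?q z = (\<Sum>j<n. of_int (c j) * inverse z ^ j) / of_nat n"
      using n by (metis nonzero_mult_div_cancel_left of_nat_0_eq_iff less_numeral_extra(3))
    then have "rpoly ?q z = F (restrict c {..<n})" by (simp add: F_def)
    ultimately show ?thesis by auto
  qed
  then have "\<not> inj (\<lambda>k. rpoly p z ^ k)"
    using fin by (metis finite_imageD finite_subset image_subsetI infinite_UNIV_nat)
  then obtain i j where ij: "i < j" "rpoly p z ^ i = rpoly p z ^ j"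
    unfolding inj_def by (metis linorder_neqE_nat)
  have nz: "rpoly p z \<noteq> 0" using norm1[OF z] by auto
  have "rpoly p z ^ j = rpoly p z ^ i * rpoly p z ^ (j - i)" using ij(1) by (simp flip: power_add)
  then have "rpoly p z ^ (j - i) = 1" using ij nz by simp
  then show ?thesis using ij by (intro exI[of _ "j - i"]) auto
qed

subsection \<open>The cyclotomic field and its embeddings\<close>

lemma rat_adjoin_prim_root:
  assumes z: "z \<in> prim_roots n" and n: "n > 0"
  shows "rat_adjoin z = range (\<lambda>p. rpoly p z)"
proof (intro equalityI subsetI)
  fix x assume "x \<in> rat_adjoin z"
  then show "x \<in> range (\<lambda>p. rpoly p z)"
  proof induction
    case (of_rat q)
    then show ?case by (intro range_eqI[of _ _ "[:q:]"]) simp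
  next
    case gen
    then show ?case by (intro range_eqI[of _ _ "[:0, 1:]"]) simp
  next
    case (add x y)
    then show ?case by (auto simp flip: rpoly_simps(3))
  next
    case (mult x y)
    then show ?case by (auto simp flip: rpoly_simps(6))
  next
    case (inverse x)
    then obtain p where p: "x = rpoly p z" by blast
    show ?case
    proof (cases "x = 0")
      case True
      then show ?thesis by (intro range_eqI[of _ _ 0]) simp
    next
      case False
      \<comment> \<open>\<open>q\<close> collects the other conjugates, so
        \<open>x * rpoly q z\<close> is the norm, a nonzero rational number.\<close>
      define q where "q = (\<Prod>k\<in>totatives n - {1}. pcompose p (monom 1 k))"
      have "(\<Prod>w\<in>prim_roots n. rpoly p w) = (\<Prod>k\<in>totatives n. rpoly p (z ^ k))"
        using prod.reindex_bij_betw[OF bij_betw_totatives_prim_roots[OF z n], of "rpoly p"] by simp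
      also have "\<dots> = x * rpoly q z"
        using n by (subst prod.remove[of _ 1]) (auto simp: q_def p in_totatives_iff)
      finally have N: "(\<Prod>w\<in>prim_roots n. rpoly p w) = x * rpoly q z" .
      obtain c where c: "(\<Prod>w\<in>prim_roots n. rpoly p w) = of_rat c"
        using norm_rat[OF n] by (auto elim: Rats_cases)
      have "(\<Prod>w\<in>prim_roots n. rpoly p w) \<noteq> 0"
        using rpoly_nonzero_conjugate[OF z _ n] False n by (simp add: p)
      then have "c \<noteq> 0" "x * rpoly q z = of_rat c" using N c by auto
      then have "inverse x = rpoly q z / of_rat c" using False by (simp add: field_simps)
      then have "inverse x = rpoly (Polynomial.smult (inverse c) q) z"
        by (simp add: of_rat_inverse divide_inverse mult.commute)
      then show ?thesis by blast
    qed
  qed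
next
  fix x assume "x \<in> range (\<lambda>p. rpoly p z)"
  then obtain p where "x = rpoly p z" by blast
  then show "x \<in> rat_adjoin z"
  proof (induction p arbitrary: x)
    case 0
    then show ?case using rat_adjoin.of_rat[of 0] by simp
  next
    case (pCons a p)
    then show ?case by (auto intro: rat_adjoin.intros)
  qed
qed

lemma rpoly_cnj: "rpoly p (cnj w) = cnj (rpoly p w)"
proof (induction p)
  case (pCons a p)
  have "cnj (of_rat a) = of_rat a"
  proof -
    obtain c d where "a = of_int c / of_int d" by (metis Fract_of_int_quotient Rat_cases)
    then show ?thesis by (simp add: of_rat_divide)
  qed
  then show ?case using pCons by simp
qed simp

text \<open>An embedding fixes the rationals, so it is evaluation at the image of \<open>z\<close>;
  that image keeps the order \<open>n\<close> because a unital ring map out of a field is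
  injective.\<close>

lemma complex_embeddings_rpoly:
  assumes z: "z \<in> prim_roots n" and n: "n > 0" and \<sigma>: "\<sigma> \<in> complex_embeddings (rat_adjoin z)"
  shows "\<sigma> (rpoly p z) = rpoly p (\<sigma> z)" and "\<sigma> z \<in> prim_roots n"
proof -
  note K = rat_adjoin_prim_root[OF z n]
  have rK: "rpoly p z \<in> rat_adjoin z" for p by (simp add: K)
  have one: "\<sigma> 1 = 1" and add: "x \<in> rat_adjoin z \<Longrightarrow> y \<in> rat_adjoin z \<Longrightarrow> \<sigma> (x + y) = \<sigma> x + \<sigma> y"
    and mult: "x \<in> rat_adjoin z \<Longrightarrow> y \<in> rat_adjoin z \<Longrightarrow> \<sigma> (x * y) = \<sigma> x * \<sigma> y" for x y
    using \<sigma> by (auto simp: complex_embeddings_def)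
  have qK: "of_rat q \<in> rat_adjoin z" for q by (rule rat_adjoin.of_rat)
  have iK: "of_int k \<in> rat_adjoin z" for k using qK[of "of_int k"] by simp
  have zero: "\<sigma> 0 = 0" using add[OF iK[of 0] iK[of 0]] by simp
  have int: "\<sigma> (of_int k) = of_int k" for k
  proof (induction k rule: int_induct[where k = 0])
    case (step1 i)
    then show ?case using add[OF iK[of i] iK[of 1]] one by simp
  next
    case (step2 i)
    then show ?case using add[OF iK[of "i - 1"] iK[of 1]] one by (simp add: eq_diff_eq)
  qed (simp add: zero)
  have rat: "\<sigma> (of_rat q) = of_rat q" for q
  proof -
    obtain a b where ab: "b > 0" "q = of_int a / of_int b"
      by (metis Fract_of_int_quotient Rat_cases)
    then have e: "of_int b * (of_rat q :: complex) = of_int a" by (simp add: of_rat_divide)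
    have "of_int b * \<sigma> (of_rat q) = \<sigma> (of_int b * of_rat q)" using mult[OF iK qK] int by simp
    also have "\<dots> = of_int b * of_rat q" unfolding e by (rule int)
    finally show ?thesis using ab by simp
  qed
  have zK: "z \<in> rat_adjoin z" by (rule rat_adjoin.gen)
  show rp: "\<sigma> (rpoly p z) = rpoly p (\<sigma> z)" for p
  proof (induction p)
    case (pCons a p)
    have "\<sigma> (of_rat a + z * rpoly p z) = \<sigma> (of_rat a) + \<sigma> (z * rpoly p z)"
      by (rule add[OF qK rat_adjoin.mult[OF zK rK]])
    also have "\<sigma> (z * rpoly p z) = \<sigma> z * \<sigma> (rpoly p z)" by (rule mult[OF zK rK])
    finally show ?case using pCons rat by simp
  qed (simp add: zero)
  show "\<sigma> z \<in> prim_roots n"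
  proof (rule prim_rootsI)
    fix k
    have "\<sigma> (z ^ k - 1) = \<sigma> z ^ k - 1" using rp[of "monom 1 k - 1"] by simp
    moreover have "\<sigma> (z ^ k - 1) = 0 \<longleftrightarrow> z ^ k - 1 = 0"
    proof
      assume s: "\<sigma> (z ^ k - 1) = 0"
      show "z ^ k - 1 = 0"
      proof (rule ccontr)
        assume nz: "z ^ k - 1 \<noteq> 0"
        have xK: "z ^ k - 1 \<in> rat_adjoin z" using rK[of "monom 1 k - 1"] by simp
        have "\<sigma> ((z ^ k - 1) * inverse (z ^ k - 1)) = 0"
          unfolding mult[OF xK rat_adjoin.inverse[OF xK]] s by simp
        then show False using nz one by simp
      qed
    qed (simp add: zero)
    ultimately show "\<sigma> z ^ k = 1 \<longleftrightarrow> n dvd k"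
      using prim_roots_power_eq_1_iff[OF z, of k] by simp
  qed
qed

lemma inj_on_complex_embeddings:
  assumes z: "z \<in> prim_roots n" and n: "n > 0"
  shows "inj_on (\<lambda>\<sigma>. \<sigma> z) (complex_embeddings (rat_adjoin z))"
proof (rule inj_onI)
  fix \<sigma> \<sigma>' assume s: "\<sigma> \<in> complex_embeddings (rat_adjoin z)" "\<sigma>' \<in> complex_embeddings (rat_adjoin z)"
    and eq: "\<sigma> z = \<sigma>' z"
  have "\<sigma> x = \<sigma>' x" if "x \<in> rat_adjoin z" for x
    using that complex_embeddings_rpoly(1)[OF z n s(1)] complex_embeddings_rpoly(1)[OF z n s(2)] eq
    unfolding rat_adjoin_prim_root[OF z n] by auto
  then show "\<sigma> = \<sigma>'" using s by (intro extensionalityI[of _ "rat_adjoin z"]) (auto simp: complex_embeddings_def)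
qed

lemma ring_of_integers_prim_root:
  assumes z: "z \<in> prim_roots n" and n: "n > 0"
  shows "ring_of_integers (rat_adjoin z) = int_adj z"
proof (intro equalityI subsetI)
  fix x assume "x \<in> ring_of_integers (rat_adjoin z)"
  then show "x \<in> int_adj z"
    using algebraic_int_rpoly_in_int_adj[OF z n] by (auto simp: ring_of_integers_def rat_adjoin_prim_root[OF z n])
next
  fix x assume x: "x \<in> int_adj z"
  then have "algebraic_int x" using int_adj_algebraic_int algebraic_int_prim_root[OF z n] by blast
  then show "x \<in> ring_of_integers (rat_adjoin z)"
    using int_adj_rpoly[OF x] by (auto simp: ring_of_integers_def rat_adjoin_prim_root[OF z n])
qed

text \<open>Higher powers of \<open>z\<close> reduce by the monic integer minimal polynomial of
  degree \<open>totient n\<close>. Linear independence comes later, from the nonzero determinant of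
  \<open>B\<close>.\<close>

lemma int_adj_prim_root_eq:
  assumes z: "z \<in> prim_roots n" and n: "n > 0"
  shows "int_adj z = range (\<lambda>c. \<Sum>i<totient n. of_int (c i) * z ^ i)"
proof (intro equalityI subsetI)
  fix x assume "x \<in> int_adj z"
  then obtain p where p: "x = zpoly p z" by (auto simp: int_adj_def)
  obtain g where g: "lead_coeff g = 1" "degree g = totient n" "zpoly g z = 0"
    using degree_cyclotomic_min_poly[OF z n] by blast
  obtain C where C: "\<And>k. z ^ k = (\<Sum>i<totient n. of_int (C k i) * z ^ i)"
    using monic_root_power_reduce(2)[of g z] g unfolding zpoly_def by metis
  have "x = (\<Sum>k\<le>degree p. of_int (coeff p k) * z ^ k)" by (simp add: p zpoly_def poly_altdef)
  also have "\<dots> = (\<Sum>k\<le>degree p. \<Sum>i<totient n. of_int (coeff p k * C k i) * z ^ i)"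
    by (subst C) (simp add: sum_distrib_left mult.assoc)
  also have "\<dots> = (\<Sum>i<totient n. of_int (\<Sum>k\<le>degree p. coeff p k * C k i) * z ^ i)"
    by (subst sum.swap) (simp add: sum_distrib_right)
  finally show "x \<in> range (\<lambda>c. \<Sum>i<totient n. of_int (c i) * z ^ i)"
    by (rule range_eqI[of _ _ "\<lambda>i. \<Sum>k\<le>degree p. coeff p k * C k i"])
next
  fix x assume "x \<in> range (\<lambda>c. \<Sum>i<totient n. of_int (c i) * z ^ i)"
  then show "x \<in> int_adj z"
    by (auto intro!: int_adj_sum int_adj_mult int_adj_of_int int_adj_power int_adj_self)
qed

lemma sum_lessThan_double: "(\<Sum>i<2 * r. f i) = (\<Sum>j<r. f (2 * j) + f (2 * j + 1))"
  for f :: "nat \<Rightarrow> 'a :: comm_monoid_add"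
  by (induction r) (auto simp: add.assoc)

subsection \<open>The cyclotomic lattice\<close>

locale cyclotomic_embeddings =
  fixes n :: nat and \<tau> :: "nat \<Rightarrow> complex \<Rightarrow> complex" and z :: complex
  assumes n2: "n > 2" and z: "z \<in> prim_roots n"
    and enum: "conj_pairs_enum (rat_adjoin z) (totient n div 2) \<tau>"
begin

abbreviation d where "d \<equiv> totient n"
abbreviation r where "r \<equiv> totient n div 2"
abbreviation K where "K \<equiv> rat_adjoin z"
abbreviation mink where "mink \<equiv> minkowski_embedding r \<tau>"

definition L where "L = mink ` int_adj z"

lemma n0: "n > 0"
  using n2 by simp

lemma d_eq: "2 * r = d" and r0: "r > 0" and d0: "d > 0"
proof -
  have "even d" using totient_even[OF n2] .
  then show "2 * r = d" by simp
  show "d > 0" using n0 by simp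
  then show "r > 0" using \<open>2 * r = d\<close> by (cases r) auto
qed

lemma in_K [simp]: "rpoly p z \<in> K"
  by (simp add: rat_adjoin_prim_root[OF z n0])

lemma KE: assumes "x \<in> K" obtains p where "x = rpoly p z"
  using assms by (auto simp: rat_adjoin_prim_root[OF z n0])

lemma \<tau>_embedding: "j < r \<Longrightarrow> \<tau> j \<in> complex_embeddings K"
  using bij_betwE[OF enum[unfolded conj_pairs_enum_def], rule_format, of "(j, False)"] by auto

lemma \<tau>_rpoly: "j < r \<Longrightarrow> \<tau> j (rpoly p z) = rpoly p (\<tau> j z)"
  and \<tau>_prim: "j < r \<Longrightarrow> \<tau> j z \<in> prim_roots n"
  using complex_embeddings_rpoly[OF z n0 \<tau>_embedding] by auto

text \<open>Surjectivity is by counting: evaluation at \<open>z\<close> is injective on embeddings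
  and lands in \<open>prim_roots n\<close>, and the enumeration supplies
  \<open>2 * r = totient n\<close> of them.\<close>

lemma bij_betw_conjugates:
  "bij_betw (\<lambda>(j, c). if c then cnj (\<tau> j z) else \<tau> j z) ({..<r} \<times> (UNIV :: bool set)) (prim_roots n)"
proof -
  let ?F = "\<lambda>(j, c). if c then restrict (cnj \<circ> \<tau> j) K else \<tau> j"
  let ?A = "{..<r} \<times> (UNIV :: bool set)"
  have F: "bij_betw ?F ?A (complex_embeddings K)" using enum by (simp add: conj_pairs_enum_def)
  have inj: "inj_on (\<lambda>\<sigma>. \<sigma> z) (?F ` ?A)"
    using inj_on_complex_embeddings[OF z n0] F by (simp add: bij_betw_def)
  have eq: "((\<lambda>\<sigma>. \<sigma> z) \<circ> ?F) s = (\<lambda>(j, c). if c then cnj (\<tau> j z) else \<tau> j z) s" for s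
    using rat_adjoin.gen[of z] by (cases s) auto
  have inj2: "inj_on ((\<lambda>\<sigma>. \<sigma> z) \<circ> ?F) ?A"
    using F inj by (intro comp_inj_on) (auto simp: bij_betw_def)
  have "((\<lambda>\<sigma>. \<sigma> z) \<circ> ?F) ` ?A = prim_roots n"
  proof (rule card_subset_eq)
    show "finite (prim_roots n)" using n0 by simp
    have "?F ` ?A = complex_embeddings K" using F by (simp add: bij_betw_def)
    then show "((\<lambda>\<sigma>. \<sigma> z) \<circ> ?F) ` ?A \<subseteq> prim_roots n"
      unfolding image_comp[symmetric] using complex_embeddings_rpoly(2)[OF z n0] by auto
    show "card (((\<lambda>\<sigma>. \<sigma> z) \<circ> ?F) ` ?A) = card (prim_roots n)"
      unfolding card_image[OF inj2] card_prim_roots[OF n0] using d_eq by (simp add: card_cartesian_product)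
  qed
  with inj2 have "bij_betw ((\<lambda>\<sigma>. \<sigma> z) \<circ> ?F) ?A (prim_roots n)" by (simp add: bij_betw_def)
  then show ?thesis by (rule bij_betw_cong[THEN iffD1, rotated]) (rule eq)
qed

lemma sum_conjugates:
  fixes F :: "complex \<Rightarrow> 'a :: comm_monoid_add"
  shows "(\<Sum>w\<in>prim_roots n. F w) = (\<Sum>j<r. F (\<tau> j z) + F (cnj (\<tau> j z)))"
proof -
  have "(\<Sum>w\<in>prim_roots n. F w) =
      (\<Sum>s\<in>{..<r} \<times> (UNIV :: bool set). F ((\<lambda>(j, c). if c then cnj (\<tau> j z) else \<tau> j z) s))"
    using sum.reindex_bij_betw[OF bij_betw_conjugates, of F] by simp
  also have "\<dots> = (\<Sum>j<r. \<Sum>c\<in>UNIV. F (if c then cnj (\<tau> j z) else \<tau> j z))"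
    by (simp add: sum.cartesian_product case_prod_beta)
  also have "\<dots> = (\<Sum>j<r. F (\<tau> j z) + F (cnj (\<tau> j z)))" by (simp add: UNIV_bool add.commute)
  finally show ?thesis .
qed

lemma mink_carrier [simp]: "mink x \<in> carrier_vec d" "dim_vec (mink x) = d"
  using d_eq by (auto simp: minkowski_embedding_def)

lemma mink_index: "i < d \<Longrightarrow> mink x $ i = (if even i then Re (\<tau> (i div 2) x) else Im (\<tau> (i div 2) x))"
  using d_eq by (simp add: minkowski_embedding_def)

text \<open>Half the trace form: rational polynomials commute with complex conjugation, so
  \<open>w\<close> and \<open>cnj w\<close> together contribute twice a real part.\<close>

lemma inner_mink:
  "complex_of_real (mink (rpoly p z) \<bullet> mink (rpoly q z)) =
     1 / 2 * (\<Sum>w\<in>prim_roots n. rpoly p w * cnj (rpoly q w))"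
proof -
  have "mink (rpoly p z) \<bullet> mink (rpoly q z) = (\<Sum>i<2 * r. mink (rpoly p z) $ i * mink (rpoly q z) $ i)"
    using d_eq by (simp add: scalar_prod_def atLeast0LessThan)
  also have "\<dots> = (\<Sum>j<r. Re (rpoly p (\<tau> j z)) * Re (rpoly q (\<tau> j z)) + Im (rpoly p (\<tau> j z)) * Im (rpoly q (\<tau> j z)))"
    unfolding sum_lessThan_double using d_eq
    by (intro sum.cong refl) (auto simp: mink_index \<tau>_rpoly)
  finally have *: "2 * (mink (rpoly p z) \<bullet> mink (rpoly q z)) =
    (\<Sum>j<r. 2 * (Re (rpoly p (\<tau> j z)) * Re (rpoly q (\<tau> j z)) + Im (rpoly p (\<tau> j z)) * Im (rpoly q (\<tau> j z))))"
    by (simp add: sum_distrib_left)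
  have "(\<Sum>w\<in>prim_roots n. rpoly p w * cnj (rpoly q w)) =
    of_real (\<Sum>j<r. 2 * (Re (rpoly p (\<tau> j z)) * Re (rpoly q (\<tau> j z)) + Im (rpoly p (\<tau> j z)) * Im (rpoly q (\<tau> j z))))"
    unfolding sum_conjugates of_real_sum
    by (intro sum.cong refl) (simp add: rpoly_cnj complex_eq_iff)
  then have "(\<Sum>w\<in>prim_roots n. rpoly p w * cnj (rpoly q w)) =
      of_real (2 * (mink (rpoly p z) \<bullet> mink (rpoly q z)))"
    unfolding * .
  then show ?thesis by simp
qed

lemma norm_mink: "(eucl_norm (mink (rpoly p z)))\<^sup>2 = (\<Sum>w\<in>prim_roots n. (norm (rpoly p w))\<^sup>2) / 2"
proof -
  have "complex_of_real (mink (rpoly p z) \<bullet> mink (rpoly p z)) =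
      complex_of_real ((\<Sum>w\<in>prim_roots n. (norm (rpoly p w))\<^sup>2) / 2)"
    unfolding inner_mink by (simp flip: complex_norm_square)
  then have e: "mink (rpoly p z) \<bullet> mink (rpoly p z) = (\<Sum>w\<in>prim_roots n. (norm (rpoly p w))\<^sup>2) / 2"
    by (simp only: of_real_eq_iff)
  have "(\<Sum>w\<in>prim_roots n. (norm (rpoly p w))\<^sup>2) / 2 \<ge> 0" by (simp add: sum_nonneg)
  then show ?thesis unfolding eucl_norm_def e by simp
qed

lemma mink_minus: "x \<in> K \<Longrightarrow> mink (- x) = - mink x"
proof -
  assume "x \<in> K"
  then obtain p where p: "x = rpoly p z" by (rule KE)
  have "mink (rpoly (- p) z) = - mink (rpoly p z)"
  proof (rule eq_vecI)
    fix i assume "i < dim_vec (- mink (rpoly p z))"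
    then have i: "i < d" "i div 2 < r" using d_eq by auto
    then show "mink (rpoly (- p) z) $ i = (- mink (rpoly p z)) $ i"
      unfolding mink_index[OF i(1)] \<tau>_rpoly[OF i(2)] by (simp add: mink_index \<tau>_rpoly)
  qed simp
  then show ?thesis by (simp add: p)
qed

lemma inj_on_mink: "inj_on mink K"
proof (rule inj_onI)
  fix x y assume "x \<in> K" "y \<in> K" and eq: "mink x = mink y"
  then obtain p q where p: "x = rpoly p z" and q: "y = rpoly q z" by (metis KE)
  \<comment> \<open>The first two coordinates already recover \<open>\<tau> 0 x\<close>, and a
    single embedding is injective.\<close>
  have "mink x $ 0 = mink y $ 0" "mink x $ 1 = mink y $ 1" using eq by auto
  then have "\<tau> 0 x = \<tau> 0 y" using d_eq r0 d0 by (simp add: mink_index complex_eq_iff)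
  then have "rpoly p (\<tau> 0 z) = rpoly q (\<tau> 0 z)" using \<tau>_rpoly[OF r0] p q by simp
  then show "x = y" unfolding p q by (rule rpoly_conjugate_eq[OF \<tau>_prim[OF r0] z n0])
qed

lemma mink_zero: "mink 0 = 0\<^sub>v d"
proof (rule eq_vecI)
  fix i assume "i < dim_vec (0\<^sub>v d)"
  then have i: "i < d" "i div 2 < r" using d_eq by auto
  then show "mink 0 $ i = 0\<^sub>v d $ i" using \<tau>_rpoly[OF i(2), of 0] by (simp add: mink_index)
qed simp

lemma root_unity_in_int_adj: "x ^ n = 1 \<Longrightarrow> x \<in> int_adj z"
  using prim_rootsE[OF z n0] int_adj_power[OF int_adj_self] by metis

lemma int_adj_subset_K: "int_adj z \<subseteq> K"
  by (auto simp: rat_adjoin_prim_root[OF z n0] dest: int_adj_rpoly)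

lemma norm_mink_root_unity:
  assumes "x ^ n = 1"
  shows "(eucl_norm (mink x))\<^sup>2 = real d / 2"
proof -
  obtain k where k: "x = z ^ k" using prim_rootsE[OF z n0 assms] by blast
  have "(eucl_norm (mink (rpoly (monom 1 k) z)))\<^sup>2 = real d / 2"
    unfolding norm_mink by (simp add: norm_power norm_prim_roots[OF _ n0] card_prim_roots[OF n0])
  then show ?thesis by (simp add: k)
qed

lemma eucl_norm_mink:
  assumes "x ^ n = 1"
  shows "eucl_norm (mink x) = sqrt (real d / 2)"
proof -
  have "eucl_norm (mink x) \<ge> 0" by (simp add: eucl_norm_def scalar_prod_def sum_nonneg)
  then show ?thesis using norm_mink_root_unity[OF assms] by (metis real_sqrt_unique)
qed

lemma norm_mink_ge:
  assumes x: "x \<in> int_adj z" "x \<noteq> 0"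
  shows "(eucl_norm (mink x))\<^sup>2 \<ge> real d / 2"
    and "(eucl_norm (mink x))\<^sup>2 = real d / 2 \<Longrightarrow> \<exists>N>0. x ^ N = 1"
proof -
  obtain p where p: "x = rpoly p z" using int_adj_rpoly[OF x(1)] by blast
  have a: "algebraic_int (rpoly p z)"
    using int_adj_algebraic_int[OF x(1) algebraic_int_prim_root[OF z n0]] p by simp
  have nz: "rpoly p z \<noteq> 0" using x p by simp
  have pos: "(norm (rpoly p w))\<^sup>2 > 0" if "w \<in> prim_roots n" for w
    using rpoly_nonzero_conjugate[OF z that n0 nz] by simp
  have fin: "finite (prim_roots n)" using n0 by simp
  note AG = sum_ge_card_of_prod_ge_1[OF fin pos rpoly_nonzero_norm_ge_1[OF z n0 a nz]]
  show "(eucl_norm (mink x))\<^sup>2 \<ge> real d / 2"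
    unfolding p norm_mink using AG(1) by (simp add: card_prim_roots[OF n0])
  assume "(eucl_norm (mink x))\<^sup>2 = real d / 2"
  then have "(\<Sum>w\<in>prim_roots n. (norm (rpoly p w))\<^sup>2) = real (card (prim_roots n))"
    unfolding p norm_mink by (simp add: card_prim_roots[OF n0])
  then have "(norm (rpoly p w))\<^sup>2 = 1" if "w \<in> prim_roots n" for w using AG(2) that by blast
  then have "norm (rpoly p w) = 1" if "w \<in> prim_roots n" for w
    using that by (metis norm_ge_zero power2_eq_1_iff real_sqrt_abs real_sqrt_one abs_of_nonneg)
  then show "\<exists>N>0. x ^ N = 1" unfolding p by (rule root_unity_of_conjugates_norm_1[OF z n0 a])
qed

lemma sq_minimum_L: "sq_minimum d L = real d / 2"
  unfolding sq_minimum_def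
proof (rule Least_equality)
  have 1: "(1::complex) ^ n = 1" by simp
  have "mink 1 \<noteq> 0\<^sub>v d"
    using inj_onD[OF inj_on_mink, of 1 0] mink_zero in_K[of 1] in_K[of 0] by auto
  then show "\<exists>x\<in>L - {0\<^sub>v d}. real d / 2 = (eucl_norm x)\<^sup>2"
    using norm_mink_root_unity[OF 1] int_adj_1 by (intro bexI[of _ "mink 1"]) (auto simp: L_def)
next
  fix y assume "\<exists>x\<in>L - {0\<^sub>v d}. y = (eucl_norm x)\<^sup>2"
  then obtain x where "x \<in> int_adj z" "mink x \<noteq> 0\<^sub>v d" "y = (eucl_norm (mink x))\<^sup>2"
    by (auto simp: L_def)
  then show "real d / 2 \<le> y" using norm_mink_ge(1)[of x] mink_zero by auto
qed

lemma min_vectors_L: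
  assumes ev: "even n"
  shows "min_vectors d L = mink ` {x. x ^ n = 1}"
proof (intro equalityI subsetI)
  fix v assume "v \<in> min_vectors d L"
  then obtain x where x: "x \<in> int_adj z" "v = mink x" "(eucl_norm v)\<^sup>2 = real d / 2"
    unfolding min_vectors_def sq_minimum_L by (auto simp: L_def)
  have "x \<noteq> 0"
  proof
    assume "x = 0"
    then have "(eucl_norm v)\<^sup>2 = 0" unfolding x(2) using norm_mink[of 0] by simp
    then show False using x(3) d0 by simp
  qed
  then obtain N where N: "N > 0" "x ^ N = 1" using norm_mink_ge(2)[OF x(1)] x by blast
  then obtain m where m: "x \<in> prim_roots m" "m > 0" using root_unity_prim_roots by metis
  obtain p where "x = rpoly p z" using int_adj_rpoly[OF x(1)] by blast
  then have "m dvd n" using prim_root_order_dvd_even[OF z n0 ev _ m(2)] m(1) by blast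
  then show "v \<in> mink ` {x. x ^ n = 1}" using x(2) m(1) by (auto simp: prim_roots_power_eq_1_iff)
next
  fix v assume "v \<in> mink ` {x. x ^ n = 1}"
  then show "v \<in> min_vectors d L"
    unfolding min_vectors_def sq_minimum_L using root_unity_in_int_adj norm_mink_root_unity
    by (auto simp: L_def)
qed

subsection \<open>Coherence\<close>

text \<open>A Ramanujan sum in absolute value, divided by its number of terms: the coherence of two
  roots whose quotient has order \<open>m\<close>.\<close>

definition coh :: "nat \<Rightarrow> real" where
  "coh m = (if squarefree m then 1 / real (totient m) else 0)"

lemma coherence_mink:
  assumes a: "a ^ n = 1" and b: "b ^ n = 1" and m: "a / b \<in> prim_roots m"
  shows "coherence (mink a) (mink b) = coh m"
proof -
  obtain i j where ij: "a = z ^ i" "b = z ^ j" using prim_rootsE[OF z n0] a b by metis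
  \<comment> \<open>On \<open>n\<close>-th roots of unity \<open>cnj w = w ^ (n - 1)\<close>, so
    \<open>?k\<close> represents \<open>i - j\<close> modulo \<open>n\<close>.\<close>
  let ?k = "i + (n - 1) * j"
  have cn: "w ^ i * cnj (w ^ j) = w ^ ?k" if "w \<in> prim_roots n" for w
    using cnj_prim_roots[OF that n0] inverse_prim_root[OF that n0] by (simp add: power_add power_mult)
  have "a / b = z ^ ?k"
    using inverse_prim_root[OF z n0] by (simp add: ij divide_inverse power_add power_mult flip: power_inverse)
  then obtain s where s: "(\<Sum>x\<in>prim_roots n. x ^ ?k) = of_int s"
    "real_of_int \<bar>s\<bar> = real d * coh m"
    using sum_power_prim_roots[OF n0 z, of ?k m] m by (auto simp: coh_def)
  have "complex_of_real (mink (rpoly (monom 1 i) z) \<bullet> mink (rpoly (monom 1 j) z)) = of_real (of_int s / 2)"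
    unfolding inner_mink using cn s(1) by simp
  then have "mink a \<bullet> mink b = of_int s / 2" by (simp only: of_real_eq_iff) (simp add: ij)
  then have ab: "\<bar>mink a \<bullet> mink b\<bar> = real d / 2 * coh m" using s(2) by simp
  show ?thesis unfolding coherence_def ab eucl_norm_mink[OF a] eucl_norm_mink[OF b] using d0 by simp
qed

lemma coherence_mink_minus:
  assumes "b ^ n = 1" and "x \<in> carrier_vec d"
  shows "coherence x (mink (- b)) = coherence x (mink b)"
proof -
  have "b \<in> K" using assms root_unity_in_int_adj int_adj_subset_K by blast
  then have m: "mink (- b) = - mink b" by (rule mink_minus)
  show ?thesis unfolding m coherence_def eucl_norm_def using assms(2) by simp
qed

text \<open>Reindex by the quotient \<open>a / b\<close> and sort by its order \<open>m\<close>: the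
  \<open>totient m\<close> quotients of order \<open>m\<close> contribute 1 altogether if
  \<open>m\<close> is squarefree, and 0 otherwise.\<close>

lemma sum_coherence:
  assumes a: "a ^ n = 1"
  shows "(\<Sum>b | b ^ n = 1. coherence (mink a) (mink b)) = 2 ^ card (prime_factors n)"
proof -
  have a0: "a \<noteq> 0" using a n0 by (auto simp: zero_power)
  have "bij_betw (\<lambda>b. a / b) {b. b ^ n = 1} {b. b ^ n = 1}"
    by (rule bij_betw_byWitness[where f' = "\<lambda>b. a / b"]) (use a a0 in \<open>auto simp: power_divide\<close>)
  then have "(\<Sum>b | b ^ n = 1. coherence (mink a) (mink b)) =
      (\<Sum>b | b ^ n = 1. coherence (mink a) (mink (a / b)))"
    by (rule sum.reindex_bij_betw[symmetric])
  also have "\<dots> = (\<Sum>m | m dvd n. \<Sum>b\<in>prim_roots m. coherence (mink a) (mink (a / b)))"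
    unfolding roots_unity_eq_Union_prim_roots[OF n0]
    by (rule sum.UNION_disjoint) (use n0 disjoint_prim_roots dvd_pos_nat in \<open>auto simp: finite_divisors_nat\<close>)
  also have "\<dots> = (\<Sum>m | m dvd n. real (totient m) * coh m)"
  proof (rule sum.cong[OF refl])
    fix m assume "m \<in> {m. m dvd n}"
    then have m: "m dvd n" "m > 0" using n0 dvd_pos_nat by auto
    have "coherence (mink a) (mink (a / b)) = coh m" if b: "b \<in> prim_roots m" for b
    proof (rule coherence_mink[OF a])
      have "b ^ n = 1" using prim_roots_power_eq_1_iff[OF b] m by simp
      then show "(a / b) ^ n = 1" using a by (simp add: power_divide)
      show "a / (a / b) \<in> prim_roots m" using a0 b by simp
    qed
    then show "(\<Sum>b\<in>prim_roots m. coherence (mink a) (mink (a / b))) = real (totient m) * coh m"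
      using m by (simp add: card_prim_roots)
  qed
  also have "\<dots> = (\<Sum>m | m dvd n. if squarefree m then 1 else 0)"
    using n0 by (intro sum.cong refl) (auto simp: coh_def dvd_pos_nat)
  also have "\<dots> = real (card {m. m dvd n \<and> squarefree m})"
    using n0 by (simp add: sum.If_cases finite_divisors_nat Collect_conj_eq)
  also have "\<dots> = 2 ^ card (prime_factors n)" using card_squarefree_divisors[OF n0] by simp
  finally show ?thesis .
qed

end

lemma odd_prime_divisor:
  fixes n :: nat
  assumes "n > 0" "\<nexists>k. n = 2 ^ k"
  shows "\<exists>q. prime q \<and> odd q \<and> q dvd n"
proof -
  obtain k where k: "n = 2 ^ multiplicity 2 n * k" "\<not> 2 dvd k"
    using multiplicity_decompose'[of n 2] assms(1) by (metis gr_implies_not0 two_is_prime_nat not_prime_unit)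
  have "k \<noteq> 1" using k(1) assms(2) by (metis mult.right_neutral)
  then obtain q where q: "prime q" "q dvd k" using prime_factor_nat by blast
  then have "odd q" using k(2) dvd_trans by blast
  then show ?thesis using q k(1) by (metis dvd_mult)
qed

lemma squarefree_odd_prime_divisor:
  fixes m :: nat
  assumes "squarefree m" "m > 2"
  shows "\<exists>q. prime q \<and> odd q \<and> q dvd m"
proof (rule odd_prime_divisor)
  show "\<nexists>k. m = 2 ^ k"
  proof
    assume "\<exists>k. m = 2 ^ k"
    then obtain k where k: "m = 2 ^ k" ..
    then have "k = 0 \<or> k = 1" using assms(1) by (auto simp: squarefree_power_iff)
    then show False using assms(2) k by auto
  qed
qed (use assms in simp)

context cyclotomic_embeddings
begin

context
  fixes T :: "real vec set"
  assumes ev: "even n" and T: "half_selection d L T"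
begin

definition U where "U = {x. x ^ n = 1 \<and> mink x \<in> T}"

lemma U_K: "x \<in> U \<Longrightarrow> x \<in> K" and root_K: "x ^ n = 1 \<Longrightarrow> x \<in> K"
  using root_unity_in_int_adj int_adj_subset_K by (auto simp: U_def)

lemma T_eq: "T = mink ` U"
  using T unfolding half_selection_def min_vectors_L[OF ev] by (auto simp: U_def)

lemma T_iff: "v \<in> T \<longleftrightarrow> (\<exists>a\<in>U. v = mink a)"
  using arg_cong[OF T_eq, of "\<lambda>A. v \<in> A"] by blast

lemma minus_root_iff: "(- x) ^ n = 1 \<longleftrightarrow> x ^ n = (1 :: complex)"
  using ev by simp

lemma U_minus_iff: "x ^ n = 1 \<Longrightarrow> x \<in> U \<longleftrightarrow> - x \<notin> U"
  using T unfolding half_selection_def min_vectors_L[OF ev]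
  by (auto simp: U_def minus_root_iff mink_minus[OF root_K])

lemma inj_on_mink_U: "inj_on mink U"
  using inj_on_mink U_K by (meson inj_on_subset subsetI)

lemma roots_split: "{x. x ^ n = 1} = U \<union> uminus ` U" and U_disjoint: "U \<inter> uminus ` U = {}"
proof -
  show "{x. x ^ n = 1} = U \<union> uminus ` U"
  proof (intro equalityI subsetI)
    fix x :: complex assume x: "x \<in> {x. x ^ n = 1}"
    show "x \<in> U \<union> uminus ` U"
    proof (cases "x \<in> U")
      case False
      then have "- x \<in> U" using U_minus_iff x by auto
      then show ?thesis by (auto intro!: image_eqI[of _ _ "- x"])
    qed simp
  qed (auto simp: U_def minus_root_iff)
  show "U \<inter> uminus ` U = {}"
  proof (rule ccontr)
    assume "\<not> ?thesis"
    then obtain x where "x \<in> U" "- x \<in> U" by auto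
    then show False using U_minus_iff[of x] by (auto simp: U_def)
  qed
qed

lemma finite_U: "finite U"
  using n0 by (intro finite_subset[of U "{x. x ^ n = 1}"]) (auto simp: U_def)

lemma sum_roots_split:
  assumes "\<And>x. x \<in> U \<Longrightarrow> f (- x) = f x"
  shows "(\<Sum>x | x ^ n = 1. f x) = 2 * (\<Sum>x\<in>U. f x :: real)"
proof -
  have "(\<Sum>x | x ^ n = 1. f x) = (\<Sum>x\<in>U. f x) + (\<Sum>x\<in>uminus ` U. f x)"
    unfolding roots_split by (rule sum.union_disjoint) (use finite_U U_disjoint in auto)
  also have "(\<Sum>x\<in>uminus ` U. f x) = (\<Sum>x\<in>U. f x)"
    using assms by (subst sum.reindex) auto
  finally show ?thesis by simp
qed

lemma card_U: "real (card U) = real n / 2"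
  using sum_roots_split[of "\<lambda>_. 1"] card_roots_unity_eq[OF n0] by simp

lemma card_T: "real (card T) = real n / 2"
  using arg_cong[OF T_eq, of card] card_image[OF inj_on_mink_U] card_U by metis

lemma finite_T: "finite T"
  using arg_cong[OF T_eq, of finite] finite_U by blast

lemma U_nonempty: "U \<noteq> {}"
  using card_U n0 by auto

lemma avg_coherence_at_T:
  assumes "\<alpha> \<in> T"
  shows "avg_coherence_at T \<alpha> = (2 ^ omega n - 2) / (real n - 2)"
proof -
  obtain a where a: "a \<in> U" "\<alpha> = mink a" using assms by (auto simp: T_iff)
  then have a1: "a ^ n = 1" by (simp add: U_def)
  have diff: "T - {\<alpha>} = mink ` (U - {a})"
    using a inj_onD[OF inj_on_mink_U] by (auto simp: T_iff)
  have "(\<Sum>y\<in>T - {\<alpha>}. coherence \<alpha> y) = (\<Sum>b\<in>U - {a}. coherence \<alpha> (mink b))"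
    unfolding diff using inj_on_subset[OF inj_on_mink_U] by (subst sum.reindex) auto
  \<comment> \<open>Over all \<open>n\<close>-th roots the sum is \<open>2 ^ omega n\<close>;
    \<open>U\<close> keeps one of each pair of equal terms, and the term at \<open>a\<close> itself
    is 1.\<close>
  also have "\<dots> = (\<Sum>b\<in>U. coherence \<alpha> (mink b)) - coherence \<alpha> (mink a)"
    using finite_U a(1) by (simp add: sum_diff1)
  also have "(\<Sum>b\<in>U. coherence \<alpha> (mink b)) = 2 ^ omega n / 2"
    using sum_coherence[OF a1] sum_roots_split[of "\<lambda>b. coherence \<alpha> (mink b)"] coherence_mink_minus a
    by (simp add: omega_def U_def)
  also have "coherence \<alpha> (mink a) = 1"
  proof -
    have "a \<noteq> 0" using a1 n0 by (auto simp: zero_power)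
    then have "a / a \<in> prim_roots 1" by simp
    from coherence_mink[OF a1 a1 this] show ?thesis by (simp add: a coh_def)
  qed
  finally have s: "(\<Sum>y\<in>T - {\<alpha>}. coherence \<alpha> y) = (2 ^ omega n - 2) / 2" by simp
  have "real n > 2" using n2 by simp
  then show ?thesis unfolding avg_coherence_at_def s card_T by (simp add: field_simps)
qed

lemma avg_coherence_T: "avg_coherence T = (2 ^ omega n - 2) / (real n - 2)"
proof -
  have "avg_coherence_at T ` T = {(2 ^ omega n - 2) / (real n - 2)}"
    using avg_coherence_at_T U_nonempty by (fastforce simp: image_iff T_iff)
  then show ?thesis by (simp add: avg_coherence_def)
qed

text \<open>Distinct members of \<open>U\<close> have quotient neither 1 nor -1, which excludes the
  orders 1 and 2.\<close>

lemma coherence_T_cases: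
  assumes "x \<in> T" "y \<in> T" "x \<noteq> y"
  obtains m where "m dvd n" "m > 2" "coherence x y = coh m"
proof -
  obtain a b where ab: "a \<in> U" "b \<in> U" "x = mink a" "y = mink b" using assms by (auto simp: T_iff)
  then have r1: "a ^ n = 1" "b ^ n = 1" by (auto simp: U_def)
  have b0: "b \<noteq> 0" using r1 n0 by (auto simp: zero_power)
  have "(a / b) ^ n = 1" using r1 by (simp add: power_divide)
  then obtain m where m: "m dvd n" "a / b \<in> prim_roots m" "m > 0"
    using root_unity_prim_roots n0 by metis
  have "m \<noteq> 1" using m b0 ab assms by auto
  moreover have "m \<noteq> 2"
  proof
    assume "m = 2"
    then have "(a / b)\<^sup>2 = 1" "a / b \<noteq> 1"
      using prim_roots_power_eq_1_iff[OF m(2), of 2] prim_roots_power_eq_1_iff[OF m(2), of 1] by auto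
    then have "a / b = -1" using power2_eq_1_iff[of "a / b"] by blast
    then have "a = - b" using b0 by (simp add: field_simps)
    then show False using ab U_minus_iff[OF r1(2)] by simp
  qed
  ultimately show thesis using m coherence_mink[OF r1 m(2)] ab that by simp
qed

text \<open>A squarefree order \<open>m > 2\<close> has an odd prime factor \<open>q\<close>, so
  \<open>totient m \<ge> q - 1 \<ge> p - 1\<close> for the least odd prime \<open>p\<close> dividing
  \<open>n\<close>; order \<open>p\<close> attains the bound.\<close>

lemma max_coherence_T:
  "max_coherence T = (if \<exists>k. n = 2 ^ k then 0 else 1 / (real (LEAST p. prime p \<and> odd p \<and> p dvd n) - 1))"
proof -
  let ?S = "{coherence x y | x y. x \<in> T \<and> y \<in> T \<and> x \<noteq> y}"
  have "?S \<subseteq> (\<lambda>(x, y). coherence x y) ` (T \<times> T)" by auto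
  then have fin: "finite ?S" using finite_T by (meson finite_SigmaI finite_imageI finite_subset)
  show ?thesis
  proof (cases "\<exists>k. n = 2 ^ k")
    case True
    then obtain k where k: "n = 2 ^ k" ..
    have 0: "coherence x y = 0" if xy: "x \<in> T" "y \<in> T" "x \<noteq> y" for x y
    proof -
      obtain m where m: "m dvd n" "m > 2" "coherence x y = coh m" using coherence_T_cases[OF xy] by blast
      have "\<not> squarefree m"
      proof
        assume "squarefree m"
        then obtain q where q: "prime q" "odd q" "q dvd m" using squarefree_odd_prime_divisor m(2) by blast
        then have "q dvd 2 ^ k" using m(1) k dvd_trans by blast
        then have "q dvd 2" using q(1) prime_dvd_power by blast
        then show False using q primes_dvd_imp_eq[of q 2] by auto
      qed
      then show ?thesis using m by (simp add: coh_def)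
    qed
    \<comment> \<open>\<open>Max\<close> needs a nonempty set, hence two elements of
      \<open>T\<close>; this is where \<open>n > 2\<close> enters.\<close>
    have "\<exists>x\<in>T. \<exists>y\<in>T. x \<noteq> y"
    proof (rule ccontr)
      assume "\<not> ?thesis"
      then have "card T \<le> Suc 0" using finite_T by (simp add: card_le_Suc0_iff_eq)
      then have "real n / 2 \<le> 1" using card_T by simp
      then show False using n2 by simp
    qed
    then obtain x y where xy: "x \<in> T" "y \<in> T" "x \<noteq> y" by blast
    have "0 \<in> ?S" by (intro CollectI exI[of _ x] exI[of _ y]) (use 0[OF xy] xy in simp)
    moreover have "?S \<subseteq> {0}" using 0 by blast
    ultimately have "?S = {0}" by blast
    then show ?thesis using True by (simp add: max_coherence_def)
  next
    case False
    define p where "p = (LEAST p. prime p \<and> odd p \<and> p dvd n)"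
    have ex: "\<exists>q. prime q \<and> odd q \<and> q dvd n" using odd_prime_divisor[OF n0] False by blast
    have p: "prime p" "odd p" "p dvd n" using LeastI_ex[OF ex] by (auto simp: p_def)
    have pmin: "p \<le> q" if "prime q" "odd q" "q dvd n" for q
      unfolding p_def using that by (intro Least_le) auto
    have p2: "p > 2" using p prime_gt_1_nat[of p] by (cases "p = 2") auto
    have "Max ?S = 1 / (real p - 1)"
    proof (rule Max_eqI[OF fin])
      fix c assume "c \<in> ?S"
      then obtain x y where xy: "x \<in> T" "y \<in> T" "x \<noteq> y" "c = coherence x y" by blast
      obtain m where m: "m dvd n" "m > 2" "coherence x y = coh m" using coherence_T_cases[OF xy(1-3)] by blast
      have "coh m \<le> 1 / (real p - 1)"
      proof (cases "squarefree m")
        case True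
        then obtain q where q: "prime q" "odd q" "q dvd m" using squarefree_odd_prime_divisor m(2) by blast
        then have "p \<le> q" using pmin m(1) dvd_trans by blast
        moreover have "totient q \<le> totient m" using q m by (intro totient_dvd_mono) auto
        ultimately have "real p - 1 \<le> real (totient m)" using totient_prime[OF q(1)] p2 by linarith
        then show ?thesis using True p2 by (simp add: coh_def frac_le)
      qed (use p2 in \<open>simp add: coh_def\<close>)
      then show "c \<le> 1 / (real p - 1)" using xy(4) m(3) by simp
    next
      obtain a where a: "a \<in> U" using U_nonempty by blast
      then have a1: "a ^ n = 1" by (simp add: U_def)
      then have a0: "a \<noteq> 0" using n0 by (auto simp: zero_power)
      obtain m where m: "n = m * p" using p(3) by (metis dvdE mult.commute)
      have m0: "m > 0" using m n0 by (cases m) auto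
      have y: "z ^ m \<in> prim_roots p" using prim_roots_power_mult[of z m p] z m m0 by simp
      let ?y = "z ^ m"
      have y0: "?y \<noteq> 0" using prim_roots_nonzero[OF y] p2 by simp
      have yn: "?y ^ n = 1" using prim_roots_power_eq_1_iff[OF y] p(3) by blast
      have y1: "?y \<noteq> 1" "?y \<noteq> -1"
        using prim_roots_power_eq_1_iff[OF y, of 1] prim_roots_power_eq_1_iff[OF y, of 2] p2
        by (auto dest: dvd_imp_le)
      define b0 where "b0 = a / ?y"
      have b01: "b0 ^ n = 1" using a1 yn by (simp add: b0_def power_divide)
      have ab0: "a / b0 \<in> prim_roots p" using y a0 by (simp add: b0_def)
      \<comment> \<open>One of \<open>b0\<close> and \<open>- b0\<close> is selected, with the same
        coherence; both differ from \<open>a\<close> because \<open>?y\<close> has order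
        \<open>p > 2\<close>.\<close>
      have "\<exists>b\<in>U. a \<noteq> b \<and> coherence (mink a) (mink b) = coherence (mink a) (mink b0)"
      proof (cases "b0 \<in> U")
        case True
        have "a \<noteq> b0" using y1(1) a0 y0 by (auto simp: b0_def field_simps)
        then show ?thesis using True by blast
      next
        case False
        then have "- b0 \<in> U" using U_minus_iff[OF b01] by blast
        moreover have "a \<noteq> - b0"
        proof
          assume "a = - b0"
          then have "a * ?y = a * (- 1)" using y0 by (simp add: b0_def field_simps)
          then show False using a0 y1(2) by (metis mult_cancel_left)
        qed
        moreover have "coherence (mink a) (mink (- b0)) = coherence (mink a) (mink b0)"
          using coherence_mink_minus[OF b01] by simp
        ultimately show ?thesis by blast
      qed
      then obtain b where b: "b \<in> U" "a \<noteq> b" "coherence (mink a) (mink b) = coh p"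
        using coherence_mink[OF a1 b01 ab0] by auto
      have "coh p = 1 / (real p - 1)"
        using p2 by (simp add: coh_def squarefree_prime[OF p(1)] totient_prime[OF p(1)] of_nat_diff)
      moreover have "mink a \<noteq> mink b" using inj_onD[OF inj_on_mink_U _ a b(1)] b(2) by blast
      ultimately show "1 / (real p - 1) \<in> ?S" using a b by (intro CollectI exI[of _ "mink a"] exI[of _ "mink b"]) (auto simp: T_iff)
    qed
    then show ?thesis using False by (simp add: max_coherence_def p_def)
  qed
qed

end

end

subsection \<open>Lattice determinants\<close>

lemma lattice_basis_change:
  assumes B: "lattice_basis d L B" and B': "lattice_basis d L B'"
  shows "\<exists>U :: int mat. U \<in> carrier_mat d d \<and> det B = det B' * of_int (det U)"
proof -
  have Bc: "B \<in> carrier_mat d d" and B'c: "B' \<in> carrier_mat d d" using B B' by (auto simp: lattice_basis_def)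
  have "\<exists>u. u \<in> carrier_vec d \<and> col B j = B' *\<^sub>v map_vec of_int u" if j: "j < d" for j
  proof -
    have "map_vec real_of_int (unit_vec d j) = unit_vec d j" by (auto simp: unit_vec_def)
    then have "col B j = B *\<^sub>v map_vec of_int (unit_vec d j)"
      using Bc j by (intro eq_vecI) auto
    then have "col B j \<in> L" using B unfolding lattice_basis_def by (auto intro!: exI[of _ "unit_vec d j"])
    then show ?thesis using B' unfolding lattice_basis_def by blast
  qed
  then obtain u :: "nat \<Rightarrow> int vec" where u: "\<And>j. j < d \<Longrightarrow> u j \<in> carrier_vec d"
    "\<And>j. j < d \<Longrightarrow> col B j = B' *\<^sub>v map_vec of_int (u j)" by metis
  define U where "U = mat d d (\<lambda>(i, j). u j $ i)"
  have Uc: "U \<in> carrier_mat d d" by (simp add: U_def)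
  have "B = B' * map_mat of_int U"
  proof (rule mat_col_eqI)
    fix j assume "j < dim_col (B' * map_mat real_of_int U)"
    then have j: "j < d" by (simp add: U_def)
    have "col (map_mat real_of_int U) j = map_vec of_int (u j)"
      using j u(1)[OF j] by (intro eq_vecI) (auto simp: U_def)
    then show "col B j = col (B' * map_mat of_int U) j"
      using u(2)[OF j] col_mult2[OF B'c _ j, of "map_mat of_int U"] Uc by simp
  qed (use Bc B'c in \<open>auto simp: U_def\<close>)
  then have "det B = det B' * det (map_mat of_int U)" using det_mult[OF B'c, of "map_mat of_int U"] Uc by simp
  then show ?thesis using Uc by auto
qed

lemma lattice_basis_abs_det_unique:
  assumes B: "lattice_basis d L B" and B': "lattice_basis d L B'"
  shows "\<bar>det B\<bar> = \<bar>det B'\<bar>"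
proof -
  obtain U U' :: "int mat" where U: "det B = det B' * of_int (det U)" "det B' = det B * of_int (det U')"
    using lattice_basis_change[OF B B'] lattice_basis_change[OF B' B] by blast
  have "det B = det B * of_int (det U' * det U)" using U by simp
  then have "real_of_int (det U' * det U) = 1" using B by (simp add: lattice_basis_def)
  then have "det U' * det U = 1" by (simp only: of_int_eq_1_iff)
  then have "\<bar>det U\<bar> = 1" by (metis abs_mult abs_one abs_zmult_eq_1 mult.commute)
  then show ?thesis using U(1) by (simp add: abs_mult flip: of_int_abs)
qed

lemma lattice_det_eq: "lattice_basis d L B \<Longrightarrow> lattice_det d L = \<bar>det B\<bar>"
  unfolding lattice_det_def using lattice_basis_abs_det_unique by (intro the_equality) blast+

text \<open>Column operations turn the monomials into the Newton basis, for which the matrix is lower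
  triangular.\<close>
lemma det_vandermonde:
  fixes x :: "nat \<Rightarrow> complex"
  shows "det (mat d d (\<lambda>(a, j). x a ^ j)) = (\<Prod>a<d. \<Prod>k<a. x a - x k)"
proof -
  define p where "p j = (\<Prod>k<j. [:- x k, 1:])" for j
  have deg: "degree (p j) = j" for j unfolding p_def by (subst degree_prod_eq_sum_degree) auto
  have lc: "coeff (p j) j = 1" for j
  proof -
    have "lead_coeff (p j) = 1" unfolding p_def by (simp add: lead_coeff_prod)
    then show ?thesis by (simp add: deg)
  qed
  define V where "V = mat d d (\<lambda>(a, j). x a ^ j)"
  define C where "C = mat d d (\<lambda>(i, j). coeff (p j) i)"
  define W where "W = mat d d (\<lambda>(a, j). poly (p j) (x a))"
  have car: "V \<in> carrier_mat d d" "C \<in> carrier_mat d d" "W \<in> carrier_mat d d"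
    by (simp_all add: V_def C_def W_def)
  have "W = V * C"
  proof (rule eq_matI)
    fix a j assume "a < dim_row (V * C)" "j < dim_col (V * C)"
    then have aj: "a < d" "j < d" by (simp_all add: V_def C_def)
    have "poly (p j) (x a) = (\<Sum>i\<le>j. coeff (p j) i * x a ^ i)" by (simp add: poly_altdef deg)
    also have "\<dots> = (\<Sum>i\<in>{0..<d}. coeff (p j) i * x a ^ i)"
      using aj by (intro sum.mono_neutral_left) (auto simp: coeff_eq_0 deg)
    finally show "W $$ (a, j) = (V * C) $$ (a, j)"
      using aj by (simp add: W_def V_def C_def scalar_prod_def mult.commute)
  qed (auto simp: W_def V_def C_def)
  then have "det W = det V * det C" using det_mult[OF car(1,2)] by simp
  moreover have "det C = 1"
  proof -
    have "upper_triangular C" by (auto simp: C_def upper_triangular_def coeff_eq_0 deg)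
    then show ?thesis using det_upper_triangular[OF _ car(2)]
      by (simp add: prod_list_diag_prod) (simp add: C_def lc)
  qed
  moreover have "det W = (\<Prod>a<d. \<Prod>k<a. x a - x k)"
  proof -
    have "det W = prod_list (diag_mat W)"
    proof (rule det_lower_triangular[OF _ car(3)])
      fix i j assume "i < j" "j < d"
      then show "W $$ (i, j) = 0" by (auto simp: W_def p_def poly_prod)
    qed
    then show ?thesis by (simp add: prod_list_diag_prod W_def p_def poly_prod atLeast0LessThan)
  qed
  ultimately show ?thesis by (simp add: V_def)
qed

lemma prod_diff_norm_square:
  fixes x :: "nat \<Rightarrow> complex"
  shows "(norm (\<Prod>a<d. \<Prod>k<a. x a - x k))\<^sup>2 = (\<Prod>a<d. \<Prod>b\<in>{..<d} - {a}. norm (x a - x b))"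
proof (induction d)
  case (Suc d)
  have "(\<Prod>a<Suc d. \<Prod>b\<in>{..<Suc d} - {a}. norm (x a - x b)) =
      (\<Prod>a<d. \<Prod>b\<in>{..<Suc d} - {a}. norm (x a - x b)) * (\<Prod>b<d. norm (x d - x b))"
    by (simp add: lessThan_Suc)
  also have "(\<Prod>a<d. \<Prod>b\<in>{..<Suc d} - {a}. norm (x a - x b)) =
      (\<Prod>a<d. norm (x d - x a) * (\<Prod>b\<in>{..<d} - {a}. norm (x a - x b)))"
  proof (rule prod.cong[OF refl])
    fix a assume "a \<in> {..<d}"
    then have "{..<Suc d} - {a} = insert d ({..<d} - {a})" by auto
    then show "(\<Prod>b\<in>{..<Suc d} - {a}. norm (x a - x b)) = norm (x d - x a) * (\<Prod>b\<in>{..<d} - {a}. norm (x a - x b))"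
      by (simp add: norm_minus_commute)
  qed
  finally show ?case using Suc by (simp add: prod.distrib norm_mult power_mult_distrib power2_eq_square prod_norm mult_ac)
qed simp

section \<open>Determinant and orthogonality defect of the cyclotomic lattice\<close>

context cyclotomic_embeddings
begin

definition B where "B = mat d d (\<lambda>(i, j). mink (z ^ j) $ i)"

lemma B_carrier [simp]: "B \<in> carrier_mat d d" "dim_row B = d" "dim_col B = d"
  by (simp_all add: B_def)

lemma col_B: "j < d \<Longrightarrow> col B j = mink (z ^ j)"
  by (intro eq_vecI) (auto simp: B_def)

lemma B_mult_int_vec:
  assumes c: "c \<in> carrier_vec d"
  shows "B *\<^sub>v map_vec of_int c = mink (\<Sum>j<d. of_int (c $ j) * z ^ j)"
proof (rule eq_vecI)
  fix i assume "i < dim_vec (mink (\<Sum>j<d. of_int (c $ j) * z ^ j))"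
  then have i: "i < d" "i div 2 < r" using d_eq by auto
  let ?P = "\<Sum>j<d. monom (of_int (c $ j)) j"
  have P: "rpoly ?P x = (\<Sum>j<d. of_int (c $ j) * x ^ j)" for x by (simp add: rpoly_sum)
  have e1: "\<tau> (i div 2) (\<Sum>j<d. of_int (c $ j) * z ^ j) = (\<Sum>j<d. of_int (c $ j) * \<tau> (i div 2) z ^ j)"
    using \<tau>_rpoly[OF i(2), of ?P] unfolding P .
  have e2: "\<tau> (i div 2) (z ^ j) = \<tau> (i div 2) z ^ j" for j
    using \<tau>_rpoly[OF i(2), of "monom 1 j"] by simp
  have "(B *\<^sub>v map_vec of_int c) $ i = (\<Sum>j<d. of_int (c $ j) * mink (z ^ j) $ i)"
    using i c by (simp add: B_def scalar_prod_def atLeast0LessThan mult.commute)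
  also have "\<dots> = mink (\<Sum>j<d. of_int (c $ j) * z ^ j) $ i"
    using i by (auto simp: mink_index e1 e2)
  finally show "(B *\<^sub>v map_vec of_int c) $ i = mink (\<Sum>j<d. of_int (c $ j) * z ^ j) $ i" .
qed simp

text \<open>Compare Gram matrices: \<open>transpose_mat B * B\<close> is half of
  \<open>transpose_mat V * map_mat cnj V\<close>, with \<open>V\<close> the Vandermonde matrix at
  the primitive roots. The squared norm of \<open>det V\<close> is the absolute
  discriminant.\<close>

lemma det_B_square: "(det B)\<^sup>2 = (ramified_prod n / 2) ^ d"
proof -
  interpret cnj: comm_ring_hom cnj by unfold_locales auto
  obtain h where h: "bij_betw h {0..<d} (prim_roots n)"
    using ex_bij_betw_nat_finite[of "prim_roots n"] n0 by (auto simp: card_prim_roots)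
  define V where "V = mat d d (\<lambda>(a, j). h a ^ j)"
  have V: "V \<in> carrier_mat d d" by (simp add: V_def)
  have "map_mat complex_of_real (transpose_mat B * B) = (1 / 2) \<cdot>\<^sub>m (transpose_mat V * map_mat cnj V)"
  proof (rule eq_matI)
    fix i j assume "i < dim_row ((1 / 2) \<cdot>\<^sub>m (transpose_mat V * map_mat cnj V))"
      "j < dim_col ((1 / 2) \<cdot>\<^sub>m (transpose_mat V * map_mat cnj V))"
    then have ij: "i < d" "j < d" by (simp_all add: V_def)
    have "map_mat complex_of_real (transpose_mat B * B) $$ (i, j) =
        of_real (mink (rpoly (monom 1 i) z) \<bullet> mink (rpoly (monom 1 j) z))"
      using ij by (simp add: col_B)
    also have "\<dots> = 1 / 2 * (\<Sum>w\<in>prim_roots n. w ^ i * cnj (w ^ j))" unfolding inner_mink by simp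
    also have "(\<Sum>w\<in>prim_roots n. w ^ i * cnj (w ^ j)) = (\<Sum>a\<in>{0..<d}. h a ^ i * cnj (h a ^ j))"
      using sum.reindex_bij_betw[OF h, of "\<lambda>w. w ^ i * cnj (w ^ j)"] by simp
    finally show "map_mat complex_of_real (transpose_mat B * B) $$ (i, j) =
        ((1 / 2) \<cdot>\<^sub>m (transpose_mat V * map_mat cnj V)) $$ (i, j)"
      using ij by (simp add: V_def scalar_prod_def)
  qed (auto simp: V_def)
  then have "det (map_mat complex_of_real (transpose_mat B * B)) =
      det ((1 / 2) \<cdot>\<^sub>m (transpose_mat V * map_mat cnj V))" by (rule arg_cong)
  then have "complex_of_real (det B * det B) = (1 / 2) ^ d * (det V * cnj (det V))"
    using V by (simp add: det_mult[of _ d] det_transpose[of _ d])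
  also have "\<dots> = complex_of_real ((1 / 2) ^ d * (norm (det V))\<^sup>2)"
    by (simp flip: complex_norm_square)
  finally have 1: "det B * det B = (1 / 2) ^ d * (norm (det V))\<^sup>2" by (simp only: of_real_eq_iff)
  have "(norm (det V))\<^sup>2 = (\<Prod>a<d. \<Prod>b\<in>{..<d} - {a}. norm (h a - h b))"
    unfolding V_def det_vandermonde by (rule prod_diff_norm_square)
  also have "\<dots> = (\<Prod>a<d. \<Prod>y\<in>prim_roots n - {h a}. norm (h a - y))"
  proof (rule prod.cong[OF refl])
    fix a assume "a \<in> {..<d}"
    then have "bij_betw h ({..<d} - {a}) (prim_roots n - {h a})"
      using h by (intro bij_betw_DiffI) (auto simp: atLeast0LessThan bij_betw_def)
    from prod.reindex_bij_betw[OF this, of "\<lambda>y. norm (h a - y)"]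
    show "(\<Prod>b\<in>{..<d} - {a}. norm (h a - h b)) = (\<Prod>y\<in>prim_roots n - {h a}. norm (h a - y))" .
  qed
  also have "\<dots> = diff_prod (prim_roots n)"
    unfolding diff_prod_def
    using prod.reindex_bij_betw[OF h, of "\<lambda>x. \<Prod>y\<in>prim_roots n - {x}. norm (x - y)"]
    by (simp add: atLeast0LessThan)
  also have "\<dots> = ramified_prod n ^ d" by (rule diff_prod_prim_roots[OF n0])
  finally show ?thesis using 1 by (simp add: power2_eq_square power_divide)
qed

lemma lattice_basis_B: "lattice_basis d L B"
proof -
  have "(det B)\<^sup>2 > 0" unfolding det_B_square using ramified_prod_pos[of n] by simp
  then have "det B \<noteq> 0" by auto
  moreover have "L = {B *\<^sub>v map_vec of_int c | c. c \<in> (carrier_vec d :: int vec set)}"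
  proof (intro equalityI subsetI)
    fix v assume "v \<in> L"
    then obtain c where v: "v = mink (\<Sum>i<d. of_int (c i) * z ^ i)"
      unfolding L_def int_adj_prim_root_eq[OF z n0] by auto
    have "v = B *\<^sub>v map_vec of_int (vec d c)" by (subst B_mult_int_vec) (simp_all add: v)
    then show "v \<in> {B *\<^sub>v map_vec of_int c | c. c \<in> (carrier_vec d :: int vec set)}"
      by (intro CollectI exI[of _ "vec d c"]) simp
  next
    fix v assume "v \<in> {B *\<^sub>v map_vec of_int c | c. c \<in> (carrier_vec d :: int vec set)}"
    then obtain c :: "int vec" where "c \<in> carrier_vec d" "v = B *\<^sub>v map_vec of_int c" by blast
    then show "v \<in> L" unfolding L_def int_adj_prim_root_eq[OF z n0] by (auto simp: B_mult_int_vec)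
  qed
  ultimately show ?thesis by (simp add: lattice_basis_def)
qed

lemma orth_defect_L: "orth_defect d L = (real d / ramified_prod n) powr (real d / 2)"
proof -
  have R: "ramified_prod n > 0" by (rule ramified_prod_pos)
  have half: "sqrt a ^ d = a powr (real d / 2)" if "a > 0" for a
    using that by (simp add: powr_half_sqrt[symmetric] powr_powr flip: powr_realpow)
  have "lattice_det d L = sqrt ((det B)\<^sup>2)" using lattice_det_eq[OF lattice_basis_B] by simp
  also have "\<dots> = sqrt (ramified_prod n / 2) ^ d" unfolding det_B_square by (simp add: real_sqrt_power)
  also have "\<dots> = (ramified_prod n / 2) powr (real d / 2)" by (rule half) (use R in simp)
  finally have det: "lattice_det d L = (ramified_prod n / 2) powr (real d / 2)" .
  \<comment> \<open>Minimality gives every column the norm \<open>sqrt (real d / 2)\<close>, so the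
    value is the same for all admissible bases; the halves cancel against those in the
    determinant.\<close>
  have val: "(\<Prod>j<d. eucl_norm (col B' j)) / lattice_det d L = (real d / ramified_prod n) powr (real d / 2)"
    if B': "\<forall>j<d. col B' j \<in> min_vectors d L" for B'
  proof -
    have "eucl_norm (col B' j) = sqrt (real d / 2)" if j: "j < d" for j
    proof -
      have "(eucl_norm (col B' j))\<^sup>2 = real d / 2"
        using B' j unfolding min_vectors_def sq_minimum_L by blast
      moreover have "eucl_norm (col B' j) \<ge> 0" by (simp add: eucl_norm_def scalar_prod_def sum_nonneg)
      ultimately show ?thesis by (metis real_sqrt_unique)
    qed
    then have "(\<Prod>j<d. eucl_norm (col B' j)) = (real d / 2) powr (real d / 2)"
      using half[of "real d / 2"] d0 by simp
    then show ?thesis unfolding det using R d0 by (simp add: powr_divide[symmetric])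
  qed
  have zB: "\<forall>j<d. col B j \<in> min_vectors d L"
  proof (intro allI impI)
    fix j assume j: "j < d"
    have "(z ^ j) ^ n = 1" using z by (metis mult.commute power_mult power_one prim_roots_power_self)
    then show "col B j \<in> min_vectors d L"
      unfolding col_B[OF j] min_vectors_def sq_minimum_L
      using norm_mink_root_unity root_unity_in_int_adj by (auto simp: L_def)
  qed
  show ?thesis unfolding orth_defect_def
  proof (rule the_equality)
    show "\<exists>B. lattice_basis d L B \<and> (\<forall>j<d. col B j \<in> min_vectors d L) \<and>
        (real d / ramified_prod n) powr (real d / 2) = (\<Prod>j<d. eucl_norm (col B j)) / lattice_det d L"
      using lattice_basis_B zB val[OF zB] by (intro exI[of _ B]) simp
  qed (use val in auto)
qed

lemma product_measure_T:
  assumes ev: "even n" and T: "half_selection d L T"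
  shows "product_measure d L T = ereal (real n * (real n - 2) * real d powr (real d / 2 - 1))
               / ereal (2 * (2 ^ omega n - 2) * ramified_prod n powr (real d / 2))"
proof -
  have R: "ramified_prod n powr (real d / 2) > 0" using ramified_prod_pos[of n] by simp
  have dd: "real d > 0" "real n > 2" using d0 n2 by auto
  have D: "real d powr (real d / 2 - 1) = real d powr (real d / 2) / real d"
    using dd by (simp add: powr_diff)
  have O: "orth_defect d L = real d powr (real d / 2) / ramified_prod n powr (real d / 2)"
    unfolding orth_defect_L using dd ramified_prod_pos[of n] by (simp add: powr_divide)
  let ?w = "2 ^ omega n - 2 :: real"
  show ?thesis
  proof (cases "?w = 0")
    \<comment> \<open>For even \<open>n\<close> this means that \<open>n\<close> is a power of 2 and
      the average coherence vanishes; both sides divide a positive real by 0 and are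
      infinite.\<close>
    case True
    then show ?thesis
      unfolding product_measure_def avg_coherence_T[OF ev T] card_T[OF ev T] O
      using dd R by (simp add: ereal_divide divide_ereal_def)
  next
    case False
    have "real n / 2 * (real d powr (real d / 2) / ramified_prod n powr (real d / 2)) /
        (real d * (?w / (real n - 2))) =
      real n * (real n - 2) * (real d powr (real d / 2) / real d) / (2 * ?w * ramified_prod n powr (real d / 2))"
      using False dd R by (simp add: field_simps)
    then show ?thesis
      unfolding product_measure_def avg_coherence_T[OF ev T] card_T[OF ev T] O D
      using False dd R by (simp add: ereal_divide)
  qed
qed

end

section \<open>The even case, and the passage from odd \<open>n\<close> to
  \<open>2 * n\<close>\<close>

lemma exp_in_prim_roots: "n > 0 \<Longrightarrow> exp (2 * of_real pi * \<i> / of_nat n) \<in> prim_roots n"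
  using prim_roots_cis[of n] by (simp add: cis_conv_exp mult_ac)

lemma cyclotomic_theorem_even:
  assumes n: "n > 2" "even n"
    and enum: "conj_pairs_enum (cyclotomic_field n) (totient n div 2) \<tau>"
    and T: "half_selection (totient n) (cyclotomic_lattice n \<tau>) T"
  shows "max_coherence T = (if \<exists>k. n = 2 ^ k then 0 else 1 / (real (LEAST p. prime p \<and> odd p \<and> p dvd n) - 1))"
    and "\<forall>\<alpha>\<in>T. avg_coherence_at T \<alpha> = avg_coherence T"
    and "avg_coherence T = (2 ^ omega n - 2) / (real n - 2)"
    and "orth_defect (totient n) (cyclotomic_lattice n \<tau>) =
      (real (totient n) / ramified_prod n) powr (real (totient n) / 2)"
    and "product_measure (totient n) (cyclotomic_lattice n \<tau>) T =
      ereal (real n * (real n - 2) * real (totient n) powr (real (totient n) / 2 - 1))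
               / ereal (2 * (2 ^ omega n - 2) * ramified_prod n powr (real (totient n) / 2))"
proof -
  define z where "z = exp (2 * of_real pi * \<i> / of_nat n)"
  have n0: "n > 0" using n by simp
  have z: "z \<in> prim_roots n" unfolding z_def by (rule exp_in_prim_roots[OF n0])
  interpret cyclotomic_embeddings n \<tau> z
    using n z enum by unfold_locales (simp_all add: cyclotomic_field_def z_def)
  have L: "cyclotomic_lattice n \<tau> = L"
    unfolding cyclotomic_lattice_def L_def ring_of_integers_prim_root[OF z n0, symmetric]
    by (simp add: cyclotomic_field_def z_def)
  note T' = T[unfolded L]
  show "max_coherence T = (if \<exists>k. n = 2 ^ k then 0 else 1 / (real (LEAST p. prime p \<and> odd p \<and> p dvd n) - 1))"
    by (rule max_coherence_T[OF n(2) T'])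
  show "\<forall>\<alpha>\<in>T. avg_coherence_at T \<alpha> = avg_coherence T"
    using avg_coherence_at_T[OF n(2) T'] avg_coherence_T[OF n(2) T'] by simp
  show "avg_coherence T = (2 ^ omega n - 2) / (real n - 2)"
    by (rule avg_coherence_T[OF n(2) T'])
  show "orth_defect (totient n) (cyclotomic_lattice n \<tau>) =
      (real (totient n) / ramified_prod n) powr (real (totient n) / 2)"
    unfolding L by (rule orth_defect_L)
  show "product_measure (totient n) (cyclotomic_lattice n \<tau>) T =
      ereal (real n * (real n - 2) * real (totient n) powr (real (totient n) / 2 - 1))
               / ereal (2 * (2 ^ omega n - 2) * ramified_prod n powr (real (totient n) / 2))"
    unfolding L by (rule product_measure_T[OF n(2) T'])
qed

lemma rat_adjoin_mono:
  assumes x: "x \<in> prim_roots m" "m > 0" and y: "y \<in> prim_roots n" "n > 0" and eq: "x = rpoly q y"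
  shows "rat_adjoin x \<subseteq> rat_adjoin y"
proof
  fix v assume "v \<in> rat_adjoin x"
  then obtain p where "v = rpoly p x" by (auto simp: rat_adjoin_prim_root[OF x])
  then have "v = rpoly (pcompose p q) y" by (simp add: eq)
  then show "v \<in> rat_adjoin y" unfolding rat_adjoin_prim_root[OF y] by (rule range_eqI)
qed

text \<open>For \<open>n = 2 * m + 1\<close> and \<open>z\<close> of order \<open>2 * n\<close>,
  \<open>z ^ n = -1\<close> gives \<open>z = - ((z ^ 2) ^ (m + 1))\<close>, and \<open>z ^ 2\<close>
  has order \<open>n\<close>.\<close>

lemma cyclotomic_field_double:
  assumes "odd n"
  shows "cyclotomic_field (2 * n) = cyclotomic_field n"
proof -
  have n0: "n > 0" using assms by (cases n) auto
  define y where "y = exp (2 * of_real pi * \<i> / of_nat n)"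
  define z where "z = exp (2 * of_real pi * \<i> / of_nat (2 * n))"
  have y: "y \<in> prim_roots n" unfolding y_def by (rule exp_in_prim_roots[OF n0])
  have z: "z \<in> prim_roots (2 * n)" unfolding z_def by (rule exp_in_prim_roots) (use n0 in simp)
  have n0': "2 * n > 0" using n0 by simp
  have zy: "z ^ 2 \<in> prim_roots n" using prim_roots_power_mult[OF z] by simp
  obtain b where b: "y = (z ^ 2) ^ b" using prim_roots_coprimeE[OF zy n0 y] by blast
  have zn: "z ^ n = -1"
  proof -
    have "(z ^ n)\<^sup>2 = 1" using z by (metis mult.commute power_mult prim_roots_power_self)
    moreover have "z ^ n \<noteq> 1" using prim_roots_power_eq_1_iff[OF z, of n] n0 by (auto dest: dvd_imp_le)
    ultimately show ?thesis by (simp add: power2_eq_1_iff)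
  qed
  obtain m where m: "n = 2 * m + 1" using assms by (metis oddE)
  have "z = - ((z ^ 2) ^ (m + 1))"
  proof -
    have "(z ^ 2) ^ (m + 1) = z ^ (2 * (m + 1))" by (simp only: power_mult)
    also have "2 * (m + 1) = 2 * m + 1 + 1" by simp
    also have "z ^ (2 * m + 1 + 1) = z ^ n * z" unfolding m by (simp only: power_add power_one_right)
    finally have "(z ^ 2) ^ (m + 1) = z ^ n * z" .
    then show ?thesis using zn by simp
  qed
  moreover obtain c where "z ^ 2 = y ^ c" using prim_roots_coprimeE[OF y n0 zy] by blast
  ultimately have zp: "z = rpoly (- monom 1 (c * (m + 1))) y"
    by (simp only: rpoly_simps power_mult of_rat_1 mult_1)
  have yp: "y = rpoly (monom 1 (2 * b)) z" using b by (simp add: power_mult)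
  have "rat_adjoin z \<subseteq> rat_adjoin y"
    by (rule rat_adjoin_mono[OF z n0' y n0 zp])
  moreover have "rat_adjoin y \<subseteq> rat_adjoin z"
    by (rule rat_adjoin_mono[OF y n0 z n0' yp])
  ultimately show ?thesis unfolding cyclotomic_field_def y_def z_def by blast
qed

theorem theorem1p1:
  fixes n :: nat
    and \<tau> :: "nat \<Rightarrow> complex \<Rightarrow> complex"
    and T :: "real vec set"
  defines "d \<equiv> totient n"
    and "L \<equiv> cyclotomic_lattice n \<tau>"
  assumes "n > 2"
    and "conj_pairs_enum (cyclotomic_field n) (totient n div 2) \<tau>"
    and "half_selection d L T"
  shows
    "max_coherence T =
       (if \<exists>k. n = 2 ^ k then 0
        else 1 / (real (LEAST p. prime p \<and> odd p \<and> p dvd n) - 1))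
     \<and>
     (\<forall>\<alpha>\<in>T. avg_coherence_at T \<alpha> = avg_coherence T) \<and>
     avg_coherence T =
       (if odd n then (2 ^ omega n - 1) / (real n - 1)
        else (2 ^ omega n - 2) / (real n - 2))
     \<and>
     orth_defect d L = (real d / ramified_prod n) powr (real d / 2)
     \<and>
     product_measure d L T =
       (if even n
        then ereal (real n * (real n - 2) * real d powr (real d / 2 - 1))
               / ereal (2 * (2 ^ omega n - 2) * ramified_prod n powr (real d / 2))
        else ereal (real n * (real n - 1) * real d powr (real d / 2 - 1))
               / ereal ((2 ^ omega n - 1) * ramified_prod n powr (real d / 2)))"
proof (cases "even n")
  case True
  then show ?thesis
    using cyclotomic_theorem_even[OF assms(3) True assms(4) assms(5)[unfolded d_def L_def]]
    unfolding d_def L_def by simp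
next
  case False
  have n0: "n > 0" using assms(3) by simp
  have nd: "\<not> 2 dvd n" using False by simp
  have tot: "totient (2 * n) = totient n" using False by (simp add: totient_double)
  have field: "cyclotomic_field (2 * n) = cyclotomic_field n" by (rule cyclotomic_field_double[OF False])
  have lat: "cyclotomic_lattice (2 * n) \<tau> = cyclotomic_lattice n \<tau>"
    by (simp add: cyclotomic_lattice_def tot field)
  have om: "omega (2 * n) = Suc (omega n)"
  proof -
    have "prime_factors (2 * n) = insert 2 (prime_factors n)"
      using n0 by (simp add: prime_factors_product prime_prime_factors)
    moreover have "2 \<notin> prime_factors n" using nd by (simp add: in_prime_factors_iff)
    ultimately show ?thesis by (simp add: omega_def)
  qed
  \<comment> \<open>The factor at the new prime is
    \<open>2 powr (1 - 1 / (2 - 1)) = 1\<close>.\<close>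
  have ram: "ramified_prod (2 * n) = ramified_prod n"
    using ramified_prod_mult_not_dvd[OF two_is_prime_nat nd n0] by simp
  have pow2: "(\<nexists>k. 2 * n = 2 ^ k)" "(\<nexists>k. n = 2 ^ k)"
  proof -
    show 1: "\<nexists>k. n = 2 ^ k"
    proof
      assume "\<exists>k. n = 2 ^ k"
      then obtain k where "n = 2 ^ k" ..
      then show False using False assms(3) by (cases k) auto
    qed
    show "\<nexists>k. 2 * n = 2 ^ k"
    proof
      assume "\<exists>k. 2 * n = 2 ^ k"
      then obtain k where k: "2 * n = 2 ^ k" ..
      then show False using 1 assms(3) by (cases k) auto
    qed
  qed
  have dvd2: "prime p \<and> odd p \<and> p dvd 2 * n \<longleftrightarrow> prime p \<and> odd p \<and> p dvd n" for p
    by (auto simp: prime_dvd_mult_iff dest: primes_dvd_imp_eq[OF _ two_is_prime_nat])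
  have n2: "2 * n > 2" "even (2 * n)" using assms(3) by auto
  \<comment> \<open>Field, totient, lattice, \<open>ramified_prod\<close> and odd prime divisors
    agree for \<open>n\<close> and \<open>2 * n\<close>, so the same \<open>\<tau>\<close> and
    \<open>T\<close> qualify; besides \<open>n\<close> itself only \<open>omega\<close> changes, by
    one.\<close>
  note E = cyclotomic_theorem_even[OF n2, of \<tau> T, unfolded tot field lat om ram dvd2,
      OF assms(4) assms(5)[unfolded d_def L_def]]
  have avg: "(2 ^ Suc (omega n) - 2) / (real (2 * n) - 2) = (2 ^ omega n - 1) / (real n - 1)"
    using assms(3) by (simp add: field_simps)
  \<comment> \<open>Positivity makes the extended-real quotients real ones, in which the factors 2
    cancel.\<close>
  have w: "(2::real) ^ omega n - 1 > 0"
  proof -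
    have "prime_factors n \<noteq> {}" using assms(3) by (auto simp: prime_factorization_empty_iff)
    then have "omega n > 0" by (simp add: omega_def card_gt_0_iff)
    then show ?thesis using one_less_power[of "2::real"] by simp
  qed
  have R: "ramified_prod n powr x > 0" for x using ramified_prod_pos[of n] by simp
  have "ereal (real (2 * n) * (real (2 * n) - 2) * D) / ereal (2 * (2 ^ Suc (omega n) - 2) * ramified_prod n powr x)
      = ereal (real n * (real n - 1) * D) / ereal ((2 ^ omega n - 1) * ramified_prod n powr x)" for D x
  proof -
    have "real (2 * n) * (real (2 * n) - 2) * D / (2 * (2 ^ Suc (omega n) - 2) * ramified_prod n powr x)
      = real n * (real n - 1) * D / ((2 ^ omega n - 1) * ramified_prod n powr x)"
      using w R[of x] by (simp add: field_simps)
    then show ?thesis using w R[of x] by (simp add: ereal_divide)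
  qed
  then show ?thesis using E avg pow2 False unfolding d_def L_def by simp
qed

end
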